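(* Let $G$ be a connected planar graph and let $k,l$ be integers greater than one. Then the following holds: (i) If the degrees of all faces of $G$ are divisible by $k$, and the degrees of all vertices of $G$ are divisible by $l$ except for two vertices with degrees $u$ and $v$, then $\gcd(u,l)=\gcd(v,l)$. (ii) If the degrees of all faces of $G$ are divisible by $k$ except for one face with degree $u$, and the degrees of all vertices of $G$ are divisible by $l$ except for one vertex with degree $v$, then $k/\gcd(u,k)=l/\gcd(v,l)$.
   Context: Planar graphs are finite graphs embedded in the sphere; multiple edges and loops are allowed, a loop contributing two units to the degree of its endpoint. The degree of a face is the number of edges surrounding it, where an edge having the same face on both of its sides is counted twice. The exceptional vertices and faces are those whose degrees are not divisible by the corresponding number. *)

theory Defs
  imports "HOL-Analysis.Analysis"
begin

abbreviation two_sphere :: "(real^3) set" where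
  "two_sphere \<equiv> sphere 0 1"

text \<open>A drawing of a graph: vertices are points, and each edge label carries the curve
  that draws it. Distinct labels may join the same vertices (multiple edges), and the curve of an
  edge may be closed (a loop). The parametrisation of a curve orients the edge, but nothing below
  depends on that orientation.\<close>

record 'e drawing =
  verts :: "(real^3) set"
  edges :: "'e set"
  curve :: "'e \<Rightarrow> real \<Rightarrow> real^3"

definition drawn_set :: "'e drawing \<Rightarrow> (real^3) set" where
  "drawn_set G = verts G \<union> (\<Union>e\<in>edges G. path_image (curve G e))"

text \<open>\<^const>\<open>simple_path\<close> covers both arcs and simple closed curves. The last two conditions say
  that the interior of an edge contains no vertex and no point of another edge.\<close>

definition planar_graph :: "'e drawing \<Rightarrow> bool" where
  "planar_graph G \<longleftrightarrow>
     finite (verts G) \<and> finite (edges G) \<and>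
     drawn_set G \<subseteq> two_sphere \<and>
     (\<forall>e\<in>edges G. simple_path (curve G e)) \<and>
     (\<forall>e\<in>edges G. path_image (curve G e) \<inter> verts G
                    = {pathstart (curve G e), pathfinish (curve G e)}) \<and>
     (\<forall>e\<in>edges G. \<forall>f\<in>edges G. e \<noteq> f \<longrightarrow>
        path_image (curve G e) \<inter> path_image (curve G f) \<subseteq> verts G)"

definition adjacency :: "'e drawing \<Rightarrow> ((real^3) \<times> (real^3)) set" where
  "adjacency G = (\<Union>e\<in>edges G. {(pathstart (curve G e), pathfinish (curve G e)),
                                 (pathfinish (curve G e), pathstart (curve G e))})"

definition connected_graph :: "'e drawing \<Rightarrow> bool" where
  "connected_graph G \<longleftrightarrow> (\<forall>x\<in>verts G. \<forall>y\<in>verts G. (x, y) \<in> (adjacency G)\<^sup>*)"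

text \<open>A loop contributes to both summands.\<close>

definition vertex_degree :: "'e drawing \<Rightarrow> real^3 \<Rightarrow> nat" where
  "vertex_degree G x = card {e \<in> edges G. pathstart (curve G e) = x}
                     + card {e \<in> edges G. pathfinish (curve G e) = x}"

definition faces :: "'e drawing \<Rightarrow> (real^3) set set" where
  "faces G = components (two_sphere - drawn_set G)"

text \<open>The faces having the edge on their boundary. A face is disjoint from the drawn graph, so
  its boundary relative to the sphere is met by an edge exactly where its closure is; the
  \<^const>\<open>frontier\<close> in the ambient space would be the whole closure anyway.\<close>

definition faces_at :: "'e drawing \<Rightarrow> 'e \<Rightarrow> (real^3) set set" where
  "faces_at G e = {F \<in> faces G. path_image (curve G e) \<subseteq> closure F}"

text \<open>An edge has the same face on both of its sides when no other face borders it.\<close>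

definition face_degree :: "'e drawing \<Rightarrow> (real^3) set \<Rightarrow> nat" where
  "face_degree G F =
     (\<Sum>e | e \<in> edges G \<and> F \<in> faces_at G e. if faces_at G e = {F} then 2 else 1)"

definition exceptional_vertices :: "'e drawing \<Rightarrow> nat \<Rightarrow> (real^3) set" where
  "exceptional_vertices G l = {x \<in> verts G. \<not> l dvd vertex_degree G x}"

definition exceptional_faces :: "'e drawing \<Rightarrow> nat \<Rightarrow> (real^3) set set" where
  "exceptional_faces G k = {F \<in> faces G. \<not> k dvd face_degree G F}"

end

(*
A drawing without exceptional vertices or faces carries, away from the exceptional ones, the local
structure of the (2,k,l) triangle group: turning around a vertex is an element a of order l, crossing
an edge is an involution c, and turning around a face is a c, of order k. The monodromy around an
exceptional vertex of degree u is conjugate to a^u, of order l / gcd(u,l), around an exceptional face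
it is conjugate to (a c)^u, of order k / gcd(u,k). On a sphere with two punctures these two orders
agree.

Instead of fundamental groups the proof counts. Take a finite quotient H of the triangle group and
lift the combinatorial map to flags x H. The genus inequality V - E + F <= 2 C for permutations,
applied to the lifted map, together with Euler's formula below, bounds the sum of the inverse orders
of the two monodromies by twice each of them.

To obtain the combinatorial map from continuous curves, the sphere is punctured and mapped to the
plane. Around a point of the drawing the edges are cut off at a small circle and ordered by the angle
of their end points; consecutive ones bound Jordan domains, and Janiszewski's theorem shows that near
the point these domains are locally connected and cover everything off the drawing. No orientation is
transported along edges: a flag is an edge end with a side, and sides at the two ends of an edge are
matched by the faces they lie in. If both sides lie in the same face either matching will do, because
Euler's inequality for the drawing leaves no room for a wrong one.
*)

theory Submission
  imports Defs "HOL-Complex_Analysis.Contour_Integration" "HOL-Combinatorics.Permutations"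
begin

section \<open>Components of a finite relation and cycles of a permutation\<close>

text \<open>Put \<gamma> v = gcd (deg v) l / l and \<kappa> F = gcd (fdeg F) k / k: the inverse
  orders of the monodromies, equal to 1 at everything that is not exceptional. Flags carry both
  directions of turning, so over \<open>v\<close> there are \<open>2 * card H * \<gamma> v\<close>
  lifted cycles, and likewise over a face. If the lift has C components, the genus inequality says
  that all \<gamma> and \<kappa> add up to at most E + C / card H. Every component meets the fibre
  over each vertex and each face, so C / card H \<le> 2g for g any one of the numbers \<gamma> v,
  \<kappa> F. With E + 2 \<le> V + F the deficits 1 - \<gamma> and 1 - \<kappa> add up to at least 2
  - 2g. For just two exceptional items with values x and y this reads x + y \<le> 2g, and the
  choices g = x and g = y force x = y. The group has to act on itself: among the points that
  \<open>a\<close> permutes there may be fixed ones, whose cycles do not show the order of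
  \<open>a\<close>, whereas all cycles of left multiplication by \<open>a\<close> have length
  \<open>l\<close>.\<close>

definition conn :: "('a \<times> 'a) set \<Rightarrow> ('a \<times> 'a) set" where
  "conn r = (r \<union> r\<inverse>)\<^sup>*"

text \<open>Classes are formed in the whole type and only their representatives are restricted to
  \<open>A\<close>, so one relation can be compared on different sets.\<close>

definition ncomp :: "('a \<times> 'a) set \<Rightarrow> 'a set \<Rightarrow> nat" where
  "ncomp r A = card (A // conn r)"

lemma conn_refl [simp]: "(x, x) \<in> conn r" by (simp add: conn_def)

lemma conn_sym: "(x, y) \<in> conn r \<Longrightarrow> (y, x) \<in> conn r"
  unfolding conn_def by (metis converse_Un converse_converse rtrancl_converseD sup_commute)

lemma conn_trans [trans]: "\<lbrakk>(x, y) \<in> conn r; (y, z) \<in> conn r\<rbrakk> \<Longrightarrow> (x, z) \<in> conn r"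
  unfolding conn_def by (rule rtrancl_trans)

lemma conn_base: "(x, y) \<in> r \<Longrightarrow> (x, y) \<in> conn r"
  unfolding conn_def by blast

lemma equiv_conn: "equiv UNIV (conn r)"
  by (intro equivI refl_onI symI transI) (auto intro: conn_sym conn_trans)

lemma conn_least:
  assumes "r \<subseteq> conn r'" shows "conn r \<subseteq> conn r'"
proof -
  have "(x, y) \<in> conn r'" if "(x, y) \<in> r \<union> r\<inverse>" for x y
    using that assms conn_sym[of y x r'] by auto
  then have "r \<union> r\<inverse> \<subseteq> conn r'" by auto
  then have "conn r \<subseteq> (conn r')\<^sup>*" unfolding conn_def[of r] by (rule rtrancl_mono)
  then show ?thesis by (simp add: conn_def)
qed

lemma conn_class_eq: "conn r `` {x} = conn r `` {y} \<longleftrightarrow> (x, y) \<in> conn r"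
  using eq_equiv_class_iff[OF equiv_conn, of x y r] by simp

text \<open>A walk that uses the new edge several times can be shortened, so a single passage in one
  of the two directions suffices.\<close>

lemma conn_insert:
  assumes "(a, b) \<in> conn (insert (x, y) r)"
  shows "(a, b) \<in> conn r \<or> (a, x) \<in> conn r \<and> (y, b) \<in> conn r \<or> (a, y) \<in> conn r \<and> (x, b) \<in> conn r"
proof -
  let ?S = "{(a, b). (a, b) \<in> conn r \<or> (a, x) \<in> conn r \<and> (y, b) \<in> conn r \<or> (a, y) \<in> conn r \<and> (x, b) \<in> conn r}"
  have ext: "(a, d) \<in> ?S" if "(a, b) \<in> ?S" "(b, d) \<in> insert (x, y) r \<union> (insert (x, y) r)\<inverse>" for a b d
  proof -
    have "(b, d) \<in> conn r \<or> b = x \<and> d = y \<or> b = y \<and> d = x"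
      using that(2) conn_base[of b d r] conn_sym[OF conn_base, of d b r] by auto
    then show ?thesis
    proof (elim disjE)
      assume "(b, d) \<in> conn r"
      then show ?thesis using that(1) conn_trans[of _ b r d] by auto
    qed (use that(1) in auto)
  qed
  have "(a, b) \<in> ?S"
    using assms unfolding conn_def[of "insert (x, y) r"]
  proof (induction rule: rtrancl_induct)
    case (step b d)
    then show ?case using ext by blast
  qed simp
  then show ?thesis by simp
qed

lemma finite_comps: "finite A \<Longrightarrow> finite (A // conn r)"
  by (simp add: quotient_def)

lemma comps_image:
  assumes "r \<subseteq> conn r'"
  shows "A // conn r' = (\<lambda>C. conn r' `` C) ` (A // conn r)"
proof -
  have "conn r' `` (conn r `` {x}) = conn r' `` {x}" for x
    using conn_least[OF assms] conn_trans[of x _ r'] by (auto intro: ImageI)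
  then show ?thesis by (auto simp: quotient_def image_iff)
qed

lemma ncomp_mono:
  assumes "finite A" "r \<subseteq> conn r'"
  shows "ncomp r' A \<le> ncomp r A"
  unfolding ncomp_def comps_image[OF assms(2)] by (rule card_image_le[OF finite_comps[OF assms(1)]])

lemma subset_conn: "r \<subseteq> r' \<Longrightarrow> r \<subseteq> conn r'" using conn_base[of _ _ r'] by auto

lemma insert_conn: "r \<subseteq> conn (insert e r)" by (rule subset_conn) blast

lemma class_insert: "conn (insert e r) `` (conn r `` {a}) = conn (insert e r) `` {a}"
  using conn_least[OF insert_conn[of r e]] conn_trans[of a _ "insert e r"] by (auto intro: ImageI)

text \<open>Only the class of \<open>x\<close> can get lost: on the remaining classes the passage to
  the coarser relation is injective.\<close>

lemma ncomp_insert_ge: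
  assumes "finite A"
  shows "ncomp r A \<le> ncomp (insert (x, y) r) A + 1"
proof -
  let ?r = "insert (x, y) r"
  have "inj_on (\<lambda>C. conn ?r `` C) (A // conn r - {conn r `` {x}})"
  proof (rule inj_onI)
    fix C D assume C: "C \<in> A // conn r - {conn r `` {x}}" and D: "D \<in> A // conn r - {conn r `` {x}}"
      and eq: "conn ?r `` C = conn ?r `` D"
    obtain a b where ab: "C = conn r `` {a}" "D = conn r `` {b}" using C D by (auto simp: quotient_def)
    then have "(a, b) \<in> conn ?r" using eq by (simp add: class_insert conn_class_eq)
    moreover have "(a, x) \<notin> conn r" "(x, b) \<notin> conn r"
      using C D ab conn_class_eq[of r a x] conn_class_eq[of r x b] by auto
    ultimately have "(a, b) \<in> conn r" using conn_insert[of a b x y r] by auto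
    then show "C = D" using ab conn_class_eq[of r a b] by simp
  qed
  then have "card (A // conn r - {conn r `` {x}}) = card ((\<lambda>C. conn ?r `` C) ` (A // conn r - {conn r `` {x}}))"
    by (simp add: card_image)
  also have "\<dots> \<le> card ((\<lambda>C. conn ?r `` C) ` (A // conn r))"
    using finite_comps[OF assms] by (intro card_mono) auto
  also have "\<dots> = ncomp ?r A" unfolding ncomp_def comps_image[OF insert_conn] ..
  finally have "card (A // conn r - {conn r `` {x}}) \<le> ncomp ?r A" .
  then show ?thesis unfolding ncomp_def using diff_card_le_card_Diff[of "{conn r `` {x}}" "A // conn r"]
    by simp
qed

lemma ncomp_insert_less:
  assumes "finite A" "x \<in> A" "y \<in> A" "(x, y) \<notin> conn r"
  shows "ncomp (insert (x, y) r) A + 1 \<le> ncomp r A"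
proof -
  let ?r = "insert (x, y) r"
  have xA: "conn r `` {x} \<in> A // conn r" using assms by (auto simp: quotient_def)
  have yA: "conn r `` {y} \<in> A // conn r - {conn r `` {x}}"
    using assms conn_class_eq[of r x y] by (auto simp: quotient_def)
  have "conn ?r `` (conn r `` {x}) = conn ?r `` (conn r `` {y})"
    using conn_base[of x y ?r] by (simp add: class_insert conn_class_eq)
  then have "(\<lambda>C. conn ?r `` C) ` (A // conn r) \<subseteq> (\<lambda>C. conn ?r `` C) ` (A // conn r - {conn r `` {x}})"
  proof (intro image_subsetI)
    fix C assume C: "C \<in> A // conn r"
    show "conn ?r `` C \<in> (\<lambda>C. conn ?r `` C) ` (A // conn r - {conn r `` {x}})"
    proof (cases "C = conn r `` {x}")
      case True
      then show ?thesis using yA \<open>conn ?r `` (conn r `` {x}) = _\<close> by (intro image_eqI[OF _ yA]) simp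
    next
      case False
      then show ?thesis using C by (intro image_eqI[of _ _ C]) auto
    qed
  qed
  then have "ncomp ?r A \<le> card ((\<lambda>C. conn ?r `` C) ` (A // conn r - {conn r `` {x}}))"
    unfolding ncomp_def comps_image[OF insert_conn]
    using finite_comps[OF assms(1)] by (intro card_mono) auto
  also have "\<dots> \<le> card (A // conn r - {conn r `` {x}})"
    using finite_comps[OF assms(1)] by (intro card_image_le) auto
  also have "\<dots> < card (A // conn r)"
    using finite_comps[OF assms(1)] xA by (rule card_Diff1_less)
  finally show ?thesis by (simp add: ncomp_def)
qed

text \<open>Each class has total weight 1. This turns numbers of cycles into sums of inverse cycle
  lengths over points, the form in which lifted cycles are counted.\<close>

lemma ncomp_eq_sum:
  assumes "finite A" "r \<subseteq> A \<times> A"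
  shows "real (ncomp r A) = (\<Sum>x\<in>A. 1 / card (conn r `` {x}))"
proof -
  have sub: "conn r `` {x} \<subseteq> A" if "x \<in> A" for x
  proof -
    have "(x, y) \<in> conn r \<Longrightarrow> y \<in> A" for y
      unfolding conn_def by (induction rule: rtrancl_induct) (use that assms in auto)
    then show ?thesis by auto
  qed
  have "x \<in> \<Union> (A // conn r)" if "x \<in> A" for x using quotientI[OF that, of "conn r"] conn_refl[of x r] by blast
  then have eq: "A = \<Union> (A // conn r)" using sub by (auto simp: quotient_def)
  have "(\<Sum>x\<in>A. 1 / card (conn r `` {x})) = (\<Sum>x\<in>\<Union> (A // conn r). 1 / card (conn r `` {x}))"
    using eq by simp
  also have "\<dots> = (\<Sum>C\<in>A // conn r. \<Sum>x\<in>C. 1 / card (conn r `` {x}))"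
  proof (rule sum.Union_disjoint[unfolded comp_def])
    show "\<forall>C\<in>A // conn r. finite C" using eq assms(1) by (metis Union_upper finite_subset)
    show "\<forall>C\<in>A // conn r. \<forall>D\<in>A // conn r. C \<noteq> D \<longrightarrow> C \<inter> D = {}"
    proof (intro ballI impI)
      fix C D assume "C \<in> A // conn r" "D \<in> A // conn r" "C \<noteq> D"
      moreover have "A // conn r \<subseteq> UNIV // conn r" by (auto simp: quotient_def)
      ultimately show "C \<inter> D = {}" using quotient_disj[OF equiv_conn[of r], of C D] by auto
    qed
  qed
  also have "\<dots> = (\<Sum>C\<in>A // conn r. 1)"
  proof (rule sum.cong[OF refl])
    fix C assume "C \<in> A // conn r"
    then obtain a where a: "a \<in> A" "C = conn r `` {a}" by (auto simp: quotient_def)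
    have "conn r `` {x} = C" if "x \<in> C" for x using that a conn_class_eq[of r a x] by auto
    then have "(\<Sum>x\<in>C. 1 / card (conn r `` {x})) = (\<Sum>x\<in>C. 1 / card C)" by (intro sum.cong) auto
    moreover have "finite C" using a sub[OF a(1)] assms(1) finite_subset by blast
    moreover have "a \<in> C" using a by simp
    ultimately show "(\<Sum>x\<in>C. 1 / card (conn r `` {x})) = 1" by (auto simp: card_gt_0_iff)
  qed
  also have "\<dots> = real (ncomp r A)" by (simp add: ncomp_def)
  finally show ?thesis by simp
qed

section \<open>Cycles of a permutation as components of its graph\<close>

definition graph_on :: "('a \<Rightarrow> 'a) \<Rightarrow> 'a set \<Rightarrow> ('a \<times> 'a) set" where
  "graph_on f A = (\<lambda>x. (x, f x)) ` A"

abbreviation "cycles f A \<equiv> ncomp (graph_on f A) A"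

lemma funpow_in: "\<lbrakk>f ` A \<subseteq> A; x \<in> A\<rbrakk> \<Longrightarrow> (f ^^ n) x \<in> A"
  by (induction n) auto

lemma funpow_conn: "\<lbrakk>f ` A \<subseteq> A; x \<in> A\<rbrakk> \<Longrightarrow> (x, (f ^^ n) x) \<in> conn (graph_on f A)"
proof (induction n)
  case (Suc n)
  then have "((f ^^ n) x, (f ^^ Suc n) x) \<in> graph_on f A" using funpow_in[of f A x n] by (auto simp: graph_on_def)
  then show ?case using Suc conn_base conn_trans by metis
qed simp

lemma period_exists:
  assumes "finite A" "bij_betw f A A" "x \<in> A"
  obtains n where "n > 0" "(f ^^ n) x = x"
proof -
  have im: "f ` A \<subseteq> A" using assms by (simp add: bij_betw_def)
  have "\<not> inj_on (\<lambda>n. (f ^^ n) x) {..card A}"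
  proof
    assume "inj_on (\<lambda>n. (f ^^ n) x) {..card A}"
    then have "card {..card A} \<le> card A"
      using funpow_in[OF im assms(3)] by (intro card_inj_on_le[OF _ _ assms(1)]) auto
    then show False by simp
  qed
  then obtain i j where ij: "i < j" "(f ^^ i) x = (f ^^ j) x" unfolding inj_on_def by (metis linorder_neqE_nat)
  have cancel: "(f ^^ i) x = (f ^^ (i + m)) x \<Longrightarrow> (f ^^ m) x = x" for m
  proof (induction i)
    case (Suc i)
    then have "(f ^^ i) x = (f ^^ (i + m)) x"
      using inj_onD[OF bij_betw_imp_inj_on[OF assms(2)]] funpow_in[OF im assms(3)] by simp
    then show ?case using Suc by blast
  qed simp
  have "(f ^^ (j - i)) x = x" by (rule cancel) (use ij in simp)
  then show ?thesis using ij that[of "j - i"] by simp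
qed

text \<open>Backward steps of the equivalence closure are forward iterates as well, since every
  point of a finite permutation is periodic.\<close>

lemma cycle_class:
  assumes "finite A" "bij_betw f A A" "x \<in> A"
  shows "conn (graph_on f A) `` {x} = range (\<lambda>n. (f ^^ n) x)"
proof
  have im: "f ` A \<subseteq> A" using assms by (simp add: bij_betw_def)
  show "range (\<lambda>n. (f ^^ n) x) \<subseteq> conn (graph_on f A) `` {x}" using funpow_conn[OF im assms(3)] by auto
  have "y \<in> range (\<lambda>n. (f ^^ n) x)" if "(x, y) \<in> conn (graph_on f A)" for y
    using that unfolding conn_def
  proof (induction rule: rtrancl_induct)
    case base then show ?case by (auto intro: range_eqI[of _ _ 0])
  next
    case (step y z)
    then obtain n where n: "y = (f ^^ n) x" by auto
    from step(2) show ?case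
    proof
      assume "(y, z) \<in> graph_on f A"
      then show ?thesis using n by (auto simp: graph_on_def intro: range_eqI[of _ _ "Suc n"])
    next
      assume "(y, z) \<in> (graph_on f A)\<inverse>"
      then have z: "z \<in> A" "f z = y" by (auto simp: graph_on_def)
      obtain m where "m > 0" "(f ^^ m) z = z" using period_exists[OF assms(1,2) z(1)] .
      then have "z = (f ^^ (m - 1)) y" using z(2) by (cases m) (auto simp: funpow_swap1)
      then have "z = (f ^^ (m - 1 + n)) x" using n by (simp only: funpow_add o_apply)
      then show ?thesis by (rule range_eqI)
    qed
  qed
  then show "conn (graph_on f A) `` {x} \<subseteq> range (\<lambda>n. (f ^^ n) x)" by auto
qed

lemma card_cycle_class:
  assumes "finite A" "bij_betw f A A" "x \<in> A" "N > 0" "\<And>n. (f ^^ n) x = x \<longleftrightarrow> N dvd n"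
  shows "card (conn (graph_on f A) `` {x}) = N"
proof -
  have im: "f ` A \<subseteq> A" using assms by (simp add: bij_betw_def)
  have N: "(f ^^ N) x = x" using assms(5)[of N] by simp
  have mod: "(f ^^ n) x = (f ^^ (n mod N)) x" for n
    using N by (rule funpow_mod_eq[symmetric])
  have "range (\<lambda>n. (f ^^ n) x) = (\<lambda>n. (f ^^ n) x) ` {..<N}"
    using mod assms(4) by (auto simp: image_iff) (metis lessThan_iff mod_less_divisor)
  moreover have "inj_on (\<lambda>n. (f ^^ n) x) {..<N}"
  proof -
    have "i = j" if "i \<le> j" "j < N" "(f ^^ i) x = (f ^^ j) x" for i j
    proof -
      have "(f ^^ (N - i + j)) x = (f ^^ (N - i)) ((f ^^ j) x)" by (simp only: funpow_add o_apply)
      also have "\<dots> = (f ^^ (N - i)) ((f ^^ i) x)" using that by simp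
      also have "\<dots> = (f ^^ (N - i + i)) x" by (simp only: funpow_add o_apply)
      also have "\<dots> = x" using that N by simp
      finally have "(f ^^ (N - i + j)) x = x" .
      then have "N dvd (N - i + j)" using assms(5) by blast
      then have "N dvd N + (j - i)" using that by simp
      then have "N dvd j - i" by (simp add: dvd_add_right_iff)
      then show "i = j" using that by (metis diff_is_0_eq dvd_imp_le less_imp_diff_less linorder_not_le order_antisym zero_less_diff)
    qed
    then show ?thesis unfolding inj_on_def by (metis lessThan_iff nle_le)
  qed
  ultimately show ?thesis unfolding cycle_class[OF assms(1-3)] by (simp add: card_image)
qed

section \<open>Composition with a transposition, and the genus inequality\<close>

lemma cycles_transpose_le:
  assumes "finite A" "x \<in> A" "y \<in> A"
  shows "cycles (f \<circ> Transposition.transpose x y) A \<le> cycles f A + 1"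
proof -
  let ?g = "f \<circ> Transposition.transpose x y" and ?r = "insert (x, y) (graph_on (f \<circ> Transposition.transpose x y) A)"
  have xy: "(x, y) \<in> conn ?r" "(y, x) \<in> conn ?r" using conn_base conn_sym by (metis insertI1)+
  have g: "(z, ?g z) \<in> conn ?r" if "z \<in> A" for z using that conn_base[of z "?g z" ?r] by (auto simp: graph_on_def)
  \<comment> \<open>The two permutations differ only in that the images of \<open>x\<close> and
    \<open>y\<close> are exchanged; once \<open>x\<close> and \<open>y\<close> are joined by an
    edge, the difference disappears.\<close>
  have "(z, f z) \<in> conn ?r" if "z \<in> A" for z
  proof (cases "z = x \<or> z = y")
    case True
    then show ?thesis using g[OF assms(2)] g[OF assms(3)] xy conn_trans by (auto simp: Transposition.transpose_def split: if_splits)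
  next
    case False
    then show ?thesis using g[OF that] by simp
  qed
  then have "graph_on f A \<subseteq> conn ?r" by (auto simp: graph_on_def)
  then have "ncomp ?r A \<le> cycles f A" by (rule ncomp_mono[OF assms(1)])
  then show ?thesis using ncomp_insert_ge[OF assms(1), of "graph_on ?g A" x y] by simp
qed

text \<open>The two cycles become one: from \<open>x\<close> the new permutation jumps to
  \<open>f y\<close> and then follows \<open>f\<close>, which never meets \<open>x\<close> and
  therefore runs on until it reaches \<open>y\<close>.\<close>

lemma cycles_transpose_less:
  assumes A: "finite A" "bij_betw f A A" "x \<in> A" "y \<in> A" and ne: "(x, y) \<notin> conn (graph_on f A)"
  shows "cycles (f \<circ> Transposition.transpose x y) A + 1 \<le> cycles f A"
proof -
  let ?g = "f \<circ> Transposition.transpose x y"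
  let ?r = "graph_on ?g A"
  have im: "f ` A \<subseteq> A" using A by (simp add: bij_betw_def)
  have imt: "?g ` A \<subseteq> A" using A im by (auto simp: Transposition.transpose_def)
  have "x \<noteq> y" using ne by auto
  have fyA: "f y \<in> A" using im A by auto
  obtain m where "m > 0" "(f ^^ m) y = y" using period_exists[OF A(1,2,4)] .
  then have ex: "(f ^^ (m - 1)) (f y) = y" by (cases m) (auto simp: funpow_swap1)
  define n where "n = (LEAST n. (f ^^ n) (f y) = y)"
  have n: "(f ^^ n) (f y) = y" "\<And>i. i < n \<Longrightarrow> (f ^^ i) (f y) \<noteq> y"
    using LeastI[of "\<lambda>n. (f ^^ n) (f y) = y", OF ex] not_less_Least[of _ "\<lambda>n. (f ^^ n) (f y) = y"] unfolding n_def by auto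
  have nx: "(f ^^ i) (f y) \<noteq> x" for i
  proof
    assume "(f ^^ i) (f y) = x"
    then have "(f ^^ Suc i) y = x" by (simp add: funpow_swap1)
    then have "(y, x) \<in> conn (graph_on f A)" using funpow_conn[OF im A(4), of "Suc i"] by simp
    then show False using ne conn_sym by metis
  qed
  have "(?g ^^ i) (f y) = (f ^^ i) (f y)" if "i \<le> n" for i
    using that
  proof (induction i)
    case (Suc i)
    then show ?case using n(2)[of i] nx[of i] by simp
  qed simp
  then have "(?g ^^ n) (f y) = y" using n(1) by simp
  moreover have "?g x = f y" by simp
  ultimately have "(?g ^^ Suc n) x = y" by (simp add: funpow_swap1)
  then have xy: "(x, y) \<in> conn ?r" using funpow_conn[OF imt A(3), of "Suc n"] by simp
  have g: "(z, ?g z) \<in> conn ?r" if "z \<in> A" for z using that conn_base[of z "?g z" ?r] by (auto simp: graph_on_def)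
  have "(z, f z) \<in> conn ?r" if "z \<in> A" for z
  proof (cases "z = x \<or> z = y")
    case True
    then show ?thesis using g[OF A(3)] g[OF A(4)] xy conn_sym[OF xy] conn_trans by (auto simp: Transposition.transpose_def split: if_splits)
  next
    case False
    then show ?thesis using g[OF that] by simp
  qed
  then have "insert (x, y) (graph_on f A) \<subseteq> conn ?r" using xy by (auto simp: graph_on_def)
  then have "cycles ?g A \<le> ncomp (insert (x, y) (graph_on f A)) A" by (rule ncomp_mono[OF A(1)])
  then show ?thesis using ncomp_insert_less[OF A(1,3,4) ne] by simp
qed

text \<open>The arithmetic of adding one transposition: \<open>a\<close> and the \<open>c\<close>'s
  are numbers of cycles, the \<open>n\<close>'s numbers of components, \<open>m\<close> and
  \<open>k\<close> numbers of moved points. In the first case the ends of the transposition were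
  already connected, in the second they were not.\<close>

lemma genus_step_arith:
  fixes a :: nat
  shows "\<lbrakk>c1 \<le> c2 + 1; n1 \<le> n2; n2 \<le> n3; 2 * (a + c2) \<le> m + 4 * n1; k = m + 2\<rbrakk> \<Longrightarrow> 2 * (a + c1) \<le> k + 4 * n3"
    "\<lbrakk>c1 + 1 \<le> c2; n1 \<le> n2 + 1; n2 \<le> n3; 2 * (a + c2) \<le> m + 4 * n1; k = m + 2\<rbrakk> \<Longrightarrow> 2 * (a + c1) \<le> k + 4 * n3"
  by simp_all

text \<open>Induction on the number of transpositions in \<open>\<alpha>\<close>: a new one changes the number of cycles of
  \<open>s \<circ> \<alpha>\<close> by one, and lowers it if it joins two components.\<close>

lemma genus_inequality:
  assumes A: "finite A" "bij_betw s A A" and \<alpha>: "\<And>x. x \<in> A \<Longrightarrow> \<alpha> x \<in> A" "\<And>x. x \<in> A \<Longrightarrow> \<alpha> (\<alpha> x) = x"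
  shows "2 * (cycles s A + cycles (s \<circ> \<alpha>) A) \<le> card {x \<in> A. \<alpha> x \<noteq> x} + 4 * ncomp (graph_on s A \<union> graph_on \<alpha> A) A"
  using \<alpha>
proof (induction "card {x \<in> A. \<alpha> x \<noteq> x}" arbitrary: \<alpha> rule: less_induct)
  case less
  note \<alpha> = less.prems
  show ?case
  proof (cases "{x \<in> A. \<alpha> x \<noteq> x} = {}")
    case True
    then have "graph_on (s \<circ> \<alpha>) A = graph_on s A" by (auto simp: graph_on_def)
    moreover have "cycles s A \<le> ncomp (graph_on s A \<union> graph_on \<alpha> A) A"
    proof (rule ncomp_mono[OF A(1)])
      have "graph_on \<alpha> A \<subseteq> conn (graph_on s A)" using True by (auto simp: graph_on_def)
      then show "graph_on s A \<union> graph_on \<alpha> A \<subseteq> conn (graph_on s A)" by (simp add: subset_conn)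
    qed
    ultimately show ?thesis by simp
  next
    case False
    then obtain x where x: "x \<in> A" "\<alpha> x \<noteq> x" by blast
    define y where "y = \<alpha> x"
    have y: "y \<in> A" "\<alpha> y = x" "x \<noteq> y" using x \<alpha> by (auto simp: y_def)
    \<comment> \<open>The involution \<alpha> without the transposition of \<open>x\<close> and
      \<open>y\<close>; it moves two points fewer.\<close>
    define \<beta> where "\<beta> z = (if z = x \<or> z = y then z else \<alpha> z)" for z
    have inj: "\<alpha> z \<noteq> x \<and> \<alpha> z \<noteq> y" if "z \<in> A" "z \<noteq> x" "z \<noteq> y" for z
      using \<alpha>(2)[of z] that y y_def by metis
    have \<beta>: "\<beta> z \<in> A" "\<beta> (\<beta> z) = z" if "z \<in> A" for z using that \<alpha> inj[of z] by (auto simp: \<beta>_def)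
    have mv: "{z \<in> A. \<alpha> z \<noteq> z} = insert x (insert y {z \<in> A. \<beta> z \<noteq> z})"
      using x y by (auto simp: \<beta>_def)
    have card: "card {z \<in> A. \<alpha> z \<noteq> z} = card {z \<in> A. \<beta> z \<noteq> z} + 2"
      unfolding mv using A(1) y(3) by (subst card_insert_disjoint, simp, simp add: \<beta>_def)+ simp
    let ?rb = "graph_on s A \<union> graph_on \<beta> A" and ?ra = "graph_on s A \<union> graph_on \<alpha> A"
    have IH: "2 * (cycles s A + cycles (s \<circ> \<beta>) A) \<le> card {x \<in> A. \<beta> x \<noteq> x} + 4 * ncomp ?rb A"
      using less.hyps[of \<beta>] card \<beta> by simp
    have "s (\<alpha> z) = ((s \<circ> \<beta>) \<circ> Transposition.transpose x y) z" for z
      using y y_def by (auto simp: \<beta>_def Transposition.transpose_def)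
    then have sa: "s \<circ> \<alpha> = (s \<circ> \<beta>) \<circ> Transposition.transpose x y" by auto
    have ins: "?ra \<subseteq> conn (insert (x, y) ?rb)"
    proof -
      have "(z, \<alpha> z) \<in> conn (insert (x, y) ?rb)" if "z \<in> A" for z
      proof (cases "z = x \<or> z = y")
        case True
        have "(x, y) \<in> conn (insert (x, y) ?rb)" by (rule conn_base) simp
        moreover have "(y, x) \<in> conn (insert (x, y) ?rb)" by (rule conn_sym[OF calculation])
        ultimately show ?thesis using True y(2) y_def by metis
      next
        case False
        then have "(z, \<alpha> z) \<in> graph_on \<beta> A" using that by (auto simp: graph_on_def \<beta>_def image_iff)
        then show ?thesis by (intro conn_base) simp
      qed
      moreover have "graph_on s A \<subseteq> conn (insert (x, y) ?rb)" by (rule subset_conn) blast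
      ultimately show ?thesis by (auto simp: graph_on_def)
    qed
    have le: "ncomp (insert (x, y) ?rb) A \<le> ncomp ?ra A" using ins by (rule ncomp_mono[OF A(1)])
    \<comment> \<open>Inside one component a possible extra cycle adds 2 on the left, paid for by
      the two moved points. If two components are joined, the right side may drop by 4 - 2, and the
      lost cycle lowers the left side by 2.\<close>
    show ?thesis
    proof (cases "(x, y) \<in> conn ?rb")
      case True
      have "insert (x, y) ?rb \<subseteq> conn ?rb" using True subset_conn[of ?rb ?rb] by blast
      then have "ncomp ?rb A \<le> ncomp (insert (x, y) ?rb) A" by (rule ncomp_mono[OF A(1)])
      moreover have "cycles (s \<circ> \<alpha>) A \<le> cycles (s \<circ> \<beta>) A + 1"
        unfolding sa by (rule cycles_transpose_le[OF A(1) x(1) y(1)])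
      ultimately show ?thesis using genus_step_arith(1)[OF _ _ le IH card] by blast
    next
      case False
      have "bij_betw \<beta> A A" using \<beta> by (intro bij_betw_byWitness[of _ \<beta>]) auto
      then have bij: "bij_betw (s \<circ> \<beta>) A A" using A(2) bij_betw_trans by blast
      have "graph_on (s \<circ> \<beta>) A \<subseteq> conn ?rb"
      proof -
        have "(z, s (\<beta> z)) \<in> conn ?rb" if "z \<in> A" for z
        proof -
          have "(z, \<beta> z) \<in> ?rb" "(\<beta> z, s (\<beta> z)) \<in> ?rb" using that \<beta> by (auto simp: graph_on_def)
          then show ?thesis using conn_base conn_trans by metis
        qed
        then show ?thesis by (auto simp: graph_on_def)
      qed
      then have "(x, y) \<notin> conn (graph_on (s \<circ> \<beta>) A)" using conn_least False by blast
      then have "cycles (s \<circ> \<alpha>) A + 1 \<le> cycles (s \<circ> \<beta>) A"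
        unfolding sa using cycles_transpose_less[OF A(1) bij x(1) y(1)] by blast
      moreover have "ncomp ?rb A \<le> ncomp (insert (x, y) ?rb) A + 1" by (rule ncomp_insert_ge[OF A(1)])
      ultimately show ?thesis using genus_step_arith(2)[OF _ _ le IH card] by blast
    qed
  qed
qed

section \<open>Finite groups with generators of orders 2, k and l\<close>

lemma funpow_fixed_iff:
  assumes "finite A" "bij_betw f A A" "x \<in> A"
  shows "(f ^^ n) x = x \<longleftrightarrow> card (conn (graph_on f A) `` {x}) dvd n"
    and "card (conn (graph_on f A) `` {x}) > 0"
proof -
  define N where "N = (LEAST n. n > 0 \<and> (f ^^ n) x = x)"
  have ex: "\<exists>n. n > 0 \<and> (f ^^ n) x = x" using period_exists[OF assms] by metis
  have N: "N > 0" "(f ^^ N) x = x" and least: "\<And>n. n > 0 \<Longrightarrow> (f ^^ n) x = x \<Longrightarrow> N \<le> n"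
    using LeastI_ex[OF ex] Least_le[of "\<lambda>n. n > 0 \<and> (f ^^ n) x = x"] unfolding N_def by auto
  have *: "(f ^^ n) x = x \<longleftrightarrow> N dvd n" for n
  proof -
    have "(f ^^ n) x = (f ^^ (n mod N)) x" by (rule funpow_mod_eq[OF N(2), symmetric])
    moreover have "(f ^^ (n mod N)) x = x \<longleftrightarrow> n mod N = 0"
      using least[of "n mod N"] mod_less_divisor[OF N(1), of n] by (cases "n mod N = 0") auto
    ultimately show ?thesis by (simp add: dvd_eq_mod_eq_0)
  qed
  have "card (conn (graph_on f A) `` {x}) = N" using card_cycle_class[OF assms N(1) *] .
  then show "(f ^^ n) x = x \<longleftrightarrow> card (conn (graph_on f A) `` {x}) dvd n"
    "card (conn (graph_on f A) `` {x}) > 0" using * N by auto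
qed

lemma single_cycle_order:
  assumes f: "f permutes A" "finite A" "A \<noteq> {}" and one: "cycles f A \<le> 1"
  shows "f ^^ i = id \<longleftrightarrow> card A dvd i"
proof -
  have bij: "bij_betw f A A" using f(1) permutes_imp_bij by blast
  have im: "f ` A \<subseteq> A" using bij by (simp add: bij_betw_def)
  have cls: "conn (graph_on f A) `` {x} = A" if "x \<in> A" for x
  proof
    show "conn (graph_on f A) `` {x} \<subseteq> A"
      unfolding cycle_class[OF f(2) bij that] using funpow_in[OF im that] by auto
    show "A \<subseteq> conn (graph_on f A) `` {x}"
    proof
      fix y assume "y \<in> A"
      then have "conn (graph_on f A) `` {y} = conn (graph_on f A) `` {x}"
        using one finite_comps[OF f(2)] quotientI[OF that, of "conn (graph_on f A)"] quotientI[OF \<open>y \<in> A\<close>, of "conn (graph_on f A)"]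
        unfolding ncomp_def by (simp add: card_le_Suc0_iff_eq)
      then show "y \<in> conn (graph_on f A) `` {x}" by (metis Image_singleton_iff conn_refl)
    qed
  qed
  have out: "(f ^^ i) x = x" if "x \<notin> A" for x
    using that f(1) by (induction i) (auto simp: permutes_def)
  have "f ^^ i = id \<longleftrightarrow> (\<forall>x\<in>A. (f ^^ i) x = x)" using out by (auto simp: fun_eq_iff)
  also have "\<dots> \<longleftrightarrow> card A dvd i" using funpow_fixed_iff(1)[OF f(2) bij] cls f(3) by auto
  finally show ?thesis .
qed

text \<open>The permutation \<open>a\<close> consists of \<open>n\<close> cycles of length \<open>l\<close> and \<open>s\<close> fixed points; the
  transpositions of \<open>c\<close> join these cycles into a tree (a chain of the long ones, with the fixed
  points as leaves on the first). By the genus inequality \<open>a \<circ> c\<close> is then a single cycle.\<close>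

locale caterpillar =
  fixes k l :: nat
  assumes l: "1 < l" "l \<le> k"
begin

definition "n = k div l"
definition "s = k mod l"
text \<open>The points below \<open>n * l\<close> form \<open>n\<close> consecutive blocks of length
  \<open>l\<close>, each of them rotated by one.\<close>

definition "a i = (if i < n * l then (if Suc i mod l = 0 then Suc i - l else Suc i) else i)" for i
text \<open>The leaf \<open>i + n * l\<close> hangs on point \<open>i\<close> of the first block,
  and the last point of a block is linked to the first point of the next. The transpositions are
  disjoint: because of \<open>s < l\<close> no leaf hangs on the last point of the first block, and
  because of \<open>1 < l\<close> the two ends of a block differ.\<close>

definition "c i = (if i \<ge> k then i else if i \<ge> n * l then i - n * l else if i < s then i + n * l
   else if Suc i mod l = 0 \<and> Suc i < n * l then Suc i else if i mod l = 0 \<and> 0 < i then i - 1 else i)" for i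

lemma k_split: "k = n * l + s" "s < l" "n > 0"
  using l by (auto simp: n_def s_def div_greater_zero_iff)

lemma block: "q < n \<Longrightarrow> t < l \<Longrightarrow> q * l + t < n * l"
proof -
  assume "q < n" "t < l"
  then have "q * l + t < Suc q * l" by simp
  also have "\<dots> \<le> n * l" using \<open>q < n\<close> by (intro mult_le_mono1) simp
  finally show ?thesis .
qed

lemma a_block:
  assumes "q < n" "t < l" shows "a (q * l + t) = q * l + Suc t mod l"
proof -
  have "Suc (q * l + t) mod l = Suc t mod l" by (metis add_Suc_right mod_mult_self3)
  moreover have "Suc t mod l = (if Suc t = l then 0 else Suc t)" using assms by auto
  ultimately show ?thesis using block[OF assms] assms by (auto simp: a_def)
qed

lemma apow_block:
  assumes "q < n" "t < l" shows "(a ^^ j) (q * l + t) = q * l + (t + j) mod l"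
proof (induction j)
  case (Suc j)
  then show ?case using a_block[OF assms(1), of "(t + j) mod l"] l by (simp add: mod_Suc_eq)
qed (use assms in simp)

lemma split_block: "i < n * l \<Longrightarrow> \<exists>q t. i = q * l + t \<and> q < n \<and> t < l"
  using l by (intro exI[of _ "i div l"] exI[of _ "i mod l"]) (auto simp: less_mult_imp_div_less)

lemma a_in: "i < n * l \<Longrightarrow> a i < n * l"
  using split_block[of i] a_block block l by fastforce

lemma a_fixed: "(a ^^ j) i = i \<longleftrightarrow> (i < n * l \<longrightarrow> l dvd j)"
proof (cases "i < n * l")
  case True
  then obtain q t where qt: "i = q * l + t" "q < n" "t < l" using split_block by blast
  have "(t + j) mod l = t \<longleftrightarrow> l dvd j"
  proof
    assume "(t + j) mod l = t"
    then have "(t + j) mod l = t mod l" using qt by simp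
    then have "l dvd (t + j) - t" using mod_eq_dvd_iff_nat[of t "t + j" l] by simp
    then show "l dvd j" by simp
  next
    assume "l dvd j"
    then show "(t + j) mod l = t" using qt(3) by auto
  qed
  then show ?thesis using True qt apow_block[OF qt(2,3), of j] by simp
next
  case False
  then have "(a ^^ j) i = i" by (induction j) (auto simp: a_def)
  then show ?thesis using False by simp
qed

lemma a_order: "a ^^ j = id \<longleftrightarrow> l dvd j"
proof -
  have nl: "0 < n * l" using k_split(3) l by simp
  show ?thesis
  proof
    assume "a ^^ j = id"
    then have "(a ^^ j) 0 = 0" by simp
    then show "l dvd j" using a_fixed[of j 0] nl by simp
  next
    assume "l dvd j"
    then show "a ^^ j = id" using a_fixed[of j] by (intro ext) simp
  qed
qed

lemma a_permutes: "a permutes {..<k}"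
proof (rule bij_imp_permutes)
  have "inj_on a {..<k}"
  proof (rule inj_onI)
    fix x y assume "a x = a y"
    then have "(a ^^ (l - 1)) (a x) = (a ^^ (l - 1)) (a y)" by simp
    then have "(a ^^ Suc (l - 1)) x = (a ^^ Suc (l - 1)) y" unfolding funpow_Suc_right by simp
    then show "x = y" using a_fixed[of l x] a_fixed[of l y] l by simp
  qed
  moreover have "a ` {..<k} \<subseteq> {..<k}"
  proof clarsimp
    fix i assume "i < k"
    then show "a i < k" using a_in[of i] k_split(1) by (cases "i < n * l") (auto simp: a_def)
  qed
  ultimately show "bij_betw a {..<k} {..<k}" by (simp add: bij_betw_def endo_inj_surj)
qed (use k_split in \<open>auto simp: a_def\<close>)

lemma cycles_a: "cycles a {..<k} = n + s"
proof -
  have bij: "bij_betw a {..<k} {..<k}" using a_permutes permutes_imp_bij by blast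
  have "graph_on a {..<k} \<subseteq> {..<k} \<times> {..<k}" using bij by (auto simp: graph_on_def bij_betw_def)
  then have "real (cycles a {..<k}) = (\<Sum>x<k. 1 / card (conn (graph_on a {..<k}) `` {x}))"
    by (intro ncomp_eq_sum) auto
  also have "\<dots> = (\<Sum>x<k. if x < n * l then 1 / real l else 1)"
  proof (rule sum.cong[OF refl])
    fix x assume x: "x \<in> {..<k}"
    have "card (conn (graph_on a {..<k}) `` {x}) = (if x < n * l then l else 1)"
      using l a_fixed[of _ x] by (intro card_cycle_class bij x) auto
    then show "1 / real (card (conn (graph_on a {..<k}) `` {x})) = (if x < n * l then 1 / real l else 1)" by simp
  qed
  also have "\<dots> = (\<Sum>x\<in>{..<n * l} \<union> {n * l..<k}. if x < n * l then 1 / real l else 1)"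
    using k_split(1) by (intro sum.cong) auto
  also have "\<dots> = (\<Sum>x<n * l. 1 / real l) + (\<Sum>x\<in>{n * l..<k}. 1)"
    by (subst sum.union_disjoint) auto
  also have "\<dots> = real n + real (k - n * l)" using l by simp
  also have "k - n * l = s" by (metis k_split(1) diff_add_inverse)
  finally have "real (cycles a {..<k}) = real (n + s)" by simp
  then show ?thesis by (simp only: of_nat_eq_iff)
qed

lemma c_leaf: "i < s \<Longrightarrow> c i = i + n * l" "i < s \<Longrightarrow> c (i + n * l) = i"
proof -
  assume i: "i < s"
  have "l \<le> n * l" using k_split(3) by simp
  then have "i < n * l" using i k_split(2) by linarith
  then show "c i = i + n * l" "c (i + n * l) = i" using i k_split(1) by (auto simp: c_def)
qed

lemma c_link:
  assumes "0 < q" "q < n" shows "c (q * l - 1) = q * l" "c (q * l) = q * l - 1"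
proof -
  define m where "m = q * l"
  have 1: "m < n * l" using assms l by (simp add: m_def)
  have 2: "l \<le> m" using assms by (simp add: m_def)
  have 3: "Suc m mod l \<noteq> 0" "m mod l = 0"
    using l by (metis Suc_eq_plus1 m_def mod_less mod_mult_self3 one_neq_zero, simp add: m_def)
  show "c (q * l - 1) = q * l" "c (q * l) = q * l - 1"
    unfolding m_def[symmetric] using 1 2 3 k_split(1,2) l by (auto simp: c_def)
qed

lemma c_cases:
  obtains "c i = i" | j where "j < s" "i = j \<or> i = j + n * l" | q where "0 < q" "q < n" "i = q * l - 1 \<or> i = q * l"
proof -
  show ?thesis
  proof (cases "c i = i")
    case False
    consider "i < k" "i \<ge> n * l" | "i < s" | "Suc i mod l = 0" "Suc i < n * l" | "i < n * l" "i mod l = 0" "0 < i"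
      using False by (auto simp: c_def split: if_splits)
    then show ?thesis
    proof cases
      case 1
      then show ?thesis using that(2)[of "i - n * l"] k_split(1) by auto
    next
      case 2 then show ?thesis using that(2) by blast
    next
      case 3
      then obtain q where q: "Suc i = q * l" by (metis mod_0_imp_dvd dvdE mult.commute)
      then show ?thesis using 3 that(3)[of q] by (metis diff_Suc_1 gr0I mult_0 mult_less_cancel2 nat.distinct(1))
    next
      case 4
      then obtain q where q: "i = q * l" by (metis mod_0_imp_dvd dvdE mult.commute)
      then show ?thesis using 4 that(3)[of q] by auto
    qed
  qed (use that in blast)
qed

lemma c_c: "c (c i) = i"
  by (rule c_cases[of i]) (auto simp: c_leaf c_link[unfolded One_nat_def])

lemma c_in: assumes "i < k" shows "c i < k"
proof (rule c_cases[of i])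
  fix j assume "j < s" "i = j \<or> i = j + n * l"
  then show ?thesis using k_split(1) c_leaf[of j] by auto
next
  fix q assume q: "0 < q" "q < n" "i = q * l - 1 \<or> i = q * l"
  moreover have "q * l < k" using q k_split(1) l by (metis mult_less_cancel2 gr_implies_not0 less_trans_Suc not_gr0 trans_less_add1 zero_less_one order.strict_trans)
  ultimately show ?thesis using c_link[OF q(1,2)] by auto
qed (use assms in simp)

lemma c_permutes: "c permutes {..<k}"
  by (rule bij_imp_permutes) (auto intro!: bij_betw_byWitness[of _ c] simp: c_c c_in, simp add: c_def)

text \<open>Two points for each of the \<open>n - 1\<close> links and \<open>s\<close>
  leaves.\<close>

lemma card_moved: "card {i \<in> {..<k}. c i \<noteq> i} \<le> 2 * (n - 1 + s)"
proof -
  let ?L = "{..<s} \<union> (\<lambda>j. j + n * l) ` {..<s} \<union> (\<lambda>q. q * l - 1) ` {1..<n} \<union> (\<lambda>q. q * l) ` {1..<n}"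
  have "{i \<in> {..<k}. c i \<noteq> i} \<subseteq> ?L"
  proof
    fix i assume i: "i \<in> {i \<in> {..<k}. c i \<noteq> i}"
    show "i \<in> ?L" by (rule c_cases[of i]) (use i in auto)
  qed
  then have "card {i \<in> {..<k}. c i \<noteq> i} \<le> card ?L" by (intro card_mono) auto
  also have "\<dots> \<le> (card {..<s} + card ((\<lambda>j. j + n * l) ` {..<s})) + card ((\<lambda>q. q * l - 1) ` {1..<n}) + card ((\<lambda>q. q * l) ` {1..<n})"
    by (intro card_Un_le[THEN order_trans] add_mono order_refl)
  also have "\<dots> \<le> (s + s) + (n - 1) + (n - 1)"
    using card_image_le[of "{..<s}" "\<lambda>j. j + n * l"] card_image_le[of "{1..<n}" "\<lambda>q. q * l - 1"]
      card_image_le[of "{1..<n}" "\<lambda>q. q * l"] by (intro add_mono) auto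
  finally show ?thesis by simp
qed

text \<open>From 0 every point is reached along the blocks by \<open>a\<close>, from block to block
  by the links, and from the first block to the leaves.\<close>

lemma connected: "ncomp (graph_on a {..<k} \<union> graph_on c {..<k}) {..<k} \<le> 1"
proof -
  let ?r = "graph_on a {..<k} \<union> graph_on c {..<k}"
  have ra: "(i, a i) \<in> conn ?r" "(i, c i) \<in> conn ?r" if "i < k" for i
    using that by (auto intro!: conn_base simp: graph_on_def)
  have row: "(q * l, q * l + t) \<in> conn ?r" if "q < n" "t < l" for q t
    using that(2)
  proof (induction t)
    case (Suc t)
    have "q * l + t < k" using block[OF that(1), of t] Suc k_split(1) by simp
    then have "(q * l + t, q * l + Suc t) \<in> conn ?r"
      using ra(1)[of "q * l + t"] a_block[OF that(1), of t] Suc by simp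
    then show ?case using Suc conn_trans by (metis Suc_lessD)
  qed simp
  have rows: "(0, q * l) \<in> conn ?r" if "q < n" for q
    using that
  proof (induction q)
    case (Suc q)
    then have "(0, q * l) \<in> conn ?r" by simp
    also have "(q * l, q * l + (l - 1)) \<in> conn ?r" using row[of q "l - 1"] Suc l by simp
    also have "q * l + (l - 1) = Suc q * l - 1" using l by simp
    also have "(Suc q * l - 1, Suc q * l) \<in> conn ?r"
    proof -
      have "Suc q * l - 1 < k" using block[of q "l - 1"] Suc.prems k_split(1) l by simp
      then show ?thesis using ra(2)[of "Suc q * l - 1"] c_link(1)[of "Suc q"] Suc.prems by simp
    qed
    finally show ?case .
  qed simp
  have all: "(0, i) \<in> conn ?r" if "i < k" for i
  proof (cases "i < n * l")
    case True
    then obtain q t where "i = q * l + t" "q < n" "t < l" using split_block by blast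
    then show ?thesis using rows[of q] row[of q t] conn_trans[of 0 "q * l" ?r] by simp
  next
    case False
    then have j: "i - n * l < s" "i - n * l < l" using that k_split by auto
    then have "(0, i - n * l) \<in> conn ?r" using row[of 0 "i - n * l"] k_split(3) by simp
    also have "(i - n * l, i) \<in> conn ?r"
      using ra(2)[of "i - n * l"] c_leaf(1)[OF j(1)] False that by simp
    finally show ?thesis .
  qed
  have "{..<k} // conn ?r \<subseteq> {conn ?r `` {0}}"
  proof
    fix C assume "C \<in> {..<k} // conn ?r"
    then obtain i where i: "i < k" "C = conn ?r `` {i}" by (auto simp: quotient_def)
    then show "C \<in> {conn ?r `` {0}}" using all[OF i(1)] conn_class_eq[of ?r 0 i] by simp
  qed
  then have "card ({..<k} // conn ?r) \<le> card {conn ?r `` {0}}" by (intro card_mono) auto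
  then show ?thesis by (simp add: ncomp_def)
qed

lemma ac_order: "(a \<circ> c) ^^ i = id \<longleftrightarrow> k dvd i"
proof -
  have bij: "bij_betw a {..<k} {..<k}" using a_permutes permutes_imp_bij by blast
  have "2 * (cycles a {..<k} + cycles (a \<circ> c) {..<k}) \<le> card {i \<in> {..<k}. c i \<noteq> i} + 4 * ncomp (graph_on a {..<k} \<union> graph_on c {..<k}) {..<k}"
    by (rule genus_inequality[OF _ bij]) (auto simp: c_in c_c)
  \<comment> \<open>With z the number of cycles of \<open>a \<circ> c\<close>, the genus inequality
    reads 2 (n + s + z) \<le> 2 (n - 1 + s) + 4.\<close>
  moreover have "2 * (x + z) \<le> m + 4 * q \<Longrightarrow> x = n' + s' \<Longrightarrow> m \<le> 2 * (n' - 1 + s') \<Longrightarrow> q \<le> 1 \<Longrightarrow> 0 < n' \<Longrightarrow> z \<le> 1"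
    for x z m q n' s' :: nat by (cases n') simp_all
  ultimately have "cycles (a \<circ> c) {..<k} \<le> 1" using cycles_a card_moved connected k_split(3) by blast
  then show ?thesis
    using single_cycle_order[of "a \<circ> c" "{..<k}" i] permutes_compose[OF c_permutes a_permutes] l
    by (simp add: lessThan_empty_iff)
qed

end

text \<open>The caterpillar requires \<open>l \<le> k\<close>. Otherwise it is built with the orders
  exchanged and \<open>a \<circ> c\<close> takes the place of \<open>a\<close>; since
  \<open>c\<close> is an involution, \<open>(a \<circ> c) \<circ> c = a\<close>. That the orders are
  exact, and not merely divisors of \<open>l\<close> and \<open>k\<close>, is what makes lifted
  cycle lengths least common multiples.\<close>

theorem triangle_group:
  fixes k l :: nat
  assumes "k > 1" "l > 1"
  obtains N and a c :: "nat \<Rightarrow> nat" where "a permutes {..<N}" "c permutes {..<N}" "c \<circ> c = id"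
    "\<And>i. a ^^ i = id \<longleftrightarrow> l dvd i" "\<And>i. (a \<circ> c) ^^ i = id \<longleftrightarrow> k dvd i"
proof (cases "l \<le> k")
  case True
  interpret caterpillar k l using True assms by unfold_locales
  have "c \<circ> c = id" by (simp add: fun_eq_iff c_c)
  then show ?thesis using that[OF a_permutes c_permutes _ a_order ac_order] by blast
next
  case False
  interpret caterpillar l k using False assms by unfold_locales auto
  have "c \<circ> c = id" "(a \<circ> c) \<circ> c = a" by (simp_all add: fun_eq_iff c_c)
  then show ?thesis
    using that[OF permutes_compose[OF c_permutes a_permutes] c_permutes _ ac_order] a_order by simp
qed

section \<open>Flag systems and their coverings\<close>

lemma conn_map:
  assumes "\<And>x y. (x, y) \<in> r \<Longrightarrow> (g x, g y) \<in> conn r'" and "(x, y) \<in> conn r"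
  shows "(g x, g y) \<in> conn r'"
  using assms(2) unfolding conn_def[of r]
proof (induction rule: rtrancl_induct)
  case (step y z)
  then have "(g y, g z) \<in> conn r'" using assms(1) conn_sym[OF assms(1), of z y] by auto
  with step.IH show ?case by (rule conn_trans)
qed simp

lemma conn_invariant:
  assumes "\<And>x y. (x, y) \<in> r \<Longrightarrow> h x = h y" and "(x, y) \<in> conn r"
  shows "h x = h y"
  using assms(2) unfolding conn_def
proof (induction rule: rtrancl_induct)
  case (step y z)
  then show ?case using assms(1)[of y z] assms(1)[of z y] by auto
qed simp

text \<open>To be used with \<open>B\<close> the fibre over one vertex or face and \<open>r'\<close>
  the cycles of a single permutation on it: these cycles bound the number of all components.\<close>

lemma ncomp_le_meeting:
  assumes "finite B" "B \<subseteq> A" "r' \<subseteq> conn r" and "\<And>x. x \<in> A \<Longrightarrow> \<exists>y\<in>B. (x, y) \<in> conn r"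
  shows "ncomp r A \<le> ncomp r' B"
proof -
  have "A // conn r \<subseteq> B // conn r"
  proof
    fix C assume "C \<in> A // conn r"
    then obtain x where x: "x \<in> A" "C = conn r `` {x}" by (auto simp: quotient_def)
    then obtain y where "y \<in> B" "(x, y) \<in> conn r" using assms(4) by blast
    then show "C \<in> B // conn r" using x conn_class_eq[of r x y] by (auto simp: quotient_def)
  qed
  then have "ncomp r A \<le> ncomp r B" unfolding ncomp_def using finite_comps[OF assms(1)] by (intro card_mono)
  also have "\<dots> \<le> ncomp r' B" by (rule ncomp_mono[OF assms(1,3)])
  finally show ?thesis .
qed

text \<open>The total weight of \<open>a\<close> points that lie on cycles of length
  \<open>lcm a b\<close>.\<close>

lemma div_lcm: "b > 0 \<Longrightarrow> a > 0 \<Longrightarrow> real a / real (lcm a b) = real (gcd a b) / real b" for a b :: nat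
proof -
  assume "b > 0" "a > 0"
  moreover have "real a * real b = real (gcd a b) * real (lcm a b)"
    by (metis of_nat_mult prod_gcd_lcm_nat)
  ultimately show ?thesis by (simp add: field_simps lcm_pos_nat)
qed

text \<open>Here \<open>f d\<close> is the face in the corner between \<open>d\<close> and \<open>\<rho> d\<close>. Nothing ties the direction in which
  \<open>\<rho>\<close> turns at one vertex to that at another.\<close>

locale cmap =
  fixes D :: "'d set" and \<rho> opp :: "'d \<Rightarrow> 'd" and tail :: "'d \<Rightarrow> 'v" and f :: "'d \<Rightarrow> 'f" and sides :: "'d \<Rightarrow> 'f set"
  assumes finD: "finite D" and neD: "D \<noteq> {}"
    and \<rho>_bij: "bij_betw \<rho> D D" and tail_\<rho>: "\<And>d. d \<in> D \<Longrightarrow> tail (\<rho> d) = tail d"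
    and \<rho>_trans: "\<And>d d'. \<lbrakk>d \<in> D; d' \<in> D; tail d = tail d'\<rbrakk> \<Longrightarrow> \<exists>m. (\<rho> ^^ m) d = d'"
    and opp: "\<And>d. d \<in> D \<Longrightarrow> opp d \<in> D" "\<And>d. d \<in> D \<Longrightarrow> opp (opp d) = d" "\<And>d. d \<in> D \<Longrightarrow> opp d \<noteq> d"
    and sides_\<rho>: "\<And>d. d \<in> D \<Longrightarrow> sides (\<rho> d) = {f d, f (\<rho> d)}"
    and sides_opp: "\<And>d. d \<in> D \<Longrightarrow> sides (opp d) = sides d"
    and connected: "\<And>d d'. \<lbrakk>d \<in> D; d' \<in> D\<rbrakk> \<Longrightarrow> (d, d') \<in> conn (graph_on \<rho> D \<union> graph_on opp D)"
    and euler: "card D + 4 \<le> 2 * card (tail ` D) + 2 * card (f ` D)"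
begin

text \<open>A flag \<open>(d, b)\<close> is a dart with one of its two corners. The map \<open>across\<close> goes to the other end
  of the edge, staying on the side of the same face; if both sides have the same face, the choice is
  arbitrary.\<close>

definition "\<rho>i = inv_into D \<rho>"
definition "\<Phi> = D \<times> (UNIV :: bool set)"
definition lab :: "'d \<times> bool \<Rightarrow> 'f" where "lab x = (if snd x then f (fst x) else f (\<rho>i (fst x)))"
definition turn :: "'d \<times> bool \<Rightarrow> 'd \<times> bool" where
  "turn x = (if snd x then (\<rho> (fst x), False) else (\<rho>i (fst x), True))"
definition across :: "'d \<times> bool \<Rightarrow> 'd \<times> bool" where
  "across x = (opp (fst x), if lab (opp (fst x), True) = lab (fst x, True) then snd x else \<not> snd x)"
definition flip :: "'d \<times> bool \<Rightarrow> 'd \<times> bool" where "flip x = (fst x, \<not> snd x)"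
text \<open>The maps \<open>turn\<close>, \<open>across\<close> and \<open>flip\<close> are
  involutions. Of their products, \<open>turn \<circ> flip\<close> turns around a vertex, in the
  direction given by the Boolean, so that each vertex has two cycles;
  \<open>flip \<circ> across\<close> goes to the other end of the edge; and the composition of
  these, \<open>turn \<circ> across\<close>, walks around a face.\<close>

definition "s = turn \<circ> flip"
definition "\<alpha> = flip \<circ> across"
definition "deg v = card {d \<in> D. tail d = v}"
text \<open>Every side of an edge is seen from both ends of the edge, hence by two flags.\<close>

definition "fdeg F = card {x \<in> \<Phi>. lab x = F} div 2"
abbreviation "G \<equiv> graph_on s \<Phi> \<union> graph_on \<alpha> \<Phi>"

section \<open>The involutions on flags, and the vertex cycles\<close>

lemma fin\<Phi>: "finite \<Phi>" using finD by (simp add: \<Phi>_def)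

lemma \<rho>_in: "d \<in> D \<Longrightarrow> \<rho> d \<in> D" using \<rho>_bij by (auto simp: bij_betw_def)

lemma \<rho>i: "d \<in> D \<Longrightarrow> \<rho>i d \<in> D" "d \<in> D \<Longrightarrow> \<rho> (\<rho>i d) = d" "d \<in> D \<Longrightarrow> \<rho>i (\<rho> d) = d"
  using \<rho>_bij unfolding \<rho>i_def
  by (auto simp: bij_betw_def inv_into_into f_inv_into_f inv_into_f_f)

lemma sides_lab: "d \<in> D \<Longrightarrow> sides d = {lab (d, True), lab (d, False)}"
  using sides_\<rho>[of "\<rho>i d"] \<rho>i[of d] by (auto simp: lab_def)

lemma in\<Phi>: "x \<in> \<Phi> \<longleftrightarrow> fst x \<in> D" by (cases x) (simp add: \<Phi>_def)

lemma turn: "x \<in> \<Phi> \<Longrightarrow> turn x \<in> \<Phi>" "x \<in> \<Phi> \<Longrightarrow> turn (turn x) = x" "x \<in> \<Phi> \<Longrightarrow> lab (turn x) = lab x"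
  "turn x \<noteq> x" "x \<in> \<Phi> \<Longrightarrow> tail (fst (turn x)) = tail (fst x)"
  using \<rho>_in[of "fst x"] \<rho>i[of "fst x"] tail_\<rho>[of "fst x"] tail_\<rho>[of "\<rho>i (fst x)"]
  by (auto simp: turn_def in\<Phi> lab_def prod_eq_iff)

text \<open>The two ends of an edge carry the same unordered pair of labels, so the labels agree
  either as they stand or after an exchange.\<close>

lemma across: "x \<in> \<Phi> \<Longrightarrow> across x \<in> \<Phi>" "x \<in> \<Phi> \<Longrightarrow> across (across x) = x" "x \<in> \<Phi> \<Longrightarrow> lab (across x) = lab x"
  "x \<in> \<Phi> \<Longrightarrow> across x \<noteq> x"
proof -
  assume x: "x \<in> \<Phi>"
  then have d: "fst x \<in> D" "opp (fst x) \<in> D" using opp by (auto simp: in\<Phi>)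
  show "across x \<in> \<Phi>" "across (across x) = x" "across x \<noteq> x"
    using d opp by (auto simp: across_def in\<Phi> prod_eq_iff)
  have "{lab (fst x, True), lab (fst x, False)} = {lab (opp (fst x), True), lab (opp (fst x), False)}"
    using sides_lab d sides_opp by metis
  then show "lab (across x) = lab x"
    by (cases x; cases "snd x") (auto simp: across_def doubleton_eq_iff)
qed

lemma flip: "x \<in> \<Phi> \<Longrightarrow> flip x \<in> \<Phi>" "flip (flip x) = x" "flip (across x) = across (flip x)"
  by (auto simp: flip_def in\<Phi> across_def)

lemma s_in: "x \<in> \<Phi> \<Longrightarrow> s x \<in> \<Phi>" using turn flip by (simp add: s_def)
lemma \<alpha>_in: "x \<in> \<Phi> \<Longrightarrow> \<alpha> x \<in> \<Phi>" using across flip by (simp add: \<alpha>_def)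
lemma \<alpha>_\<alpha>: "x \<in> \<Phi> \<Longrightarrow> \<alpha> (\<alpha> x) = x" using across flip by (simp add: \<alpha>_def)
lemma \<alpha>_ne: "x \<in> \<Phi> \<Longrightarrow> \<alpha> x \<noteq> x" using opp(3)[of "fst x"] by (auto simp: \<alpha>_def flip_def across_def in\<Phi> prod_eq_iff)

lemma s_eq: "s (d, True) = (\<rho>i d, True)" "s (d, False) = (\<rho> d, False)"
  by (auto simp: s_def turn_def flip_def)

lemma s_\<alpha>: "s (\<alpha> x) = turn (across x)" by (simp add: s_def \<alpha>_def flip)

lemma s_bij: "bij_betw s \<Phi> \<Phi>"
  by (intro bij_betw_byWitness[of _ "flip \<circ> turn"] ballI image_subsetI) (simp_all add: s_def turn flip)

lemma \<phi>_bij: "bij_betw (s \<circ> \<alpha>) \<Phi> \<Phi>"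
  by (intro bij_betw_byWitness[of _ "across \<circ> turn"] ballI image_subsetI) (simp_all add: s_\<alpha> turn across)

lemma vertex_class:
  assumes "d \<in> D" shows "conn (graph_on s \<Phi>) `` {(d, b)} = {d' \<in> D. tail d' = tail d} \<times> {b}"
proof
  have "y \<in> \<Phi>" if "((d, b), y) \<in> conn (graph_on s \<Phi>)" for y
  proof -
    have "(y \<in> \<Phi>) = ((d, b) \<in> \<Phi>)"
      by (rule conn_invariant[OF _ that, of "\<lambda>x. x \<in> \<Phi>", symmetric]) (auto simp: graph_on_def s_in)
    then show ?thesis using assms by (simp add: \<Phi>_def)
  qed
  moreover have "tail (fst (d, b)) = tail (fst y) \<and> snd (d, b) = snd y" if "((d, b), y) \<in> conn (graph_on s \<Phi>)" for y
  proof -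
    have "tail (fst x) = tail (fst (s x)) \<and> snd x = snd (s x)" if "x \<in> \<Phi>" for x
      using turn(5)[OF flip(1)[OF that]] by (auto simp: s_def flip_def turn_def)
    then have "(tail (fst (d, b)), snd (d, b)) = (tail (fst y), snd y)"
      by (intro conn_invariant[OF _ that, of "\<lambda>x. (tail (fst x), snd x)"]) (auto simp: graph_on_def)
    then show ?thesis by simp
  qed
  ultimately show "conn (graph_on s \<Phi>) `` {(d, b)} \<subseteq> {d' \<in> D. tail d' = tail d} \<times> {b}"
    by (force simp: in\<Phi>)
  have step: "((e, b), (\<rho> e, b)) \<in> conn (graph_on s \<Phi>)" if "e \<in> D" for e
  proof (cases b)
    case True
    have "((\<rho> e, True), (e, True)) \<in> graph_on s \<Phi>"
      using \<rho>_in[OF that] \<rho>i(3)[OF that] by (auto simp: graph_on_def s_eq \<Phi>_def image_iff)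
    then show ?thesis using True conn_base conn_sym by metis
  next
    case False
    have "((e, False), (\<rho> e, False)) \<in> graph_on s \<Phi>"
      using that by (auto simp: graph_on_def s_eq \<Phi>_def image_iff)
    then show ?thesis using False conn_base by metis
  qed
  have "((d, b), ((\<rho> ^^ m) d, b)) \<in> conn (graph_on s \<Phi>) \<and> (\<rho> ^^ m) d \<in> D" for m
  proof (induction m)
    case (Suc m)
    then show ?case using step[of "(\<rho> ^^ m) d"] \<rho>_in conn_trans by auto
  qed (use assms in simp)
  then show "{d' \<in> D. tail d' = tail d} \<times> {b} \<subseteq> conn (graph_on s \<Phi>) `` {(d, b)}"
    using \<rho>_trans[OF assms] by (auto; metis)
qed

lemma card_vertex_class: "x \<in> \<Phi> \<Longrightarrow> card (conn (graph_on s \<Phi>) `` {x}) = deg (tail (fst x))"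
  using vertex_class[of "fst x" "snd x"] by (simp add: in\<Phi> deg_def card_cartesian_product)

lemma card_vertex_flags: "card {x \<in> \<Phi>. tail (fst x) = v} = 2 * deg v"
proof -
  have "{x \<in> \<Phi>. tail (fst x) = v} = {d \<in> D. tail d = v} \<times> UNIV" by (auto simp: \<Phi>_def)
  then show ?thesis by (simp add: card_cartesian_product deg_def)
qed

lemma deg_pos: "v \<in> tail ` D \<Longrightarrow> deg v > 0"
  using finD by (auto simp: deg_def card_gt_0_iff)

lemma sum_vertex_flags:
  "(\<Sum>x\<in>\<Phi>. h (tail (fst x))) = (\<Sum>v\<in>tail ` D. 2 * real (deg v) * h v)"
proof -
  have "(\<Sum>x\<in>\<Phi>. h (tail (fst x))) = (\<Sum>v\<in>tail ` D. \<Sum>x | x \<in> \<Phi> \<and> tail (fst x) = v. h (tail (fst x)))"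
    by (rule sum.group[symmetric]) (use fin\<Phi> finD in \<open>auto simp: in\<Phi>\<close>)
  also have "\<dots> = (\<Sum>v\<in>tail ` D. 2 * real (deg v) * h v)"
    by (intro sum.cong) (auto simp: card_vertex_flags)
  finally show ?thesis .
qed

lemma cycles_s: "cycles s \<Phi> = 2 * card (tail ` D)"
proof -
  have "real (cycles s \<Phi>) = (\<Sum>x\<in>\<Phi>. 1 / card (conn (graph_on s \<Phi>) `` {x}))"
    by (intro ncomp_eq_sum fin\<Phi>) (auto simp: graph_on_def s_in)
  also have "\<dots> = (\<Sum>x\<in>\<Phi>. 1 / deg (tail (fst x)))" by (intro sum.cong) (auto simp: card_vertex_class)
  also have "\<dots> = (\<Sum>v\<in>tail ` D. 2 * real (deg v) * (1 / deg v))" by (rule sum_vertex_flags)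
  also have "\<dots> = (\<Sum>v\<in>tail ` D. 2)" using deg_pos by (intro sum.cong) auto
  finally have "real (cycles s \<Phi>) = real (2 * card (tail ` D))" by simp
  then show ?thesis by (simp only: of_nat_eq_iff)
qed

text \<open>A walk of darts lifts to flags, but nothing controls on which side of \<open>d\<close>
  it arrives. Hence up to two components.\<close>

lemma flag_conn:
  assumes "x \<in> \<Phi>" "d \<in> D"
  shows "(x, (d, True)) \<in> conn G \<or> (x, (d, False)) \<in> conn G"
proof -
  have G: "(y, s y) \<in> conn G" "(y, \<alpha> y) \<in> conn G" if "y \<in> \<Phi>" for y
    using that by (auto intro!: conn_base simp: graph_on_def)
  define Q where "Q e \<longleftrightarrow> (\<exists>b. (x, (e, b)) \<in> conn G)" for e
  have Q1: "Q e \<longleftrightarrow> Q (\<rho> e)" if "e \<in> D" for e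
  proof -
    have "((e, b), (\<rho> e, b)) \<in> conn G" for b
      using G(1)[of "(e, False)"] conn_sym[OF G(1)[of "(\<rho> e, True)"]] that \<rho>_in[OF that] \<rho>i(3)[OF that]
      by (cases b) (auto simp: s_eq \<Phi>_def)
    then show ?thesis unfolding Q_def using conn_trans[of x _ G] conn_sym[of "(e, _)" _ G] by blast
  qed
  have Q2: "Q e \<longleftrightarrow> Q (opp e)" if "e \<in> D" for e
  proof -
    have *: "\<exists>b'. ((e, b), (opp e, b')) \<in> conn G" if "e \<in> D" for e b
      using G(2)[of "(e, b)"] that by (auto simp: \<alpha>_def flip_def across_def \<Phi>_def)
    have "Q e \<Longrightarrow> Q (opp e)" if "e \<in> D" for e unfolding Q_def using *[OF that] conn_trans[of x _ G] by blast
    then show ?thesis using that opp by metis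
  qed
  have "Q (fst x) \<longleftrightarrow> Q d"
    by (rule conn_invariant[OF _ connected[of "fst x" d]]) (use assms Q1 Q2 in \<open>auto simp: graph_on_def in\<Phi>\<close>)
  moreover have "Q (fst x)" unfolding Q_def by (rule exI[of _ "snd x"]) simp
  ultimately obtain b where "(x, (d, b)) \<in> conn G" unfolding Q_def by blast
  then show ?thesis by (cases b) auto
qed

lemma ncomp_G: "ncomp G \<Phi> \<le> 2"
proof -
  obtain d where d: "d \<in> D" using neD by blast
  have "\<Phi> // conn G \<subseteq> {conn G `` {(d, True)}, conn G `` {(d, False)}}"
  proof
    fix C assume "C \<in> \<Phi> // conn G"
    then obtain x where x: "x \<in> \<Phi>" "C = conn G `` {x}" by (auto simp: quotient_def)
    then show "C \<in> {conn G `` {(d, True)}, conn G `` {(d, False)}}"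
      using flag_conn[OF x(1) d] conn_class_eq[of G x] by auto
  qed
  then have "ncomp G \<Phi> \<le> card {conn G `` {(d, True)}, conn G `` {(d, False)}}"
    unfolding ncomp_def by (intro card_mono) auto
  also have "\<dots> \<le> 2" by (simp add: card_insert_if)
  finally show ?thesis .
qed

section \<open>Cycles around the faces\<close>

lemma \<phi>_in: "x \<in> \<Phi> \<Longrightarrow> (s \<circ> \<alpha>) x \<in> \<Phi>" using s_in \<alpha>_in by simp

text \<open>Since \<open>turn\<close> reverses the face walk, a segment of the walk from
  \<open>x\<close> to \<open>turn x\<close> is symmetric about its middle, where \<open>turn\<close>
  or \<open>across\<close> would have a fixed point. The induction removes one step at either end of
  the segment.\<close>

lemma turn_not_on_cycle:
  assumes "x \<in> \<Phi>" shows "((s \<circ> \<alpha>) ^^ j) x \<noteq> turn x"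
  using assms
proof (induction j arbitrary: x rule: less_induct)
  case (less j)
  have eq: "(s \<circ> \<alpha>) y = turn (across y)" for y by (simp add: s_\<alpha>)
  consider "j = 0" | "j = 1" | i where "j = Suc (Suc i)" by (metis One_nat_def not0_implies_Suc)
  then show ?case
  proof cases
    case 1 then show ?thesis using turn(4)[of x] by simp
  next
    case 2
    have "turn (across x) \<noteq> turn x"
      using turn(2)[OF across(1)[OF less.prems]] turn(2)[OF less.prems] across(4)[OF less.prems] by metis
    then show ?thesis using 2 eq by simp
  next
    case 3
    show ?thesis
    proof
      assume a: "((s \<circ> \<alpha>) ^^ j) x = turn x"
      define y where "y = (s \<circ> \<alpha>) x"
      have y: "y \<in> \<Phi>" using \<phi>_in less.prems by (simp add: y_def)
      define w where "w = ((s \<circ> \<alpha>) ^^ i) y"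
      have w: "w \<in> \<Phi>" unfolding w_def using \<phi>_in y by (intro funpow_in) auto
      have "((s \<circ> \<alpha>) ^^ j) x = (s \<circ> \<alpha>) w"
        unfolding w_def y_def 3 by (simp add: funpow_swap1)
      then have "turn (across w) = turn x" using a eq by metis
      then have "across w = x" using turn(2) across(1)[OF w] less.prems by metis
      then have "w = across x" using across(2)[OF w] by simp
      also have "\<dots> = turn y" unfolding y_def eq using turn(2)[OF across(1)[OF less.prems]] by simp
      finally show False using less.IH[of i y] y 3 unfolding w_def by simp
    qed
  qed
qed

text \<open>Conjugation by \<open>turn\<close> takes the face walk to its inverse, which has the
  same cycles.\<close>

lemma turn_conn:
  assumes "(x, y) \<in> conn (graph_on (s \<circ> \<alpha>) \<Phi>)"
  shows "(turn x, turn y) \<in> conn (graph_on (s \<circ> \<alpha>) \<Phi>)"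
proof (rule conn_map[OF _ assms])
  fix x y assume "(x, y) \<in> graph_on (s \<circ> \<alpha>) \<Phi>"
  then have x: "x \<in> \<Phi>" "y = turn (across x)" by (auto simp: graph_on_def s_\<alpha>)
  then have "turn y = across x" using turn(2) across(1) by metis
  moreover have "(across x, turn x) \<in> graph_on (s \<circ> \<alpha>) \<Phi>"
    using across[OF x(1)] by (auto simp: graph_on_def s_\<alpha> image_iff intro!: bexI[of _ "across x"])
  ultimately show "(turn x, turn y) \<in> conn (graph_on (s \<circ> \<alpha>) \<Phi>)" using conn_base conn_sym by metis
qed

abbreviation "cls x \<equiv> conn (graph_on (s \<circ> \<alpha>) \<Phi>) `` {x}"

lemma cls_sub: "x \<in> \<Phi> \<Longrightarrow> y \<in> cls x \<Longrightarrow> y \<in> \<Phi> \<and> lab y = lab x"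
proof -
  assume x: "x \<in> \<Phi>" "y \<in> cls x"
  then have y: "(x, y) \<in> conn (graph_on (s \<circ> \<alpha>) \<Phi>)" by simp
  have "(x \<in> \<Phi>, lab x) = (y \<in> \<Phi>, lab y)"
    by (rule conn_invariant[OF _ y, of "\<lambda>x. (x \<in> \<Phi>, lab x)"])
       (auto simp: graph_on_def s_\<alpha> turn across)
  then show ?thesis using x by simp
qed

lemma card_cls_turn: assumes "x \<in> \<Phi>" shows "card (cls (turn x)) = card (cls x)"
proof -
  have le: "card (cls x) \<le> card (cls (turn x))" if "x \<in> \<Phi>" for x
  proof (rule card_inj_on_le[of turn])
    show "inj_on turn (cls x)"
      by (rule inj_on_inverseI[of _ turn]) (use cls_sub[OF that] turn(2) in blast)
    show "turn ` cls x \<subseteq> cls (turn x)" using turn_conn by auto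
    have "cls (turn x) \<subseteq> \<Phi>" using cls_sub[OF turn(1)[OF that]] by blast
    then show "finite (cls (turn x))" using fin\<Phi> by (rule finite_subset)
  qed
  show ?thesis using le[OF assms] le[OF turn(1)[OF assms]] turn(2)[OF assms] by simp
qed

lemma cls_turn_disj: assumes "x \<in> \<Phi>" shows "turn x \<notin> cls x"
proof
  assume "turn x \<in> cls x"
  then obtain n where "turn x = ((s \<circ> \<alpha>) ^^ n) x" unfolding cycle_class[OF fin\<Phi> \<phi>_bij assms] by blast
  then show False using turn_not_on_cycle[OF assms, of n] by simp
qed

lemma lab_image: "lab ` \<Phi> = f ` D"
proof
  show "lab ` \<Phi> \<subseteq> f ` D" using \<rho>i by (auto simp: lab_def in\<Phi>)
  show "f ` D \<subseteq> lab ` \<Phi>"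
  proof
    fix F assume "F \<in> f ` D"
    then obtain d where "d \<in> D" "F = lab (d, True)" by (auto simp: lab_def)
    then show "F \<in> lab ` \<Phi>" by (auto simp: \<Phi>_def)
  qed
qed

text \<open>Each label occurs on at least the two cycles of \<open>x\<close> and \<open>turn x\<close>; by the genus inequality and
  \<open>euler\<close> there are no more cycles than that.\<close>

lemma label_cycles:
  assumes "x \<in> \<Phi>" "y \<in> \<Phi>" "lab x = lab y"
  shows "y \<in> cls x \<or> y \<in> cls (turn x)"
proof -
  have "\<exists>z. z \<in> \<Phi> \<and> lab z = F" if "F \<in> f ` D" for F using that unfolding lab_image[symmetric] by blast
  then obtain z where z: "\<And>F. F \<in> f ` D \<Longrightarrow> z F \<in> \<Phi>" "\<And>F. F \<in> f ` D \<Longrightarrow> lab (z F) = F" by metis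
  define g where "g = (\<lambda>(F, b). cls (if b then z F else turn (z F)))"
  have gz: "(if b then z F else turn (z F)) \<in> \<Phi>" "lab (if b then z F else turn (z F)) = F" if "F \<in> f ` D" for F b
    using z[OF that] turn[of "z F"] by auto
  have "inj_on g (f ` D \<times> UNIV)"
  proof (rule inj_onI, clarify)
    fix d b d' b' assume d: "d \<in> D" "d' \<in> D" and eq: "g (f d, b) = g (f d', b')"
    let ?u = "if b then z (f d) else turn (z (f d))" and ?w = "if b' then z (f d') else turn (z (f d'))"
    have "?w \<in> cls ?u" using eq by (auto simp: g_def)
    then have "lab ?w = lab ?u" using cls_sub gz(1)[of "f d" b] d by blast
    then have F: "f d = f d'" using gz(2)[of "f d" b] gz(2)[of "f d'" b'] d by simp
    have ne: "z (f d) \<in> \<Phi>" using z d by blast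
    have "b = b'"
    proof (rule ccontr)
      assume "b \<noteq> b'"
      then have "cls (z (f d)) = cls (turn (z (f d)))" using eq F by (cases b; cases b') (auto simp: g_def)
      then have "turn (z (f d)) \<in> cls (z (f d))" by (metis Image_singleton_iff conn_refl)
      then show False using cls_turn_disj[OF ne] by blast
    qed
    then show "f d = f d' \<and> b = b'" using F by simp
  qed
  then have card: "card (g ` (f ` D \<times> UNIV)) = 2 * card (f ` D)"
    by (simp add: card_image card_cartesian_product)
  \<comment> \<open>There are \<open>2 * card D\<close> flags, all moved by \<alpha>, two vertex
    cycles for each vertex and at most two components. The term 8 that the components contribute is
    twice the constant 4 of \<open>euler\<close>.\<close>
  have "2 * (cycles s \<Phi> + cycles (s \<circ> \<alpha>) \<Phi>) \<le> card {x \<in> \<Phi>. \<alpha> x \<noteq> x} + 4 * ncomp G \<Phi>"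
    by (rule genus_inequality[OF fin\<Phi> s_bij \<alpha>_in \<alpha>_\<alpha>])
  moreover have "{x \<in> \<Phi>. \<alpha> x \<noteq> x} = \<Phi>" using \<alpha>_ne by auto
  moreover have "card \<Phi> = 2 * card D" by (simp add: \<Phi>_def card_cartesian_product)
  ultimately have "cycles (s \<circ> \<alpha>) \<Phi> \<le> 2 * card (f ` D)" using cycles_s ncomp_G euler by auto
  then have "card (\<Phi> // conn (graph_on (s \<circ> \<alpha>) \<Phi>)) \<le> card (g ` (f ` D \<times> UNIV))" using card by (simp add: ncomp_def)
  moreover have "g ` (f ` D \<times> UNIV) \<subseteq> \<Phi> // conn (graph_on (s \<circ> \<alpha>) \<Phi>)"
    using gz(1) by (auto simp: g_def intro!: quotientI)
  ultimately have eq: "g ` (f ` D \<times> UNIV) = \<Phi> // conn (graph_on (s \<circ> \<alpha>) \<Phi>)"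
    using finite_comps[OF fin\<Phi>] by (intro card_seteq) auto
  have cl: "cls y = cls (z (lab y)) \<or> cls y = cls (turn (z (lab y)))" if y: "y \<in> \<Phi>" for y
  proof -
    have "cls y \<in> g ` (f ` D \<times> UNIV)" using eq quotientI[OF y] by simp
    then obtain F b where Fb: "F \<in> f ` D" "cls y = cls (if b then z F else turn (z F))" by (auto simp: g_def)
    then have "y \<in> cls (if b then z F else turn (z F))" by (metis Image_singleton_iff conn_refl)
    then have "lab y = lab (if b then z F else turn (z F))" using cls_sub[OF gz(1)[OF Fb(1), of b]] by blast
    also have "\<dots> = F" by (rule gz(2)[OF Fb(1)])
    finally have "lab y = F" .
    then show ?thesis using Fb by (cases b) auto
  qed
  have F: "z (lab x) \<in> \<Phi>" using z assms(1) lab_image by blast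
  have yx: "y \<in> cls u" if "cls y = cls u" for u using that by (metis Image_singleton_iff conn_refl)
  have tc: "cls (turn u) = cls (turn w)" if "cls u = cls w" for u w
    using that turn_conn[of u w] by (simp only: conn_class_eq)
  have "cls y = cls x \<or> cls y = cls (turn x)"
    using cl[OF assms(1)]
  proof
    assume "cls x = cls (z (lab x))"
    then show ?thesis using cl[OF assms(2)] assms(3) tc[of x "z (lab x)"] by auto
  next
    assume "cls x = cls (turn (z (lab x)))"
    then show ?thesis using cl[OF assms(2)] assms(3) tc[of x "turn (z (lab x))"] turn(2)[OF F] by auto
  qed
  then show ?thesis using yx by blast
qed

lemma card_cls:
  assumes "x \<in> \<Phi>" shows "card {y \<in> \<Phi>. lab y = lab x} = 2 * card (cls x)"
proof -
  have "{y \<in> \<Phi>. lab y = lab x} = cls x \<union> cls (turn x)"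
  proof (intro equalityI subsetI)
    fix y assume "y \<in> {y \<in> \<Phi>. lab y = lab x}"
    then show "y \<in> cls x \<union> cls (turn x)" using label_cycles[OF assms, of y] by simp
  next
    fix y assume "y \<in> cls x \<union> cls (turn x)"
    then have "y \<in> \<Phi> \<and> lab y = lab x"
    proof
      assume "y \<in> cls x" then show ?thesis by (rule cls_sub[OF assms])
    next
      assume "y \<in> cls (turn x)"
      then have "y \<in> \<Phi> \<and> lab y = lab (turn x)" by (rule cls_sub[OF turn(1)[OF assms]])
      then show ?thesis using turn(3)[OF assms] by simp
    qed
    then show "y \<in> {y \<in> \<Phi>. lab y = lab x}" by simp
  qed
  moreover have "cls x \<inter> cls (turn x) = {}"
  proof (rule ccontr)
    assume "cls x \<inter> cls (turn x) \<noteq> {}"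
    then obtain y where "(x, y) \<in> conn (graph_on (s \<circ> \<alpha>) \<Phi>)" "(turn x, y) \<in> conn (graph_on (s \<circ> \<alpha>) \<Phi>)" by auto
    then have "(x, turn x) \<in> conn (graph_on (s \<circ> \<alpha>) \<Phi>)" using conn_trans conn_sym by metis
    then show False using cls_turn_disj[OF assms] by simp
  qed
  moreover have "finite (cls x)" "finite (cls (turn x))"
    using cls_sub[OF assms] cls_sub[OF turn(1)[OF assms]] by (auto intro!: finite_subset[OF _ fin\<Phi>])
  ultimately show ?thesis using card_cls_turn[OF assms] by (simp add: card_Un_disjoint)
qed

text \<open>Here a degree obtained by counting sides of edges becomes the length of a boundary walk,
  no matter how \<open>across\<close> has matched the sides.\<close>

lemma fdeg_cls: "x \<in> \<Phi> \<Longrightarrow> card (cls x) = fdeg (lab x)"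
  using card_cls[of x] by (simp add: fdeg_def)

lemma label_flag: "F \<in> f ` D \<Longrightarrow> \<exists>x\<in>\<Phi>. lab x = F"
  unfolding lab_image[symmetric] by blast

lemma card_label_flags: "F \<in> f ` D \<Longrightarrow> card {x \<in> \<Phi>. lab x = F} = 2 * fdeg F"
  using label_flag[of F] card_cls fdeg_cls by fastforce

lemma fdeg_pos: "F \<in> f ` D \<Longrightarrow> fdeg F > 0"
proof -
  assume "F \<in> f ` D"
  then obtain x where x: "x \<in> \<Phi>" "lab x = F" using label_flag by blast
  have "card (cls x) > 0" by (rule funpow_fixed_iff(2)[OF fin\<Phi> \<phi>_bij x(1)])
  then show ?thesis using fdeg_cls x by metis
qed

lemma sum_label_flags:
  "(\<Sum>x\<in>\<Phi>. h (lab x)) = (\<Sum>F\<in>f ` D. 2 * real (fdeg F) * h F)"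
proof -
  have "(\<Sum>x\<in>\<Phi>. h (lab x)) = (\<Sum>F\<in>f ` D. \<Sum>x | x \<in> \<Phi> \<and> lab x = F. h (lab x))"
    by (rule sum.group[symmetric]) (use fin\<Phi> finD lab_image in auto)
  also have "\<dots> = (\<Sum>F\<in>f ` D. 2 * real (fdeg F) * h F)"
    by (intro sum.cong) (auto simp: card_label_flags)
  finally show ?thesis .
qed

section \<open>Lifting the flag system by a group of permutations\<close>

lemma lift_conn:
  assumes "(x, y) \<in> conn G" "h permutes {..<N}" "a permutes {..<N}" "c permutes {..<N}"
  shows "\<exists>h'. h' permutes {..<N} \<and>
    ((x, h), (y, h')) \<in> conn (graph_on (map_prod s ((\<circ>) a)) (\<Phi> \<times> {h. h permutes {..<N}}) \<union>
       graph_on (map_prod \<alpha> ((\<circ>) c)) (\<Phi> \<times> {h. h permutes {..<N}}))"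
    (is "\<exists>h'. _ \<and> _ \<in> conn ?L")
proof -
  define Q where "Q z \<longleftrightarrow> (\<exists>h'. h' permutes {..<N} \<and> ((x, h), (z, h')) \<in> conn ?L)" for z
  have base: "((z, p), (s z, a \<circ> p)) \<in> conn ?L" "((z, p), (\<alpha> z, c \<circ> p)) \<in> conn ?L"
    if "z \<in> \<Phi>" "p permutes {..<N}" for z p
    using that by (auto intro!: conn_base simp: graph_on_def image_iff)
  have fwd: "\<exists>p'. p' permutes {..<N} \<and> ((z, p), (z', p')) \<in> conn ?L"
    if "(z, z') \<in> G" "p permutes {..<N}" for z z' p
  proof -
    have z: "z \<in> \<Phi>" "z' = s z \<or> z' = \<alpha> z" using that(1) by (auto simp: graph_on_def)
    then show ?thesis
      using base[OF z(1) that(2)] permutes_compose[OF that(2) assms(3)] permutes_compose[OF that(2) assms(4)] by blast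
  qed
  \<comment> \<open>To follow an arrow backwards the left factor \<open>q\<close> has to be
    cancelled; the permutation reached is \<open>inv q \<circ> p\<close>.\<close>
  have bwd: "\<exists>p'. p' permutes {..<N} \<and> ((z', p), (z, p')) \<in> conn ?L"
    if "(z, z') \<in> G" "p permutes {..<N}" for z z' p
  proof -
    have z: "z \<in> \<Phi>" "z' = s z \<or> z' = \<alpha> z" using that(1) by (auto simp: graph_on_def)
    have "\<exists>p'. p' permutes {..<N} \<and> q \<circ> p' = p" if "q permutes {..<N}" for q
      using that \<open>p permutes {..<N}\<close> permutes_compose[OF \<open>p permutes {..<N}\<close> permutes_inv[OF that]]
      by (intro exI[of _ "inv q \<circ> p"]) (simp add: o_assoc[symmetric] permutes_inv_o o_assoc)
    then obtain p1 p2 where p: "p1 permutes {..<N}" "a \<circ> p1 = p" "p2 permutes {..<N}" "c \<circ> p2 = p"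
      using assms(3,4) by metis
    have "((z', p), (z, p1)) \<in> conn ?L \<or> ((z', p), (z, p2)) \<in> conn ?L"
      using z(2) conn_sym[OF base(1)[OF z(1) p(1)]] conn_sym[OF base(2)[OF z(1) p(3)]] p by auto
    then show ?thesis using p by blast
  qed
  have step: "Q z'" if "Q z" "(z, z') \<in> G \<or> (z', z) \<in> G" for z z'
  proof -
    from that(1)[unfolded Q_def] obtain p where p: "p permutes {..<N}" "((x, h), (z, p)) \<in> conn ?L"
      by (elim exE conjE)
    from that(2) have "\<exists>p'. p' permutes {..<N} \<and> ((z, p), (z', p')) \<in> conn ?L"
    proof
      assume "(z, z') \<in> G" then show ?thesis by (rule fwd[OF _ p(1)])
    next
      assume "(z', z) \<in> G" then show ?thesis by (rule bwd[OF _ p(1)])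
    qed
    then obtain p' where p': "p' permutes {..<N}" "((z, p), (z', p')) \<in> conn ?L" by (elim exE conjE)
    have "((x, h), (z', p')) \<in> conn ?L" using p(2) p'(2) by (rule conn_trans)
    then show ?thesis unfolding Q_def by (intro exI[of _ p'] conjI p'(1))
  qed
  have "Q x = Q y"
  proof (rule conn_invariant[OF _ assms(1)])
    fix z z' assume "(z, z') \<in> G"
    then show "Q z = Q z'" using step[of z z'] step[of z' z] by argo
  qed
  moreover have "Q x" unfolding Q_def by (intro exI[of _ h] conjI assms(2) conn_refl)
  ultimately show ?thesis unfolding Q_def by simp
qed

text \<open>Left multiplication by a permutation other than the identity has no fixed point. So the
  iterate returns exactly when both the length of the base cycle and the order of \<open>q\<close>
  divide the exponent.\<close>

lemma lifted_cycle:
  assumes fx: "finite A" "bij_betw p A A" "x \<in> A" and h: "h permutes {..<N}" and q: "q permutes {..<N}"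
    and ord: "\<And>i. q ^^ i = id \<longleftrightarrow> l dvd i" "l > 0"
    and A': "finite A'" "bij_betw (map_prod p ((\<circ>) q)) A' A'" "(x, h) \<in> A'"
  shows "card (conn (graph_on (map_prod p ((\<circ>) q)) A') `` {(x, h)}) = lcm (card (conn (graph_on p A) `` {x})) l"
proof (rule card_cycle_class[OF A'])
  show "0 < lcm (card (conn (graph_on p A) `` {x})) l"
    using funpow_fixed_iff(2)[OF fx] ord(2) by (simp add: lcm_pos_nat)
  fix n
  have pow: "(map_prod p ((\<circ>) q) ^^ n) (x, h) = ((p ^^ n) x, (q ^^ n) \<circ> h)"
    by (induction n) (auto simp: o_assoc)
  have "(q ^^ n) \<circ> h = h \<longleftrightarrow> q ^^ n = id"
  proof
    assume "(q ^^ n) \<circ> h = h"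
    then have "(q ^^ n) \<circ> (h \<circ> inv h) = h \<circ> inv h" by (metis o_assoc)
    then show "q ^^ n = id" using permutes_inv_o(1)[OF h] by simp
  qed simp
  then show "(map_prod p ((\<circ>) q) ^^ n) (x, h) = (x, h) \<longleftrightarrow> lcm (card (conn (graph_on p A) `` {x})) l dvd n"
    unfolding pow using funpow_fixed_iff(1)[OF fx, of n] ord(1) by simp
qed

lemma lift_bij:
  assumes "bij_betw p A A" "q permutes {..<N}"
  shows "bij_betw (map_prod p ((\<circ>) q)) (A \<times> {h. h permutes {..<N}}) (A \<times> {h. h permutes {..<N}})"
proof -
  have "bij_betw ((\<circ>) q) {h. h permutes {..<N}} {h. h permutes {..<N}}"
  proof (rule bij_betw_byWitness[of _ "(\<circ>) (inv q)"])
    show "\<forall>h\<in>{h. h permutes {..<N}}. inv q \<circ> (q \<circ> h) = h"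
      using permutes_inv_o(2)[OF assms(2)] by (simp add: o_assoc)
    show "\<forall>h\<in>{h. h permutes {..<N}}. q \<circ> (inv q \<circ> h) = h"
      using permutes_inv_o(1)[OF assms(2)] by (simp add: o_assoc)
  qed (use assms(2) permutes_inv permutes_compose in blast)+
  then show ?thesis using assms(1) by (rule bij_betw_map_prod[rotated])
qed

lemma restrict_bij:
  assumes "finite A" "bij_betw p A A" "B \<subseteq> A" "p ` B \<subseteq> B" shows "bij_betw p B B"
  using assms unfolding bij_betw_def by (meson endo_inj_surj finite_subset inj_on_subset)

text \<open>Over a cycle of length \<open>m\<close> the lifted cycles have length \<open>lcm m l\<close>, hence the sums on the left.
  Every component of the lift meets the fibre over \<open>v\<close>, which bounds the number of components.\<close>

theorem lifted_count:
  assumes "k > 1" "l > 1"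
  defines "\<gamma> \<equiv> \<lambda>v. real (gcd (deg v) l) / real l" and "\<kappa> \<equiv> \<lambda>F. real (gcd (fdeg F) k) / real k"
  defines "S \<equiv> (\<Sum>v\<in>tail ` D. \<gamma> v) + (\<Sum>F\<in>f ` D. \<kappa> F)"
  shows "v \<in> tail ` D \<Longrightarrow> S \<le> card D / 2 + 2 * \<gamma> v" and "F \<in> f ` D \<Longrightarrow> S \<le> card D / 2 + 2 * \<kappa> F"
proof -
  obtain N and a c :: "nat \<Rightarrow> nat" where a: "a permutes {..<N}" and c: "c permutes {..<N}" "c \<circ> c = id"
    and ao: "\<And>i. a ^^ i = id \<longleftrightarrow> l dvd i" and aco: "\<And>i. (a \<circ> c) ^^ i = id \<longleftrightarrow> k dvd i"
    using triangle_group[OF assms(1,2)] by metis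
  \<comment> \<open>The full symmetric group is used in place of the subgroup generated by
    \<open>a\<close> and \<open>c\<close>. Further cosets can only add components, and the bound by
    a fibre counts these too.\<close>
  define H where "H = {h :: nat \<Rightarrow> nat. h permutes {..<N}}"
  have finH: "finite H" unfolding H_def by (rule finite_permutations) simp
  have "id \<in> H" by (simp add: H_def permutes_id)
  then have H: "card H > 0" using finH by (auto simp: card_gt_0_iff)
  define B where "B = \<Phi> \<times> H"
  have finB: "finite B" using fin\<Phi> finH by (simp add: B_def)
  define s' :: "('d \<times> bool) \<times> (nat \<Rightarrow> nat) \<Rightarrow> _" where "s' = map_prod s ((\<circ>) a)"
  define \<alpha>' :: "('d \<times> bool) \<times> (nat \<Rightarrow> nat) \<Rightarrow> _" where "\<alpha>' = map_prod \<alpha> ((\<circ>) c)"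
  have \<phi>': "s' \<circ> \<alpha>' = map_prod (s \<circ> \<alpha>) ((\<circ>) (a \<circ> c))" by (auto simp: s'_def \<alpha>'_def o_assoc)
  have ac: "a \<circ> c permutes {..<N}" by (rule permutes_compose[OF c(1) a])
  have s'B: "bij_betw s' B B" unfolding s'_def B_def H_def by (rule lift_bij[OF s_bij a])
  have \<phi>'B: "bij_betw (s' \<circ> \<alpha>') B B" unfolding \<phi>' B_def H_def by (rule lift_bij[OF \<phi>_bij ac])
  let ?L = "graph_on s' B \<union> graph_on \<alpha>' B"
  \<comment> \<open>Formulated for every invariant part \<open>B'\<close> of the lift, since the
    lengths are used both for the whole lift and for a single fibre.\<close>
  have cs: "card (conn (graph_on s' B') `` {(x, h)}) = lcm (deg (tail (fst x))) l"
    if "B' \<subseteq> B" "s' ` B' \<subseteq> B'" "(x, h) \<in> B'" for B' x h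
    unfolding card_vertex_class[OF subsetD[OF that(1) that(3), unfolded B_def, THEN mem_Times_iff[THEN iffD1], THEN conjunct1, simplified], symmetric]
    unfolding s'_def
    by (rule lifted_cycle[OF fin\<Phi> s_bij _ _ a ao])
       (use that finB assms restrict_bij[OF finB s'B that(1,2)] in \<open>auto simp: B_def H_def s'_def intro: finite_subset\<close>)
  have c\<phi>: "card (conn (graph_on (s' \<circ> \<alpha>') B') `` {(x, h)}) = lcm (fdeg (lab x)) k"
    if "B' \<subseteq> B" "(s' \<circ> \<alpha>') ` B' \<subseteq> B'" "(x, h) \<in> B'" for B' x h
    unfolding fdeg_cls[OF subsetD[OF that(1) that(3), unfolded B_def, THEN mem_Times_iff[THEN iffD1], THEN conjunct1, simplified], symmetric]
    unfolding \<phi>'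
    by (rule lifted_cycle[OF fin\<Phi> \<phi>_bij _ _ ac aco])
       (use that finB assms restrict_bij[OF finB \<phi>'B that(1,2)] in \<open>auto simp: B_def H_def \<phi>' intro: finite_subset\<close>)
  have cyc_s: "real (cycles s' B') = (\<Sum>x\<in>B'. 1 / lcm (deg (tail (fst (fst x)))) l)" if "B' \<subseteq> B" "s' ` B' \<subseteq> B'" for B'
  proof -
    have "real (cycles s' B') = (\<Sum>x\<in>B'. 1 / card (conn (graph_on s' B') `` {x}))"
      using that finite_subset[OF that(1) finB] by (intro ncomp_eq_sum) (auto simp: graph_on_def)
    also have "\<dots> = (\<Sum>x\<in>B'. 1 / lcm (deg (tail (fst (fst x)))) l)"
      using cs[OF that] by (intro sum.cong) (metis prod.collapse)+
    finally show ?thesis .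
  qed
  have cyc_\<phi>: "real (cycles (s' \<circ> \<alpha>') B') = (\<Sum>x\<in>B'. 1 / lcm (fdeg (lab (fst x))) k)" if "B' \<subseteq> B" "(s' \<circ> \<alpha>') ` B' \<subseteq> B'" for B'
  proof -
    have "real (cycles (s' \<circ> \<alpha>') B') = (\<Sum>x\<in>B'. 1 / card (conn (graph_on (s' \<circ> \<alpha>') B') `` {x}))"
      using that finite_subset[OF that(1) finB] by (intro ncomp_eq_sum) (auto simp: graph_on_def)
    also have "\<dots> = (\<Sum>x\<in>B'. 1 / lcm (fdeg (lab (fst x))) k)"
      using c\<phi>[OF that] by (intro sum.cong) (metis prod.collapse)+
    finally show ?thesis .
  qed
  have sumB: "(\<Sum>x\<in>A \<times> H. g (fst x)) = real (card H) * (\<Sum>x\<in>A. g x)" for A and g :: "'d \<times> bool \<Rightarrow> real"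
  proof -
    have "(\<Sum>x\<in>A. \<Sum>h\<in>H. g x) = (\<Sum>x\<in>A \<times> H. g (fst x))"
      unfolding sum.cartesian_product by (simp only: case_prod_unfold)
    from this[symmetric] show ?thesis by (simp add: sum_distrib_left)
  qed
  have zs: "real (cycles s' B) = 2 * real (card H) * (\<Sum>v\<in>tail ` D. \<gamma> v)"
  proof -
    have "real (cycles s' B) = real (card H) * (\<Sum>x\<in>\<Phi>. 1 / lcm (deg (tail (fst x))) l)"
      using cyc_s[of B] s'B sumB[of "\<lambda>x. 1 / lcm (deg (tail (fst x))) l" \<Phi>] by (simp add: bij_betw_def B_def)
    also have "(\<Sum>x\<in>\<Phi>. 1 / lcm (deg (tail (fst x))) l) = (\<Sum>v\<in>tail ` D. 2 * real (deg v) * (1 / lcm (deg v) l))"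
      by (rule sum_vertex_flags)
    also have "\<dots> = (\<Sum>v\<in>tail ` D. 2 * \<gamma> v)"
    proof (rule sum.cong[OF refl])
      fix v assume "v \<in> tail ` D"
      then have "real (deg v) / lcm (deg v) l = \<gamma> v" using div_lcm[of l "deg v"] deg_pos assms(2) by (simp add: \<gamma>_def)
      then show "2 * real (deg v) * (1 / lcm (deg v) l) = 2 * \<gamma> v" by simp
    qed
    also have "\<dots> = 2 * (\<Sum>v\<in>tail ` D. \<gamma> v)" by (simp add: sum_distrib_left)
    finally show ?thesis by (simp only: mult_ac)
  qed
  have z\<phi>: "real (cycles (s' \<circ> \<alpha>') B) = 2 * real (card H) * (\<Sum>F\<in>f ` D. \<kappa> F)"
  proof -
    have "real (cycles (s' \<circ> \<alpha>') B) = real (card H) * (\<Sum>x\<in>\<Phi>. 1 / lcm (fdeg (lab x)) k)"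
      using cyc_\<phi>[of B] \<phi>'B sumB[of "\<lambda>x. 1 / lcm (fdeg (lab x)) k" \<Phi>] by (simp add: bij_betw_def B_def)
    also have "(\<Sum>x\<in>\<Phi>. 1 / lcm (fdeg (lab x)) k) = (\<Sum>F\<in>f ` D. 2 * real (fdeg F) * (1 / lcm (fdeg F) k))"
      by (rule sum_label_flags)
    also have "\<dots> = (\<Sum>F\<in>f ` D. 2 * \<kappa> F)"
    proof (rule sum.cong[OF refl])
      fix F assume "F \<in> f ` D"
      then have "real (fdeg F) / lcm (fdeg F) k = \<kappa> F" using div_lcm[of k "fdeg F"] fdeg_pos assms(1) by (simp add: \<kappa>_def)
      then show "2 * real (fdeg F) * (1 / lcm (fdeg F) k) = 2 * \<kappa> F" by simp
    qed
    also have "\<dots> = 2 * (\<Sum>F\<in>f ` D. \<kappa> F)" by (simp add: sum_distrib_left)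
    finally show ?thesis by (simp only: mult_ac)
  qed
  have \<alpha>': "\<alpha>' x \<in> B" "\<alpha>' (\<alpha>' x) = x" "\<alpha>' x \<noteq> x" if "x \<in> B" for x
  proof -
    obtain y h where x: "x = (y, h)" by (cases x)
    have y: "y \<in> \<Phi>" "h permutes {..<N}" using that x by (auto simp: B_def H_def)
    show "\<alpha>' x \<in> B" using y \<alpha>_in permutes_compose[OF y(2) c(1)] by (simp add: x \<alpha>'_def B_def H_def)
    show "\<alpha>' (\<alpha>' x) = x" using \<alpha>_\<alpha>[OF y(1)] c(2) by (simp add: x \<alpha>'_def o_assoc)
    show "\<alpha>' x \<noteq> x" using \<alpha>_ne[OF y(1)] by (simp add: x \<alpha>'_def)
  qed
  have "2 * (cycles s' B + cycles (s' \<circ> \<alpha>') B) \<le> card {x \<in> B. \<alpha>' x \<noteq> x} + 4 * ncomp ?L B"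
    by (rule genus_inequality[OF finB s'B \<alpha>'(1,2)])
  moreover have "{x \<in> B. \<alpha>' x \<noteq> x} = B" using \<alpha>'(3) by auto
  moreover have "card B = 2 * card D * card H" by (simp add: B_def \<Phi>_def card_cartesian_product)
  ultimately have "real (2 * (cycles s' B + cycles (s' \<circ> \<alpha>') B)) \<le> real (2 * card D * card H + 4 * ncomp ?L B)"
    by (simp only: of_nat_le_iff)
  then have main: "4 * real (card H) * S \<le> 2 * real (card D) * real (card H) + 4 * real (ncomp ?L B)"
    by (simp add: zs z\<phi> S_def algebra_simps)
  \<comment> \<open>After division by \<open>4 * card H\<close> it remains to bound the number of
    components by the number of lifted cycles over one vertex or face, which is
    \<open>2 * card H * g\<close>.\<close>
  have fin: "S \<le> card D / 2 + 2 * g" if "real (ncomp ?L B) \<le> 2 * real (card H) * g" for g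
  proof -
    have "4 * real (card H) * S \<le> 2 * real (card D) * real (card H) + 4 * (2 * real (card H) * g)" using main that by linarith
    then have "4 * real (card H) * S \<le> 4 * real (card H) * (card D / 2 + 2 * g)" by (simp add: algebra_simps)
    then show ?thesis using H by (subst (asm) mult_le_cancel_left_pos) auto
  qed
  have lift: "\<exists>h'. h' \<in> H \<and> ((x, h), (y, h')) \<in> conn ?L" if "(x, y) \<in> conn G" "(x, h) \<in> B" for x y h
    using lift_conn[OF that(1) _ a c(1), of h] that(2) unfolding B_def H_def s'_def \<alpha>'_def by simp
  show "S \<le> card D / 2 + 2 * \<gamma> v" if v: "v \<in> tail ` D"
  proof (rule fin)
    obtain d where d: "d \<in> D" "tail d = v" using v by blast
    define A where "A = {x \<in> \<Phi>. tail (fst x) = v}"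
    have AB: "A \<times> H \<subseteq> B" by (auto simp: A_def B_def)
    have inv: "s' ` (A \<times> H) \<subseteq> A \<times> H"
    proof (rule image_subsetI)
      fix y assume "y \<in> A \<times> H"
      then obtain x h where y: "y = (x, h)" "x \<in> \<Phi>" "tail (fst x) = v" "h permutes {..<N}"
        by (auto simp: A_def H_def)
      have "tail (fst (s x)) = v" using turn(5)[OF flip(1)[OF y(2)]] y(3) by (simp add: s_def) (simp add: flip_def)
      then show "s' y \<in> A \<times> H"
        using s_in[OF y(2)] permutes_compose[OF y(4) a] by (simp add: y(1) A_def H_def s'_def)
    qed
    have "ncomp ?L B \<le> cycles s' (A \<times> H)"
    proof (rule ncomp_le_meeting[OF finite_subset[OF AB finB] AB])
      show "graph_on s' (A \<times> H) \<subseteq> conn ?L" using AB by (intro subset_conn) (auto simp: graph_on_def)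
      fix x assume x: "x \<in> B"
      obtain b where b: "(fst x, (d, b)) \<in> conn G" using flag_conn[of "fst x" d] x d by (auto simp: B_def)
      obtain h' where "h' \<in> H" "(x, ((d, b), h')) \<in> conn ?L" using lift[OF b, of "snd x"] x by auto
      moreover have "((d, b), h') \<in> A \<times> H" using d calculation(1) by (simp add: A_def \<Phi>_def)
      ultimately show "\<exists>y\<in>A \<times> H. (x, y) \<in> conn ?L" by blast
    qed
    then have "real (ncomp ?L B) \<le> (\<Sum>x\<in>A \<times> H. 1 / lcm (deg (tail (fst (fst x)))) l)"
      using cyc_s[OF AB inv] by linarith
    also have "\<dots> = real (card H) * (\<Sum>x\<in>A. 1 / lcm (deg (tail (fst x))) l)" by (rule sumB)
    also have "(\<Sum>x\<in>A. 1 / lcm (deg (tail (fst x))) l) = (\<Sum>x\<in>A. 1 / lcm (deg v) l)"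
      by (intro sum.cong) (auto simp: A_def)
    also have "\<dots> = 2 * (real (deg v) / lcm (deg v) l)" using card_vertex_flags[of v] by (simp add: A_def)
    also have "real (deg v) / lcm (deg v) l = \<gamma> v" using deg_pos[OF v] assms(2) div_lcm by (simp add: \<gamma>_def)
    finally show "real (ncomp ?L B) \<le> 2 * real (card H) * \<gamma> v" by simp
  qed
  show "S \<le> card D / 2 + 2 * \<kappa> F" if F: "F \<in> f ` D"
  proof (rule fin)
    obtain y where y: "y \<in> \<Phi>" "lab y = F" using label_flag[OF F] by blast
    define A where "A = {x \<in> \<Phi>. lab x = F}"
    have AB: "A \<times> H \<subseteq> B" by (auto simp: A_def B_def)
    have inv: "(s' \<circ> \<alpha>') ` (A \<times> H) \<subseteq> A \<times> H"
    proof (rule image_subsetI)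
      fix y assume "y \<in> A \<times> H"
      then obtain x h where y: "y = (x, h)" "x \<in> \<Phi>" "lab x = F" "h permutes {..<N}"
        by (auto simp: A_def H_def)
      have "(s' \<circ> \<alpha>') y = (turn (across x), (a \<circ> c) \<circ> h)" unfolding \<phi>' by (simp add: y(1) s_\<alpha>)
      moreover have "turn (across x) \<in> A" using turn(1,3)[OF across(1)[OF y(2)]] across(3)[OF y(2)] y(3) by (simp add: A_def)
      ultimately show "(s' \<circ> \<alpha>') y \<in> A \<times> H" using permutes_compose[OF y(4) ac] by (simp add: H_def)
    qed
    have "ncomp ?L B \<le> cycles (s' \<circ> \<alpha>') (A \<times> H)"
    proof (rule ncomp_le_meeting[OF finite_subset[OF AB finB] AB])
      show "graph_on (s' \<circ> \<alpha>') (A \<times> H) \<subseteq> conn ?L"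
      proof -
        have "(x, s' (\<alpha>' x)) \<in> conn ?L" if "x \<in> B" for x
        proof (rule conn_trans)
          show "(x, \<alpha>' x) \<in> conn ?L" using that by (intro conn_base) (auto simp: graph_on_def)
          show "(\<alpha>' x, s' (\<alpha>' x)) \<in> conn ?L" using \<alpha>'(1)[OF that] by (intro conn_base) (auto simp: graph_on_def)
        qed
        then show ?thesis using AB by (auto simp: graph_on_def)
      qed
      fix x assume x: "x \<in> B"
      then have x\<Phi>: "fst x \<in> \<Phi>" by (auto simp: B_def)
      \<comment> \<open>If only the other side \<open>flip y\<close> of the dart can be reached, one
        step of \<open>s\<close> leads from there to \<open>turn y\<close>, which again has the
        label \<open>F\<close>.\<close>
      have "\<exists>z\<in>A. (fst x, z) \<in> conn G"
      proof (cases "(fst x, y) \<in> conn G")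
        case True
        moreover have "y \<in> A" using y by (simp add: A_def)
        ultimately show ?thesis by (rule bexI)
      next
        case False
        then have "(fst x, flip y) \<in> conn G"
          using flag_conn[OF x\<Phi>, of "fst y"] y by (cases y; cases "snd y") (auto simp: in\<Phi> flip_def)
        moreover have "(flip y, turn y) \<in> conn G"
          by (intro conn_base UnI1) (simp add: graph_on_def s_def image_iff, metis flip(1,2) y(1))
        ultimately have "(fst x, turn y) \<in> conn G" by (rule conn_trans)
        moreover have "turn y \<in> A" using turn(1,3)[OF y(1)] y(2) by (simp add: A_def)
        ultimately show ?thesis by (rule bexI)
      qed
      then obtain z where z: "z \<in> A" "(fst x, z) \<in> conn G" by blast
      obtain h' where "h' \<in> H" "(x, (z, h')) \<in> conn ?L" using lift[OF z(2), of "snd x"] x by auto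
      then show "\<exists>y\<in>A \<times> H. (x, y) \<in> conn ?L" using z(1) by blast
    qed
    then have "real (ncomp ?L B) \<le> (\<Sum>x\<in>A \<times> H. 1 / lcm (fdeg (lab (fst x))) k)"
      using cyc_\<phi>[OF AB inv] by linarith
    also have "\<dots> = real (card H) * (\<Sum>x\<in>A. 1 / lcm (fdeg (lab x)) k)" by (rule sumB)
    also have "(\<Sum>x\<in>A. 1 / lcm (fdeg (lab x)) k) = (\<Sum>x\<in>A. 1 / lcm (fdeg F) k)"
      by (intro sum.cong) (auto simp: A_def)
    also have "\<dots> = 2 * (real (fdeg F) / lcm (fdeg F) k)" using card_label_flags[OF F] by (simp add: A_def)
    also have "real (fdeg F) / lcm (fdeg F) k = \<kappa> F" using fdeg_pos[OF F] assms(1) div_lcm by (simp add: \<kappa>_def)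
    finally show "real (ncomp ?L B) \<le> 2 * real (card H) * \<kappa> F" by simp
  qed
qed

end

section \<open>Local structure of a star of arcs in the plane\<close>

text \<open>Janiszewski's theorem is applied to \<open>T\<close> and to the union of
  \<open>A\<close> with the circle of radius \<epsilon>. The rest of \<open>T\<close> lies in the
  open ball, so the two sets meet in the connected set \<open>A\<close>. Neither separates the two
  points, hence their union does not, and a connected set that avoids the circle cannot leave the
  ball.\<close>

lemma locally_connected_at_Janiszewski:
  fixes T A :: "complex set"
  assumes "compact T" "compact A" "connected A" "A \<subseteq> T" "p \<notin> A" "T - A \<subseteq> ball p \<epsilon>" "\<epsilon> > 0"
  obtains \<delta> where "\<delta> > 0" "\<delta> \<le> \<epsilon>"
    "\<And>a b. \<lbrakk>a \<in> ball p \<delta>; b \<in> ball p \<delta>; connected_component (- T) a b\<rbrakk> \<Longrightarrow>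
        connected_component (ball p \<epsilon> - T) a b"
proof -
  obtain d where d: "d > 0" "ball p d \<inter> A = {}"
    using \<open>compact A\<close> \<open>p \<notin> A\<close>
    by (metis Compl_disjoint2 ComplI compact_imp_closed open_Compl open_contains_ball disjoint_eq_subset_Compl)
  show ?thesis
  proof (rule that [of "min d \<epsilon>"])
    fix a b assume ab: "a \<in> ball p (min d \<epsilon>)" "b \<in> ball p (min d \<epsilon>)" "connected_component (- T) a b"
    have "connected_component (- (sphere p \<epsilon> \<union> A)) a b"
      unfolding connected_component_def
      by (rule exI [of _ "ball p (min d \<epsilon>)"]) (use ab d(2) in \<open>auto simp: disjoint_iff\<close>)
    moreover have "(sphere p \<epsilon> \<union> A) \<inter> T = A \<union> (sphere p \<epsilon> \<inter> (T - A))"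
      using assms by blast
    moreover have "sphere p \<epsilon> \<inter> (T - A) = {}"
      using assms by (auto simp: sphere_def)
    ultimately have "connected ((sphere p \<epsilon> \<union> A) \<inter> T)" "connected_component (- (sphere p \<epsilon> \<union> A)) a b"
      using assms(3) by simp_all
    then have "connected_component (- ((sphere p \<epsilon> \<union> A) \<union> T)) a b"
      using assms(1-2) ab(3) by (intro Janiszewski[of "sphere p \<epsilon> \<union> A" T]) (simp_all only: compact_imp_closed compact_Un compact_sphere)
    then obtain C where C: "connected C" "C \<subseteq> - ((sphere p \<epsilon> \<union> A) \<union> T)" "a \<in> C" "b \<in> C"
      unfolding connected_component_def by blast
    have "C \<subseteq> ball p \<epsilon>"
    proof (rule ccontr)
      assume "\<not> C \<subseteq> ball p \<epsilon>"
      then have "C \<inter> frontier (ball p \<epsilon>) \<noteq> {}"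
        using C ab by (intro connected_Int_frontier) auto
      then show False
        using C \<open>\<epsilon> > 0\<close> by auto
    qed
    with C show "connected_component (ball p \<epsilon> - T) a b"
      unfolding connected_component_def by blast
  qed (use d assms in auto)
qed

text \<open>The connected part \<open>A\<close> in \<open>locally_connected_at_Janiszewski\<close>
  is the curve without a short piece around \<open>p\<close>. The conclusion rules out that the
  inside approaches \<open>p\<close> in several strands that are joined only far away.\<close>

lemma Jordan_locally_connected_at:
  fixes \<gamma> :: "real \<Rightarrow> complex"
  assumes \<gamma>: "simple_path \<gamma>" "pathstart \<gamma> = p" "pathfinish \<gamma> = p" and "\<epsilon> > 0"
  obtains \<delta> where "\<delta> > 0" "\<delta> \<le> \<epsilon>"
    "\<And>a b. \<lbrakk>a \<in> ball p \<delta>; b \<in> ball p \<delta>; a \<in> inside (path_image \<gamma>); b \<in> inside (path_image \<gamma>)\<rbrakk> \<Longrightarrow>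
        connected_component (ball p \<epsilon> \<inter> inside (path_image \<gamma>)) a b"
proof -
  have cont: "continuous_on {0..1} \<gamma>"
    using \<gamma> simple_path_imp_path path_def by blast
  have e: "\<gamma> 0 = p" "\<gamma> 1 = p"
    using \<gamma> by (auto simp: pathstart_def pathfinish_def)
  obtain d0 where d0: "d0 > 0" "\<And>t. \<lbrakk>t \<in> {0..1}; dist t 0 < d0\<rbrakk> \<Longrightarrow> dist (\<gamma> t) p < \<epsilon>"
    using cont \<open>\<epsilon> > 0\<close> e unfolding continuous_on_iff
    by (metis atLeastAtMost_iff order_refl zero_le_one)
  obtain d1 where d1: "d1 > 0" "\<And>t. \<lbrakk>t \<in> {0..1}; dist t 1 < d1\<rbrakk> \<Longrightarrow> dist (\<gamma> t) p < \<epsilon>"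
    using cont \<open>\<epsilon> > 0\<close> e unfolding continuous_on_iff
    by (metis atLeastAtMost_iff order_refl zero_le_one)
  \<comment> \<open>Below both moduli of continuity, so that the piece cut off at either end of the
    parameter interval stays within \<epsilon> of \<open>p\<close>.\<close>
  define \<tau> where "\<tau> = min (min d0 d1) (1/2) / 2"
  have \<tau>: "0 < \<tau>" "\<tau> < 1/2" "\<tau> < d0" "\<tau> < d1"
    using d0 d1 by (auto simp: \<tau>_def min_def)
  let ?A = "\<gamma> ` {\<tau>..1-\<tau>}"
  have sub: "{\<tau>..1-\<tau>} \<subseteq> {0..1}" using \<tau> by auto
  have pA: "p \<notin> ?A"
  proof
    assume "p \<in> ?A"
    then obtain t where t: "\<tau> \<le> t" "t \<le> 1 - \<tau>" "\<gamma> t = \<gamma> 0" using e by auto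
    then have "t = 0 \<or> t = 1"
      using \<gamma>(1) \<tau> unfolding simple_path_def loop_free_def by force
    with t \<tau> show False by auto
  qed
  have sm: "path_image \<gamma> - ?A \<subseteq> ball p \<epsilon>"
  proof
    fix z assume "z \<in> path_image \<gamma> - ?A"
    then obtain t where t: "t \<in> {0..1}" "z = \<gamma> t" and "z \<notin> ?A"
      by (auto simp: path_image_def)
    then have "\<not> (\<tau> \<le> t \<and> t \<le> 1 - \<tau>)" by auto
    with t show "z \<in> ball p \<epsilon>"
      using d0(2)[of t] d1(2)[of t] \<tau> by (auto simp: dist_commute dist_real_def)
  qed
  have com: "compact (path_image \<gamma>)" using \<gamma> by (simp add: compact_simple_path_image)
  have "continuous_on {\<tau>..1-\<tau>} \<gamma>" using sub cont continuous_on_subset by blast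
  then have A: "compact ?A" "connected ?A"
    by (simp_all add: compact_continuous_image connected_continuous_image)
  have "?A \<subseteq> path_image \<gamma>" using sub by (auto simp: path_image_def)
  from locally_connected_at_Janiszewski [OF com A this pA sm \<open>\<epsilon> > 0\<close>]
  obtain \<delta> where \<delta>: "\<delta> > 0" "\<delta> \<le> \<epsilon>"
    "\<And>a b. \<lbrakk>a \<in> ball p \<delta>; b \<in> ball p \<delta>; connected_component (- path_image \<gamma>) a b\<rbrakk> \<Longrightarrow>
        connected_component (ball p \<epsilon> - path_image \<gamma>) a b" by metis
  have J: "connected (inside (path_image \<gamma>))" "inside (path_image \<gamma>) \<inter> path_image \<gamma> = {}"
    using Jordan_inside_outside [of \<gamma>] \<gamma> by (auto simp: inside_no_overlap)
  show ?thesis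
  proof (rule that [OF \<delta>(1,2)])
    fix a b assume ab: "a \<in> ball p \<delta>" "b \<in> ball p \<delta>" "a \<in> inside (path_image \<gamma>)" "b \<in> inside (path_image \<gamma>)"
    have "connected_component (- path_image \<gamma>) a b"
      unfolding connected_component_def using J ab by blast
    then have "connected_component (ball p \<epsilon> - path_image \<gamma>) a b"
      using \<delta> ab by blast
    then obtain C where C: "connected C" "C \<subseteq> ball p \<epsilon> - path_image \<gamma>" "a \<in> C" "b \<in> C"
      unfolding connected_component_def by blast
    have "C \<subseteq> inside (path_image \<gamma>)"
    proof
      fix z assume "z \<in> C"
      then have "connected_component (- path_image \<gamma>) a z"
        unfolding connected_component_def using C by blast
      then show "z \<in> inside (path_image \<gamma>)"
        using ab(3) inside_same_component by metis
    qed
    with C show "connected_component (ball p \<epsilon> \<inter> inside (path_image \<gamma>)) a b"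
      unfolding connected_component_def by blast
  qed
qed

section \<open>Sectors of a disc cut by arcs from its centre\<close>

definition circ :: "complex \<Rightarrow> real \<Rightarrow> real \<Rightarrow> complex" where
  "circ p r t = p + of_real r * cis t"

lemma dist_circ: "r > 0 \<Longrightarrow> dist p (circ p r t) = r"
  by (simp add: circ_def dist_norm norm_mult)

lemma circ_eqD:
  assumes "circ p r s = circ p r t" "r > 0" "\<bar>s - t\<bar> < 2 * pi"
  shows "s = t"
proof -
  have "cis s = cis t" using assms by (simp add: circ_def)
  then have "cis (s - t) = 1" by (simp flip: cis_divide)
  then have "cos (s - t) = 1" by (metis cis.sel(1) one_complex.sel(1))
  then obtain m where "s - t = of_int m * 2 * pi"
    using cos_one_2pi_int by auto
  with assms have "\<bar>of_int m :: real\<bar> * (2*pi) < 1 * (2 * pi)"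
    by (simp add: abs_mult)
  then have "m = 0"
    by (subst (asm) mult_less_cancel_right) auto
  then show ?thesis using \<open>s - t = _\<close> by simp
qed

text \<open>Index \<open>n\<close> repeats index 0 with a full turn added to the angle, so the last
  sector has the same form as the others. With at least two spokes each sector is bounded by a
  Jordan curve.\<close>

locale spokes =
  fixes p :: complex and r :: real and n :: nat
    and g :: "nat \<Rightarrow> real \<Rightarrow> complex" and \<theta> :: "nat \<Rightarrow> real"
  assumes r: "r > 0" and n: "n \<ge> 2"
    and arcs: "\<And>i. i < n \<Longrightarrow> arc (g i)"
    and starts: "\<And>i. i < n \<Longrightarrow> pathstart (g i) = p"
    and finishes: "\<And>i. i < n \<Longrightarrow> pathfinish (g i) = circ p r (\<theta> i)"
    and inball: "\<And>i. i < n \<Longrightarrow> path_image (g i) - {pathfinish (g i)} \<subseteq> ball p r"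
    and disj: "\<And>i j. \<lbrakk>i < n; j < n; i \<noteq> j\<rbrakk> \<Longrightarrow> path_image (g i) \<inter> path_image (g j) = {p}"
    and wrap: "g n = g 0" "\<theta> n = \<theta> 0 + 2 * pi"
    and mono: "\<And>i j. \<lbrakk>i < j; j \<le> n\<rbrakk> \<Longrightarrow> \<theta> i < \<theta> j"
begin

abbreviation "P i \<equiv> path_image (g i)"
abbreviation "A i \<equiv> circ p r ` {\<theta> i..\<theta> (Suc i)}"
definition "J i = P i \<union> A i \<union> P (Suc i)"
definition "loop i = g i +++ part_circlepath p r (\<theta> i) (\<theta> (Suc i)) +++ reversepath (g (Suc i))"

lemma ends: assumes "i \<le> n"
  shows "arc (g i)" "pathstart (g i) = p" "pathfinish (g i) = circ p r (\<theta> i)"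
    "path_image (g i) - {circ p r (\<theta> i)} \<subseteq> ball p r" "circ p r (\<theta> i) \<in> P i" "p \<in> P i"
proof -
  have "circ p r (\<theta> n) = circ p r (\<theta> 0)"
    by (simp add: wrap circ_def flip: cis_mult)
  then have "\<exists>k<n. g i = g k \<and> circ p r (\<theta> i) = circ p r (\<theta> k)"
    using assms n wrap by (intro exI[of _ "if i = n then 0 else i"]) auto
  then obtain k where k: "k < n" "g i = g k" "circ p r (\<theta> i) = circ p r (\<theta> k)"
    by blast
  show "arc (g i)" "pathstart (g i) = p" "pathfinish (g i) = circ p r (\<theta> i)"
    unfolding k(2,3) using arcs starts finishes k(1) by blast+
  show "path_image (g i) - {circ p r (\<theta> i)} \<subseteq> ball p r"
    unfolding k(2,3) using inball[OF k(1)] finishes[OF k(1)] by simp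
  show "circ p r (\<theta> i) \<in> P i"
    using \<open>pathfinish (g i) = _\<close> pathfinish_in_path_image[of "g i"] by simp
  show "p \<in> P i"
    using \<open>pathstart (g i) = _\<close> pathstart_in_path_image[of "g i"] by simp
qed

lemma wrapP: "P n = P 0" using wrap by simp

lemma mono_le: "\<lbrakk>i \<le> j; j \<le> n\<rbrakk> \<Longrightarrow> \<theta> i \<le> \<theta> j"
  using mono[of i j] by (cases "i = j") auto

lemma angle_range: "i \<le> n \<Longrightarrow> \<theta> 0 \<le> \<theta> i \<and> \<theta> i \<le> \<theta> 0 + 2*pi"
  using mono_le[of 0 i] mono_le[of i n] wrap by auto

lemma circ_inj:
  assumes "circ p r s = circ p r t" "s \<in> {\<theta> 0..\<theta> n}" "t \<in> {\<theta> 0..\<theta> n}"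
  shows "s = t \<or> {s, t} = {\<theta> 0, \<theta> n}"
proof (cases "\<bar>s - t\<bar> < 2 * pi")
  case True
  then show ?thesis using circ_eqD assms r by blast
next
  case False
  then show ?thesis using assms wrap by auto
qed

lemma P_Int_circ: "\<lbrakk>i \<le> n; circ p r t \<in> P i\<rbrakk> \<Longrightarrow> circ p r t = circ p r (\<theta> i)"
  using ends(4)[of i] dist_circ[OF r, of p t] by (metis DiffI insertE mem_ball order_less_irrefl subsetD empty_iff)

lemma P_Int_A: "\<lbrakk>i \<le> n; z \<in> P i; z \<in> A j\<rbrakk> \<Longrightarrow> z = circ p r (\<theta> i)"
  using P_Int_circ by blast

lemma P_Int_P: "\<lbrakk>i \<le> n; j \<le> n; i \<noteq> j; {i,j} \<noteq> {0,n}\<rbrakk> \<Longrightarrow> P i \<inter> P j = {p}"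
  using disj[of i j] disj[of 0 j] disj[of i 0] wrapP n
  by (cases "i = n"; cases "j = n") (auto simp: doubleton_eq_iff)

lemma circle_arc:
  assumes "i < n"
  shows "pathfinish (part_circlepath p r (\<theta> i) (\<theta> (Suc i))) = circ p r (\<theta> (Suc i))"
    "pathstart (part_circlepath p r (\<theta> i) (\<theta> (Suc i))) = circ p r (\<theta> i)"
    "path_image (part_circlepath p r (\<theta> i) (\<theta> (Suc i))) = A i"
  using mono[of i "Suc i"] assms
  by (auto simp: path_image_part_circlepath' circ_def cis_conv_exp closed_segment_eq_real_ivl)

lemma path_image_loop:
  assumes "i < n" shows "path_image (loop i) = J i"
  using circle_arc[OF assms] ends(3)[of i] ends(3)[of "Suc i"] assms
  by (simp add: loop_def J_def path_image_join Un_assoc)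

lemma simple_loop:
  assumes "i < n" shows "simple_path (loop i)" "pathstart (loop i) = p" "pathfinish (loop i) = p"
proof -
  note eq = circle_arc(1,2)[OF assms]
  note im = circle_arc(3)[OF assms]
  \<comment> \<open>Strictly less than a full turn, because \<open>n \<ge> 2\<close> and the other
    sectors take up a positive angle.\<close>
  have lt: "\<theta> i < \<theta> (Suc i)" "\<theta> (Suc i) - \<theta> i < 2 * pi"
  proof -
    show "\<theta> i < \<theta> (Suc i)" using mono assms by simp
    show "\<theta> (Suc i) - \<theta> i < 2 * pi"
    proof (cases "i = 0")
      case True
      then show ?thesis using mono[of 1 n] n wrap by auto
    next
      case False
      then show ?thesis using mono[of 0 i] mono_le[of "Suc i" n] assms wrap by auto
    qed
  qed
  have arc2: "arc (part_circlepath p r (\<theta> i) (\<theta> (Suc i)) +++ reversepath (g (Suc i)))"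
  proof (rule arc_join)
    show "arc (part_circlepath p r (\<theta> i) (\<theta> (Suc i)))"
      using lt r by (intro arc_part_circlepath) auto
    show "path_image (part_circlepath p r (\<theta> i) (\<theta> (Suc i))) \<inter> path_image (reversepath (g (Suc i)))
        \<subseteq> {pathstart (reversepath (g (Suc i)))}"
      unfolding im using P_Int_A[of "Suc i" _ i] ends(3)[of "Suc i"] assms
      by (metis Int_iff Suc_leI insertI1 path_image_reversepath pathstart_reversepath subsetI)
  qed (use ends(1,3)[of "Suc i"] assms eq in \<open>simp_all add: arc_reversepath\<close>)
  have Pii: "P i \<inter> P (Suc i) = {p}"
    using P_Int_P[of i "Suc i"] assms n by (cases "i = 0") (auto simp: doubleton_eq_iff)
  show "simple_path (loop i)"
    unfolding loop_def
  proof (rule simple_path_join_loop)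
    show "path_image (g i) \<inter> path_image (part_circlepath p r (\<theta> i) (\<theta> (Suc i)) +++ reversepath (g (Suc i))) \<subseteq>
      {pathstart (g i), pathstart (part_circlepath p r (\<theta> i) (\<theta> (Suc i)) +++ reversepath (g (Suc i)))}"
    proof
      fix z assume z: "z \<in> path_image (g i) \<inter> path_image (part_circlepath p r (\<theta> i) (\<theta> (Suc i)) +++ reversepath (g (Suc i)))"
      then have "z \<in> A i \<or> z \<in> P (Suc i)"
        using ends(3)[of "Suc i"] assms eq by (subst (asm) path_image_join) (auto simp: im)
      then show "z \<in> {pathstart (g i), pathstart (part_circlepath p r (\<theta> i) (\<theta> (Suc i)) +++ reversepath (g (Suc i)))}"
        using P_Int_A[of i z i] z Pii ends(2)[of i] assms eq by auto
    qed
  qed (use ends(1-3)[of i] ends(1-3)[of "Suc i"] assms eq arc2 in simp_all)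
  show "pathstart (loop i) = p" "pathfinish (loop i) = p"
    using ends(2)[of i] ends(2)[of "Suc i"] assms by (simp_all add: loop_def)
qed

lemma Jordan:
  assumes "i < n"
  shows "inside (J i) \<noteq> {}" "open (inside (J i))" "connected (inside (J i))"
    "open (outside (J i))" "connected (outside (J i))" "\<not> bounded (outside (J i))"
    "bounded (inside (J i))" "inside (J i) \<inter> outside (J i) = {}" "inside (J i) \<union> outside (J i) = - J i"
    "frontier (inside (J i)) = J i" "compact (J i)"
proof -
  have "pathfinish (loop i) = pathstart (loop i)" using simple_loop[OF assms] by simp
  note * = Jordan_inside_outside[OF simple_loop(1)[OF assms] this, unfolded path_image_loop[OF assms]]
  show "inside (J i) \<noteq> {}" "open (inside (J i))" "connected (inside (J i))"
    "open (outside (J i))" "connected (outside (J i))" "\<not> bounded (outside (J i))"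
    "bounded (inside (J i))" "inside (J i) \<inter> outside (J i) = {}" "inside (J i) \<union> outside (J i) = - J i"
    "frontier (inside (J i)) = J i"
    using * by blast+
  show "compact (J i)"
    using compact_simple_path_image[OF simple_loop(1)[OF assms]] path_image_loop[OF assms] by simp
qed

lemma J_subset_cball: assumes "i < n" shows "J i \<subseteq> cball p r"
proof -
  have *: "circ p r t \<in> cball p r" for t using dist_circ[OF r] by simp
  have P: "P j \<subseteq> cball p r" if "j \<le> n" for j
  proof -
    have "P j \<subseteq> insert (circ p r (\<theta> j)) (ball p r)" using ends(4)[OF that] by blast
    then show ?thesis using * ball_subset_cball[of p r] by blast
  qed
  have "P i \<subseteq> cball p r" "P (Suc i) \<subseteq> cball p r" "A i \<subseteq> cball p r"
    using P[of i] P[of "Suc i"] assms * by (simp_all add: image_subset_iff)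
  then show ?thesis unfolding J_def by blast
qed

text \<open>The ray from \<open>z\<close> away from \<open>p\<close> meets the closed disc at most
  in \<open>z\<close>; it is an unbounded connected set that misses \<open>J i\<close>.\<close>

lemma outside_if_not_in_ball:
  assumes "i < n" "z \<notin> ball p r" "z \<notin> J i"
  shows "z \<in> outside (J i)"
proof -
  have "z \<noteq> p" using assms r by auto
  define L where "L = (\<lambda>t. p + of_real t * (z - p)) ` {1..}"
  have "connected L" unfolding L_def by (intro connected_continuous_image continuous_intros) auto
  have disjL: "w = z" if w: "w \<in> L" "w \<in> cball p r" for w
  proof -
    obtain t where t: "t \<ge> 1" "w = p + of_real t * (z - p)" using w(1) by (auto simp: L_def)
    have "dist p w = t * dist p z"
      using t by (simp add: dist_norm norm_mult norm_minus_commute)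
    moreover have "dist p z \<ge> r" using assms by auto
    ultimately have "t * dist p z \<le> 1 * dist p z" using w by auto
    then have "t \<le> 1" using \<open>z \<noteq> p\<close> by (subst (asm) mult_le_cancel_right) auto
    then show ?thesis using t by auto
  qed
  have "L \<inter> J i = {}" using disjL J_subset_cball[OF assms(1)] assms(3) by blast
  moreover have "z \<in> L" unfolding L_def by (auto intro!: image_eqI[of _ _ 1])
  moreover have "\<not> bounded L"
  proof
    assume "bounded L"
    then obtain B where B: "\<And>w. w \<in> L \<Longrightarrow> dist p w \<le> B" unfolding bounded_any_center[of L p] by auto
    define t where "t = \<bar>B\<bar> / dist p z + 1"
    have "t \<ge> 1" by (simp add: t_def)
    then have "dist p (p + of_real t * (z - p)) \<le> B" using B unfolding L_def by blast
    then have "t * dist p z \<le> B" using \<open>t \<ge> 1\<close> by (simp add: dist_norm norm_mult norm_minus_commute)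
    moreover have "t * dist p z = \<bar>B\<bar> + dist p z"
      using \<open>z \<noteq> p\<close> by (simp add: t_def distrib_right)
    moreover have "dist p z > 0" using \<open>z \<noteq> p\<close> by simp
    ultimately show False by linarith
  qed
  moreover have "L \<subseteq> connected_component_set (- J i) z"
    using calculation(1,2) \<open>connected L\<close> by (intro connected_component_maximal) auto
  ultimately have "\<not> bounded (connected_component_set (- J i) z)" using bounded_subset by blast
  then show ?thesis using assms(3) unfolding outside by blast
qed

text \<open>Without \<open>p\<close> a spoke is connected and misses \<open>J i\<close>, and its end
  on the circle is outside. Images are compared in the last hypothesis, and not indices, because the
  spokes 0 and \<open>n\<close> coincide.\<close>

lemma spoke_outside:
  assumes "i < n" "j < n" "j \<noteq> i" "P j \<noteq> P (Suc i)"
  shows "P j - {p} \<subseteq> outside (J i)"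
proof -
  have jj: "j \<noteq> Suc i" "{j, Suc i} \<noteq> {0,n}" "{i,j} \<noteq> {0,n}"
  proof -
    show "j \<noteq> Suc i" using assms(4) by metis
    show "{i,j} \<noteq> {0,n}" using assms(1,2) unfolding doubleton_eq_iff by linarith
    have "\<not> (j = 0 \<and> Suc i = n)" using assms(4) wrapP by metis
    then show "{j, Suc i} \<noteq> {0,n}" using assms(2) unfolding doubleton_eq_iff by linarith
  qed
  have e: "circ p r (\<theta> j) \<notin> J i"
  proof
    assume "circ p r (\<theta> j) \<in> J i"
    moreover have "circ p r (\<theta> j) \<notin> P i" "circ p r (\<theta> j) \<notin> P (Suc i)"
    proof -
      have "circ p r (\<theta> j) \<noteq> p" using dist_circ[OF r, of p "\<theta> j"] r by auto
      moreover have "P i \<inter> P j = {p}" "P (Suc i) \<inter> P j = {p}"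
        using P_Int_P[of i j] P_Int_P[of "Suc i" j] assms jj by (auto simp: insert_commute)
      ultimately show "circ p r (\<theta> j) \<notin> P i" "circ p r (\<theta> j) \<notin> P (Suc i)"
        using ends(5)[of j] assms by auto
    qed
    ultimately obtain t where t: "\<theta> i \<le> t" "t \<le> \<theta> (Suc i)" "circ p r t = circ p r (\<theta> j)"
      unfolding J_def by auto
    then have "t \<in> {\<theta> 0..\<theta> n}" using mono_le[of 0 i] mono_le[of "Suc i" n] assms by auto
    moreover have "\<theta> j \<in> {\<theta> 0..\<theta> n}" using angle_range[of j] assms wrap by auto
    ultimately have "t = \<theta> j \<or> {t, \<theta> j} = {\<theta> 0, \<theta> n}" using circ_inj t(3) by blast
    moreover have "t \<noteq> \<theta> j"
      using t mono[of j i] mono[of "Suc i" j] assms jj by (cases "j < i") auto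
    moreover have "\<theta> j \<noteq> \<theta> n" using mono[of j n] assms by auto
    ultimately have "t = \<theta> n" "\<theta> j = \<theta> 0" by (auto simp: doubleton_eq_iff)
    then have "j = 0" using mono[of 0 j] assms by (cases j) auto
    moreover have "Suc i = n" using \<open>t = \<theta> n\<close> t mono[of "Suc i" n] assms by (cases "Suc i = n") auto
    ultimately show False using jj by auto
  qed
  have "P j - {p} \<subseteq> - J i"
  proof -
    have "z \<notin> J i" if z: "z \<in> P j" "z \<noteq> p" for z
    proof
      assume "z \<in> J i"
      moreover have "z \<notin> P i" "z \<notin> P (Suc i)"
        using z P_Int_P[of i j] P_Int_P[of "Suc i" j] assms jj by (auto simp: insert_commute)
      ultimately obtain t where "z = circ p r t" unfolding J_def by auto
      then have "z = circ p r (\<theta> j)" using P_Int_circ z assms by auto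
      then show False using e \<open>z \<in> J i\<close> by simp
    qed
    then show ?thesis by auto
  qed
  moreover have "connected (P j - {p})"
  proof -
    have "P j - {p} = g j ` {0<..1}"
    proof -
      have "inj_on (g j) {0..1}" "g j 0 = p"
        using ends(1,2)[of j] assms by (auto simp: arc_def pathstart_def)
      then have "g j ` ({0..1} - {0}) = P j - {p}"
        by (subst inj_on_image_set_diff) (auto simp: path_image_def)
      moreover have "{0..1} - {0} = {0<..1::real}" by auto
      ultimately show ?thesis by simp
    qed
    moreover have "continuous_on {0<..1} (g j)"
      using ends(1)[of j] assms by (auto simp: arc_def path_def intro: continuous_on_subset)
    ultimately show ?thesis by (metis connected_continuous_image connected_Ioc)
  qed
  moreover have "circ p r (\<theta> j) \<in> P j - {p}"
    using ends(5)[of j] assms dist_circ[OF r, of p "\<theta> j"] r by auto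
  moreover have "circ p r (\<theta> j) \<in> outside (J i)"
    using outside_if_not_in_ball[OF assms(1)] e dist_circ[OF r, of p "\<theta> j"] by auto
  ultimately have "connected_component (- J i) (circ p r (\<theta> j)) z" if "z \<in> P j - {p}" for z
    using that unfolding connected_component_def by blast
  then show ?thesis
    using outside_same_component \<open>circ p r (\<theta> j) \<in> outside (J i)\<close> by blast
qed

text \<open>If \<open>q\<close> were outside all the loops, then by Janiszewski's theorem their union, which contains
  the whole circle, would not separate \<open>q\<close> from a point outside the circle.\<close>

lemma cover:
  assumes "q \<in> ball p r" "\<And>i. i < n \<Longrightarrow> q \<notin> P i"
  shows "\<exists>i<n. q \<in> inside (J i)"
proof (rule ccontr)
  assume "\<not> ?thesis"
  moreover have "q \<notin> J i" if "i < n" for i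
    using assms that dist_circ[OF r] wrapP n unfolding J_def
    by (cases "Suc i = n") auto
  ultimately have out: "q \<in> outside (J i)" if "i < n" for i using that Jordan(9) by blast
  define z where "z = circ p (2*r) 0"
  have "z \<notin> cball p r" using dist_circ[of "2*r" p 0] r by (simp add: z_def)
  then have outz: "z \<in> outside (J i)" if "i < n" for i
    using outside_if_not_in_ball[OF that, of z] J_subset_cball[OF that] by (metis ball_subset_cball subsetD)
  have *: "connected_component (- (\<Union>m<i. J m)) q z" if "i \<le> n" for i
    using that
  proof (induction i)
    case 0
    show ?case unfolding connected_component_def by (rule exI[of _ UNIV]) auto
  next
    case (Suc i)
    have cc: "connected_component (- J i) q z"
      unfolding connected_component_def
      using Jordan(5,9)[of i] out[of i] outz[of i] Suc.prems by (metis Suc_le_lessD Un_upper2)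
    show ?case
    proof (cases "i = 0")
      case True
      then show ?thesis using cc by (simp add: lessThan_Suc)
    next
      case False
      have U: "(\<Union>m<i. J m) = (\<Union>m\<le>i. P m) \<union> circ p r ` {\<theta> 0..\<theta> i}"
      proof -
        have "(\<Union>m<k. A m) \<supseteq> circ p r ` {\<theta> 0..\<theta> k}" if "0 < k" "k \<le> n" for k
          using that
        proof (induction k)
          case (Suc k)
          show ?case
          proof (cases "k = 0")
            case False
            have "{\<theta> 0..\<theta> (Suc k)} \<subseteq> {\<theta> 0..\<theta> k} \<union> {\<theta> k..\<theta> (Suc k)}" by auto
            then show ?thesis using Suc False by (fastforce simp: lessThan_Suc)
          qed auto
        qed auto
        moreover have "(\<Union>m<i. A m) \<subseteq> circ p r ` {\<theta> 0..\<theta> i}"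
        proof -
          have "{\<theta> m..\<theta> (Suc m)} \<subseteq> {\<theta> 0..\<theta> i}" if "m < i" for m
            using that mono_le[of 0 m] mono_le[of "Suc m" i] Suc.prems by auto
          then show ?thesis by blast
        qed
        ultimately have "(\<Union>m<i. A m) = circ p r ` {\<theta> 0..\<theta> i}"
          using False Suc.prems by (metis Suc_leD bot_nat_0.not_eq_extremum subset_antisym)
        moreover have "(\<Union>m<i. J m) = (\<Union>m<i. P m \<union> P (Suc m)) \<union> (\<Union>m<i. A m)"
          unfolding J_def by blast
        moreover have "(\<Union>m<i. P m \<union> P (Suc m)) = (\<Union>m\<le>i. P m)"
        proof -
          have "m \<le> i \<Longrightarrow> m < i \<or> (\<exists>m'<i. m = Suc m')" for m using False by (cases m) auto
          then show ?thesis by fastforce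
        qed
        ultimately show ?thesis by simp
      qed
      have circ_int: "circ p r s \<in> P i \<or> circ p r s \<in> P (Suc i) \<and> Suc i = n"
        if eqs: "circ p r s = circ p r t" "\<theta> 0 \<le> s" "s \<le> \<theta> i" "\<theta> i \<le> t" "t \<le> \<theta> (Suc i)" for s t
      proof -
        have "s \<in> {\<theta> 0..\<theta> n}" "t \<in> {\<theta> 0..\<theta> n}"
          using eqs mono_le[of 0 i] mono_le[of "Suc i" n] mono_le[of i n] Suc.prems by auto
        then consider "s = t" | "s = \<theta> 0" "t = \<theta> n" | "s = \<theta> n"
          using circ_inj[OF eqs(1)] by (auto simp: doubleton_eq_iff)
        then show ?thesis
        proof cases
          case 1
          then have "s = \<theta> i" using eqs by auto
          then show ?thesis using ends(5)[of i] Suc.prems by auto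
        next
          case 2
          then have "Suc i = n" using eqs mono[of "Suc i" n] Suc.prems by (cases "Suc i = n") auto
          then show ?thesis using 2 eqs ends(5)[of n] by auto
        next
          case 3
          then show ?thesis using eqs mono[of i n] Suc.prems by auto
        qed
      qed
      have Pc: "circ p r s \<in> P i" if "circ p r s \<in> P m" "\<theta> i \<le> s" "s \<le> \<theta> (Suc i)" "m \<le> i" "Suc i < n" for s m
        using circ_int[of "\<theta> m" s] P_Int_circ[of m s] that mono_le[of 0 m] mono_le[of m i] by auto
      have PcS: "circ p r s \<in> P i" if "circ p r s \<in> P (Suc i)" "\<theta> 0 \<le> s" "s \<le> \<theta> i" "Suc i < n" for s
        using circ_int[of s "\<theta> (Suc i)"] P_Int_circ[of "Suc i" s] that mono_le[of i "Suc i"] by auto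
      \<comment> \<open>A new loop meets the union of the earlier ones in its first spoke, and the
        last loop does so in both of its spokes. The intersection is connected either way, as
        Janiszewski's theorem demands.\<close>
      have con: "connected ((\<Union>m<i. J m) \<inter> J i)"
      proof (cases "Suc i = n")
        case True
        have "(\<Union>m<i. J m) \<inter> J i = P i \<union> P (Suc i)"
        proof
          have "P (Suc i) \<subseteq> (\<Union>m\<le>i. P m)" using wrapP True by auto
          then show "P i \<union> P (Suc i) \<subseteq> (\<Union>m<i. J m) \<inter> J i" unfolding U unfolding J_def by auto
          have "circ p r s \<in> P i \<union> P (Suc i)" if "circ p r s \<in> P m" "\<theta> i \<le> s" "s \<le> \<theta> (Suc i)" "m \<le> i" for s m
            using circ_int[of "\<theta> m" s] P_Int_circ[of m s] that mono_le[of 0 m] mono_le[of m i] True by auto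
          then show "(\<Union>m<i. J m) \<inter> J i \<subseteq> P i \<union> P (Suc i)"
            unfolding U unfolding J_def using circ_int by fastforce
        qed
        moreover have "connected (P i \<union> P (Suc i))"
          using ends[of i] ends[of "Suc i"] Suc.prems
          by (intro connected_Un) (auto simp: connected_arc_image)
        ultimately show ?thesis by simp
      next
        case ne: False
        have "(\<Union>m<i. J m) \<inter> J i = P i"
        proof
          show "P i \<subseteq> (\<Union>m<i. J m) \<inter> J i" unfolding U unfolding J_def by auto
          have "P m \<inter> P (Suc i) \<subseteq> P i" if "m \<le> i" for m
            using P_Int_P[of m "Suc i"] that Suc.prems ne ends(6)[of i] by (auto simp: doubleton_eq_iff)
          then show "(\<Union>m<i. J m) \<inter> J i \<subseteq> P i"
            unfolding U unfolding J_def using circ_int Pc PcS ne Suc.prems by fastforce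
        qed
        then show ?thesis using ends[of i] Suc.prems by (auto simp: connected_arc_image)
      qed
      have "connected_component (- ((\<Union>m<i. J m) \<union> J i)) q z"
        using Suc cc con Jordan(11)
        by (intro Janiszewski[of "\<Union>m<i. J m" "J i"]) (auto intro!: compact_UN compact_imp_closed)
      then show ?thesis by (simp add: lessThan_Suc Un_commute)
    qed
  qed
  have "connected_component (- (\<Union>m<n. J m)) q z" using * by blast
  then obtain C where C: "connected C" "C \<subseteq> - (\<Union>m<n. J m)" "q \<in> C" "z \<in> C"
    unfolding connected_component_def by blast
  have "C \<inter> frontier (ball p r) \<noteq> {}"
    using C assms(1) \<open>z \<notin> cball p r\<close> by (intro connected_Int_frontier) auto
  then obtain w where "w \<in> C" "w \<in> frontier (ball p r)" by blast
  then have w: "w \<in> C" "dist p w = r" using r by auto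
  define t0 where "t0 = Arg (w - p)"
  have weq: "w = circ p r (t0 + 2 * pi * of_int k)" for k
  proof -
    have "w - p = of_real r * cis t0" using w r rcis_cmod_Arg[of "w - p"]
      by (simp add: rcis_def t0_def dist_norm norm_minus_commute)
    moreover have "cis (t0 + 2 * pi * of_int k) = cis t0"
      by (simp add: cis_multiple_2pi flip: cis_mult)
    ultimately show ?thesis by (simp add: circ_def algebra_simps)
  qed
  \<comment> \<open>Shifts the argument of the crossing point into the full turn from
    \<open>\<theta> 0\<close> to \<open>\<theta> n\<close>.\<close>
  define k where "k = - \<lfloor>(t0 - \<theta> 0) / (2*pi)\<rfloor>"
  define t where "t = t0 + 2 * pi * of_int k"
  have t: "\<theta> 0 \<le> t" "t \<le> \<theta> n"
    using floor_divide_lower[of "2*pi" "t0 - \<theta> 0"] floor_divide_upper[of "2*pi" "t0 - \<theta> 0"]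
    by (auto simp: t_def k_def wrap algebra_simps)
  have "\<exists>m<n. t \<in> {\<theta> m..\<theta> (Suc m)}"
  proof -
    have "\<exists>m<k. t \<in> {\<theta> m..\<theta> (Suc m)}" if "0 < k" "k \<le> n" "t \<le> \<theta> k" for k
      using that
    proof (induction k)
      case (Suc k)
      show ?case
      proof (cases "k > 0 \<and> t \<le> \<theta> k")
        case True
        then obtain m where "m < k" "t \<in> {\<theta> m..\<theta> (Suc m)}" using Suc by auto
        then show ?thesis by (intro exI[of _ m]) auto
      next
        case False then show ?thesis using Suc t by (cases k) auto
      qed
    qed auto
    then show ?thesis using t n by auto
  qed
  then obtain m where "m < n" "w \<in> J m" using weq[of k] unfolding J_def t_def by auto
  then show False using C w by auto
qed

end

lemma closed_ball_avoid:
  fixes R :: "'a::metric_space set"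
  assumes "closed R" "p \<notin> R"
  obtains \<epsilon> where "\<epsilon> > 0" "ball p \<epsilon> \<inter> R = {}"
  using assms open_contains_ball[of "- R"] by (metis ComplI disjoint_eq_subset_Compl open_Compl)

context spokes
begin

text \<open>\<open>K i\<close> is the one component, within the ball of radius \<epsilon>, of the
  inside of the i-th loop that comes close to \<open>p\<close>. The radius is free because other
  parts of a drawing may enter the disc. The loop is the frontier of its inside, so sector
  \<open>j\<close> borders the spokes \<open>j\<close> and \<open>j + 1\<close>; all other spokes
  are outside.\<close>

lemma sectors:
  assumes "\<epsilon> > 0"
  obtains \<delta> K where "\<delta> > 0"
    "\<And>i. i < n \<Longrightarrow> connected (K i)"
    "\<And>i. i < n \<Longrightarrow> K i \<subseteq> ball p \<epsilon> - (\<Union>j<n. P j)"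
    "ball p \<delta> - (\<Union>j<n. P j) \<subseteq> (\<Union>i<n. K i)"
    "\<And>i j q. \<lbrakk>i < n; j < n; q \<in> P i; q \<noteq> p; q \<in> ball p \<delta>\<rbrakk> \<Longrightarrow>
        q \<in> closure (K j) \<longleftrightarrow> i = j \<or> i = Suc j mod n"
proof -
  have "\<exists>\<delta>>0. \<delta> \<le> \<epsilon> \<and> (\<forall>a b. a \<in> ball p \<delta> \<longrightarrow> b \<in> ball p \<delta> \<longrightarrow> a \<in> inside (J i) \<longrightarrow> b \<in> inside (J i) \<longrightarrow>
        connected_component (ball p \<epsilon> \<inter> inside (J i)) a b)" if "i < n" for i
    using Jordan_locally_connected_at[OF simple_loop[OF that] assms] path_image_loop[OF that] by metis
  then obtain d where d: "\<And>i. i < n \<Longrightarrow> d i > 0" "\<And>i. i < n \<Longrightarrow> d i \<le> \<epsilon>"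
    "\<And>i a b. \<lbrakk>i < n; a \<in> ball p (d i); b \<in> ball p (d i); a \<in> inside (J i); b \<in> inside (J i)\<rbrakk> \<Longrightarrow>
        connected_component (ball p \<epsilon> \<inter> inside (J i)) a b"
    by metis
  define \<delta> where "\<delta> = min r (Min (d ` {..<n}))"
  have fin: "finite (d ` {..<n})" "d ` {..<n} \<noteq> {}" using n by (auto simp: lessThan_empty_iff)
  have \<delta>: "\<delta> > 0" "\<delta> \<le> r" "\<And>i. i < n \<Longrightarrow> \<delta> \<le> d i"
    using d(1) r fin by (auto simp: \<delta>_def min_le_iff_disj)
  have pJ: "p \<in> J i" if "i < n" for i using ends(6)[of i] that by (simp add: J_def)
  have "\<exists>a. a \<in> inside (J i) \<inter> ball p \<delta>" if "i < n" for i
  proof -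
    have "p \<in> closure (inside (J i))" using pJ[OF that] Jordan(10)[OF that] by (auto simp: frontier_def)
    then obtain a where "a \<in> inside (J i)" "dist a p < \<delta>" using \<delta>(1) closure_approachable by metis
    then show ?thesis by (auto simp: dist_commute)
  qed
  then obtain a where a: "\<And>i. i < n \<Longrightarrow> a i \<in> inside (J i)" "\<And>i. i < n \<Longrightarrow> a i \<in> ball p \<delta>" by (metis IntE)
  define K where "K i = connected_component_set (ball p \<epsilon> \<inter> inside (J i)) (a i)" for i
  have Ksub: "K i \<subseteq> ball p \<epsilon> \<inter> inside (J i)" for i
    unfolding K_def by (rule connected_component_subset)
  have inK: "z \<in> K i" if "i < n" "z \<in> inside (J i)" "z \<in> ball p \<delta>" for i z
  proof -
    have "ball p \<delta> \<subseteq> ball p (d i)" using \<delta>(3) that by (simp add: subset_ball)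
    then show ?thesis unfolding K_def using d(3)[OF that(1), of "a i" z] a that by blast
  qed
  have PJ: "P j \<subseteq> J i" if "i < n" "j = i \<or> j = Suc i mod n" for i j
  proof -
    have "P (Suc i mod n) = P (Suc i)"
    proof (cases "Suc i = n")
      case True
      then show ?thesis using wrapP by (metis mod_self)
    qed (use that in simp)
    then show ?thesis using that(2) unfolding J_def by auto
  qed
  have Pout: "P j - {p} \<subseteq> outside (J i)" if ij: "i < n" "j < n" "j \<noteq> i" "j \<noteq> Suc i mod n" for i j
  proof (rule spoke_outside[OF ij(1-3)])
    have e: "P (Suc i mod n) = P (Suc i)"
    proof (cases "Suc i = n")
      case True
      then show ?thesis using wrapP by (metis mod_self)
    qed (use ij in simp)
    have "P j \<inter> P (Suc i mod n) = {p}"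
      using disj[of j "Suc i mod n"] ij by simp
    moreover have "circ p r (\<theta> j) \<in> P j" using ends(5) ij by simp
    moreover have "circ p r (\<theta> j) \<noteq> p" using dist_circ[OF r, of p "\<theta> j"] r by auto
    ultimately show "P j \<noteq> P (Suc i)" using e by auto
  qed
  show ?thesis
  proof (rule that [OF \<delta>(1)])
    show "connected (K i)" for i unfolding K_def by (rule connected_connected_component)
    show "K i \<subseteq> ball p \<epsilon> - (\<Union>j<n. P j)" if "i < n" for i
    proof -
      have "inside (J i) \<inter> P j = {}" if "j < n" for j
      proof (cases "j = i \<or> j = Suc i mod n")
        case True
        then show ?thesis using PJ \<open>i < n\<close> inside_no_overlap[of "J i"] by blast
      next
        case False
        then have "P j \<subseteq> outside (J i) \<union> J i" using Pout[of i j] pJ \<open>i < n\<close> \<open>j < n\<close> by blast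
        then show ?thesis using Jordan(8)[OF \<open>i < n\<close>] inside_no_overlap[of "J i"] by blast
      qed
      then show ?thesis using Ksub[of i] by blast
    qed
    show "ball p \<delta> - (\<Union>j<n. P j) \<subseteq> (\<Union>i<n. K i)"
    proof
      fix q assume q: "q \<in> ball p \<delta> - (\<Union>j<n. P j)"
      then have "q \<in> ball p r" using \<delta>(2) by auto
      then obtain i where "i < n" "q \<in> inside (J i)" using cover[of q] q by blast
      then show "q \<in> (\<Union>i<n. K i)" using inK q by blast
    qed
    fix i j q assume ij: "i < n" "j < n" and q: "q \<in> P i" "q \<noteq> p" "q \<in> ball p \<delta>"
    show "q \<in> closure (K j) \<longleftrightarrow> i = j \<or> i = Suc j mod n"
    proof
      assume qc: "q \<in> closure (K j)"
      show "i = j \<or> i = Suc j mod n"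
      proof (rule ccontr)
        assume "\<not> ?thesis"
        then have "q \<in> outside (J j)" using Pout[of j i] ij q by blast
        moreover have "outside (J j) \<inter> closure (K j) = {}"
          using open_Int_closure_eq_empty[of "outside (J j)" "K j"] Jordan(4,8)[of j] ij(2) Ksub[of j] by blast
        ultimately show False using qc by blast
      qed
    next
      assume "i = j \<or> i = Suc j mod n"
      then have "q \<in> J j" using PJ ij q by blast
      then have "q \<in> ball p \<delta> \<inter> closure (inside (J j))"
        using Jordan(10)[of j] ij q by (auto simp: frontier_def)
      then have "q \<in> closure (ball p \<delta> \<inter> inside (J j))"
        using open_Int_closure_subset[of "ball p \<delta>" "inside (J j)"] by blast
      moreover have "ball p \<delta> \<inter> inside (J j) \<subseteq> K j" using inK ij by blast
      ultimately show "q \<in> closure (K j)" using closure_mono by blast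
    qed
  qed
qed

end

section \<open>Sectors at a point of a closed set in the plane\<close>

lemma interior_arc_empty:
  fixes \<gamma> :: "real \<Rightarrow> complex"
  assumes "arc \<gamma>" shows "interior (path_image \<gamma>) = {}"
proof (rule ccontr)
  assume ne: "interior (path_image \<gamma>) \<noteq> {}"
  obtain f where "homeomorphism {0..1} (path_image \<gamma>) \<gamma> f"
    using homeomorphism_arc[OF assms] .
  then have "continuous_on (path_image \<gamma>) f" "inj_on f (path_image \<gamma>)"
    by (auto simp: homeomorphism_def intro: inj_on_inverseI)
  then have "continuous_on (interior (path_image \<gamma>)) f" "inj_on f (interior (path_image \<gamma>))"
    using interior_subset by (blast intro: continuous_on_subset inj_on_subset)+
  \<comment> \<open>The inverse of the arc would embed an open set of the plane into the
    line.\<close>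
  then have "DIM(complex) \<le> DIM(real)"
    using ne by (intro invariance_of_dimension[of "interior (path_image \<gamma>)" f]) auto
  then show False by simp
qed

lemma enumerate_by_key:
  fixes \<phi> :: "'i \<Rightarrow> real"
  assumes "finite I" "inj_on \<phi> I"
  obtains h where "bij_betw h {..<card I} I" "\<And>i j. \<lbrakk>i < j; j < card I\<rbrakk> \<Longrightarrow> \<phi> (h i) < \<phi> (h j)"
proof -
  define xs where "xs = sorted_list_of_set (\<phi> ` I)"
  have len: "length xs = card I" using assms by (simp add: xs_def card_image)
  have s: "sorted_wrt (<) xs" by (simp add: xs_def)
  have 1: "bij_betw ((!) xs) {..<card I} (\<phi> ` I)"
    by (rule bij_betw_nth) (use assms(1) in \<open>simp_all add: len[symmetric], simp_all add: xs_def\<close>)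
  have 2: "bij_betw (inv_into I \<phi>) (\<phi> ` I) I"
    using assms by (simp add: bij_betw_inv_into inj_on_imp_bij_betw)
  show ?thesis
  proof (rule that [of "inv_into I \<phi> \<circ> (!) xs"])
    show "bij_betw (inv_into I \<phi> \<circ> (!) xs) {..<card I} I"
      using bij_betw_trans[OF 1 2] .
    fix i j assume ij: "i < j" "j < card I"
    then have "xs ! i \<in> \<phi> ` I" "xs ! j \<in> \<phi> ` I"
      using 1 by (auto simp: bij_betw_def)
    then show "\<phi> ((inv_into I \<phi> \<circ> (!) xs) i) < \<phi> ((inv_into I \<phi> \<circ> (!) xs) j)"
      using sorted_wrt_nth_less[OF s ij(1)] ij len by (simp add: f_inv_into_f)
  qed
qed

lemma arc_first_exit:
  fixes \<gamma> :: "real \<Rightarrow> complex"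
  assumes "arc \<gamma>" "pathstart \<gamma> = p" "r > 0" "r < dist p (pathfinish \<gamma>)"
  obtains t where "0 < t" "t < 1" "dist p (\<gamma> t) = r"
    "path_image (subpath 0 t \<gamma>) - {\<gamma> t} \<subseteq> ball p r"
proof -
  have "path \<gamma>" using assms arc_imp_path by blast
  then obtain u where u: "0 \<le> u" "u \<le> 1" "\<gamma> u \<in> frontier (ball p r)"
     "path_image(subpath 0 u \<gamma>) - {\<gamma> u} \<subseteq> interior (ball p r)"
    using subpath_to_frontier[of \<gamma> "ball p r"] assms by auto
  have "dist p (\<gamma> u) = r" using u assms by simp
  moreover have "u \<noteq> 0" using calculation assms by (auto simp: pathstart_def)
  moreover have "u \<noteq> 1" using calculation assms by (auto simp: pathfinish_def)
  ultimately show ?thesis using that[of u] u by auto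
qed

text \<open>\<open>R\<close> is the rest of the drawing, which keeps away from \<open>p\<close>, and
  \<open>K i\<close> is the sector between the arcs \<open>i\<close> and \<open>\<rho> i\<close>. A
  single arc bounds no Jordan domain and is treated apart: since it does not separate the plane,
  there is one sector, bordered by the arc from both sides.\<close>

lemma star_sectors:
  fixes \<gamma> :: "'i \<Rightarrow> real \<Rightarrow> complex"
  assumes I: "finite I" "I \<noteq> {}"
    and \<gamma>: "\<And>i. i \<in> I \<Longrightarrow> arc (\<gamma> i)" "\<And>i. i \<in> I \<Longrightarrow> pathstart (\<gamma> i) = p"
    and disj: "\<And>i j. \<lbrakk>i \<in> I; j \<in> I; i \<noteq> j\<rbrakk> \<Longrightarrow> path_image (\<gamma> i) \<inter> path_image (\<gamma> j) = {p}"
    and R: "closed R" "p \<notin> R"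
    and X: "X = R \<union> (\<Union>i\<in>I. path_image (\<gamma> i))"
  obtains \<delta> K \<rho> where "\<delta> > 0" "bij_betw \<rho> I I" "\<And>i j. \<lbrakk>i \<in> I; j \<in> I\<rbrakk> \<Longrightarrow> \<exists>m. (\<rho> ^^ m) i = j"
    "\<And>i. i \<in> I \<Longrightarrow> connected (K i)" "\<And>i. i \<in> I \<Longrightarrow> K i \<inter> X = {}"
    "ball p \<delta> - X \<subseteq> (\<Union>i\<in>I. K i)"
    "\<And>i j q. \<lbrakk>i \<in> I; j \<in> I; q \<in> path_image (\<gamma> i); q \<noteq> p; q \<in> ball p \<delta>\<rbrakk> \<Longrightarrow>
        q \<in> closure (K j) \<longleftrightarrow> i = j \<or> i = \<rho> j"
proof (cases "card I \<ge> 2")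
  case False
  then have "card I = 1" using I by (metis One_nat_def card_0_eq less_2_cases not_le)
  then obtain k where k: "I = {k}" using card_1_singletonE by blast
  define T where "T = path_image (\<gamma> k)"
  have ak: "arc (\<gamma> k)" "\<gamma> k 0 = p" using \<gamma> k by (auto simp: pathstart_def)
  obtain \<epsilon> where \<epsilon>: "\<epsilon> > 0" "ball p \<epsilon> \<inter> R = {}" using closed_ball_avoid[OF R] .
  have cont: "continuous_on {0..1} (\<gamma> k)" using ak by (auto simp: arc_def path_def)
  obtain d0 where d0: "d0 > 0" "\<And>t. \<lbrakk>t \<in> {0..1}; dist t 0 < d0\<rbrakk> \<Longrightarrow> dist (\<gamma> k t) p < \<epsilon>"
    using cont \<epsilon>(1) ak(2) unfolding continuous_on_iff
    by (metis atLeastAtMost_iff order_refl zero_le_one)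
  define \<tau> where "\<tau> = min d0 1 / 2"
  have \<tau>: "0 < \<tau>" "\<tau> < 1" "\<tau> < d0" using d0 by (auto simp: \<tau>_def min_def)
  let ?A = "\<gamma> k ` {\<tau>..1}"
  have "continuous_on {\<tau>..1} (\<gamma> k)" using cont \<tau> by (auto intro: continuous_on_subset)
  then have A: "compact ?A" "connected ?A"
    by (simp_all add: compact_continuous_image connected_continuous_image)
  have AT: "?A \<subseteq> T" using \<tau> by (auto simp: T_def path_image_def)
  have pA: "p \<notin> ?A"
  proof
    assume "p \<in> ?A"
    then obtain t where "t \<in> {\<tau>..1}" "\<gamma> k t = \<gamma> k 0" using ak by auto
    then have "t = 0" using ak(1) \<tau> by (auto simp: arc_def inj_on_def)
    then show False using \<open>t \<in> {\<tau>..1}\<close> \<tau> by auto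
  qed
  have sm: "T - ?A \<subseteq> ball p \<epsilon>"
  proof
    fix z assume "z \<in> T - ?A"
    then obtain t where t: "t \<in> {0..1}" "z = \<gamma> k t" and "z \<notin> ?A" by (auto simp: T_def path_image_def)
    then have "t < \<tau>" by force
    then show "z \<in> ball p \<epsilon>" using d0(2)[of t] t \<tau> by (auto simp: dist_commute)
  qed
  have "compact T" using ak unfolding T_def by (simp add: compact_arc_image)
  from locally_connected_at_Janiszewski[OF this A AT pA sm \<epsilon>(1)]
  obtain \<delta> where \<delta>: "\<delta> > 0" "\<delta> \<le> \<epsilon>"
    "\<And>a b. \<lbrakk>a \<in> ball p \<delta>; b \<in> ball p \<delta>; connected_component (- T) a b\<rbrakk> \<Longrightarrow>
        connected_component (ball p \<epsilon> - T) a b" by metis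
  have conT: "connected_component (- T) a b" if "a \<notin> T" "b \<notin> T" for a b
    using connected_arc_complement[OF ak(1)] that unfolding T_def connected_component_def by fastforce
  have dense: "\<exists>z \<in> U. z \<notin> T" if "open U" "q \<in> U" for U q
    using interior_arc_empty[OF ak(1)] that unfolding T_def[symmetric]
    by (metis empty_iff interior_maximal subsetI subset_empty)
  obtain a where a: "a \<in> ball p \<delta>" "a \<notin> T" using dense[of "ball p \<delta>" p] \<delta> by auto
  define K where "K = connected_component_set (ball p \<epsilon> - T) a"
  have inK: "ball p \<delta> - T \<subseteq> K" unfolding K_def using \<delta>(3) a conT by blast
  show ?thesis
  proof (rule that [of \<delta> id "\<lambda>_. K"])
    show "connected K" unfolding K_def by (rule connected_connected_component)
    show "K \<inter> X = {}"
      using connected_component_subset[of "ball p \<epsilon> - T" a] \<epsilon> unfolding K_def X k T_def by blast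
    show "ball p \<delta> - X \<subseteq> (\<Union>i\<in>I. K)" using inK unfolding X k T_def by blast
    fix i j q assume "i \<in> I" "j \<in> I" and q: "q \<in> path_image (\<gamma> i)" "q \<noteq> p" "q \<in> ball p \<delta>"
    have "q \<in> closure K"
    proof (rule closure_iff_nhds_not_empty[THEN iffD2, rule_format])
      fix A V assume V: "V \<subseteq> A" "open V" "q \<in> V"
      obtain z where "z \<in> V \<inter> ball p \<delta>" "z \<notin> T" using dense[of "V \<inter> ball p \<delta>" q] q V by (meson IntI open_Int open_ball)
      then show "K \<inter> A \<noteq> {}" using inK V by blast
    qed
    then show "q \<in> closure K \<longleftrightarrow> i = j \<or> i = id j" using \<open>i \<in> I\<close> \<open>j \<in> I\<close> k by auto
  qed (use \<delta> k in \<open>auto intro: exI[of _ 0]\<close>)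
next
  case True
  define n where "n = card I"
  have n: "n \<ge> 2" using True by (simp add: n_def)
  \<comment> \<open>Half the least distance from \<open>p\<close> to an end point, so that every arc
    leaves the disc.\<close>
  define r where "r = Min ((\<lambda>i. dist p (pathfinish (\<gamma> i))) ` I) / 2"
  have pf: "dist p (pathfinish (\<gamma> i)) > 0" if "i \<in> I" for i
    using \<gamma>[OF that] arc_distinct_ends[of "\<gamma> i"] by auto
  have "Min ((\<lambda>i. dist p (pathfinish (\<gamma> i))) ` I) > 0" using pf I by simp
  moreover have "Min ((\<lambda>i. dist p (pathfinish (\<gamma> i))) ` I) \<le> dist p (pathfinish (\<gamma> i))" if "i \<in> I" for i
    using I that by simp
  ultimately have r: "r > 0" "\<And>i. i \<in> I \<Longrightarrow> r < dist p (pathfinish (\<gamma> i))"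
    unfolding r_def by force+
  have "\<exists>t. 0 < t \<and> t < 1 \<and> dist p (\<gamma> i t) = r \<and> path_image (subpath 0 t (\<gamma> i)) - {\<gamma> i t} \<subseteq> ball p r" if "i \<in> I" for i
    using arc_first_exit[OF \<gamma>(1,2)[OF that] r(1) r(2)[OF that]] by metis
  then obtain t where t: "\<And>i. i \<in> I \<Longrightarrow> 0 < t i" "\<And>i. i \<in> I \<Longrightarrow> t i < 1"
      "\<And>i. i \<in> I \<Longrightarrow> dist p (\<gamma> i (t i)) = r"
      "\<And>i. i \<in> I \<Longrightarrow> path_image (subpath 0 (t i) (\<gamma> i)) - {\<gamma> i (t i)} \<subseteq> ball p r" by metis
  define g where "g i = subpath 0 (t i) (\<gamma> i)" for i
  have g: "arc (g i)" "pathstart (g i) = p" "pathfinish (g i) = \<gamma> i (t i)"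
     "path_image (g i) = \<gamma> i ` {0..t i}" "path_image (g i) \<subseteq> path_image (\<gamma> i)" if "i \<in> I" for i
  proof -
    show "arc (g i)" unfolding g_def using \<gamma>[OF that] t[OF that] by (intro arc_subpath_arc) auto
    show "pathstart (g i) = p" using \<gamma>[OF that] by (simp add: g_def) (simp add: pathstart_def)
    show "pathfinish (g i) = \<gamma> i (t i)" by (simp add: g_def)
    show im: "path_image (g i) = \<gamma> i ` {0..t i}"
      unfolding g_def using t[OF that] by (subst path_image_subpath) auto
    show "path_image (g i) \<subseteq> path_image (\<gamma> i)" unfolding im unfolding path_image_def using t(1,2)[OF that] by (intro image_mono) auto
  qed
  \<comment> \<open>Beyond its first exit an arc may come back into the disc. These pieces join the
    closed set that the ball of radius \<epsilon> avoids.\<close>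
  define R' where "R' = R \<union> (\<Union>i\<in>I. \<gamma> i ` {t i..1})"
  have "closed (\<gamma> i ` {t i..1})" if "i \<in> I" for i
  proof -
    have "continuous_on {t i..1} (\<gamma> i)"
      using \<gamma>[OF that] t(1)[OF that] by (auto simp: arc_def path_def intro: continuous_on_subset)
    then show ?thesis by (simp add: compact_continuous_image compact_imp_closed)
  qed
  then have "closed R'" unfolding R'_def using I R by auto
  moreover have "p \<notin> R'"
  proof
    assume "p \<in> R'"
    then obtain i s where i: "i \<in> I" "s \<in> {t i..1}" "\<gamma> i s = \<gamma> i 0"
      using R \<gamma>(2) unfolding R'_def pathstart_def by fastforce
    then have "s = 0" using \<gamma>(1)[OF i(1)] t(1)[OF i(1)] by (auto simp: arc_def inj_on_def)
    then show False using i t(1)[OF i(1)] by auto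
  qed
  ultimately obtain \<epsilon> where \<epsilon>: "\<epsilon> > 0" "ball p \<epsilon> \<inter> R' = {}" using closed_ball_avoid by blast
  have X': "X = R' \<union> (\<Union>i\<in>I. path_image (g i))"
  proof -
    have "path_image (\<gamma> i) = \<gamma> i ` {t i..1} \<union> path_image (g i)" if "i \<in> I" for i
    proof -
      have "{0..1} = {t i..1} \<union> {0..t i}" using t(1,2)[OF that] by auto
      then show ?thesis unfolding g(4)[OF that] unfolding path_image_def by (metis image_Un)
    qed
    then show ?thesis unfolding X R'_def by auto
  qed
  define \<phi> where "\<phi> i = Arg (\<gamma> i (t i) - p)" for i
  have end_circ: "\<gamma> i (t i) = circ p r (\<phi> i)" if "i \<in> I" for i
  proof -
    have "\<gamma> i (t i) - p = of_real r * cis (\<phi> i)"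
      using t(3)[OF that] rcis_cmod_Arg[of "\<gamma> i (t i) - p"]
      by (simp add: rcis_def \<phi>_def dist_norm norm_minus_commute)
    then show ?thesis by (simp add: circ_def algebra_simps)
  qed
  have gdisj: "path_image (g i) \<inter> path_image (g j) = {p}" if "i \<in> I" "j \<in> I" "i \<noteq> j" for i j
  proof -
    have "p \<in> path_image (g i)" "p \<in> path_image (g j)"
      using g(2) that pathstart_in_path_image by metis+
    then show ?thesis using disj[OF that] g(5)[OF that(1)] g(5)[OF that(2)] by blast
  qed
  have "inj_on \<phi> I"
  proof (rule inj_onI, rule ccontr)
    fix i j assume ij: "i \<in> I" "j \<in> I" "\<phi> i = \<phi> j" "i \<noteq> j"
    then have "\<gamma> i (t i) = \<gamma> j (t j)" using end_circ by metis
    then have "\<gamma> i (t i) \<in> path_image (g i) \<inter> path_image (g j)"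
      using g(3) ij pathfinish_in_path_image by (metis IntI)
    then have "\<gamma> i (t i) = p" using gdisj ij by blast
    then show False using t(3)[OF ij(1)] r(1) by simp
  qed
  then obtain h where h: "bij_betw h {..<n} I" "\<And>i j. \<lbrakk>i < j; j < n\<rbrakk> \<Longrightarrow> \<phi> (h i) < \<phi> (h j)"
    using enumerate_by_key I unfolding n_def by metis
  have hI: "h i \<in> I" if "i < n" for i using h that by (auto simp: bij_betw_def)
  have hinj: "h i = h j \<longleftrightarrow> i = j" if "i < n" "j < n" for i j
    using h that by (auto simp: bij_betw_def inj_on_def)
  define G where "G i = g (h (i mod n))" for i
  define \<theta> where "\<theta> i = (if i < n then \<phi> (h i) else \<phi> (h 0) + 2 * pi)" for i
  interpret spokes p r n G \<theta>
  proof
    fix i assume i: "i < n"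
    then show "arc (G i)" "pathstart (G i) = p" using g hI by (simp_all add: G_def)
    show "pathfinish (G i) = circ p r (\<theta> i)" using i g(3) hI end_circ by (simp add: G_def \<theta>_def)
    show "path_image (G i) - {pathfinish (G i)} \<subseteq> ball p r"
      using i g(3) t(4) hI by (simp add: G_def g_def)
  next
    fix i j assume "i < n" "j < n" "i \<noteq> j"
    then show "path_image (G i) \<inter> path_image (G j) = {p}"
      using gdisj[of "h i" "h j"] hI hinj by (simp add: G_def)
  next
    fix i j assume ij: "i < j" "j \<le> n"
    show "\<theta> i < \<theta> j"
    proof (cases "j < n")
      case True
      then show ?thesis using ij h(2) by (simp add: \<theta>_def)
    next
      case False
      \<comment> \<open>Arguments lie in an interval of length 2 pi that is open below, so a full
        turn after the first angle is beyond all others.\<close>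
      have "\<phi> (h i) \<le> pi" "\<phi> (h 0) > - pi" unfolding \<phi>_def using Arg_bounded by auto
      then show ?thesis using False ij by (simp add: \<theta>_def)
    qed
  qed (use r n in \<open>auto simp: G_def \<theta>_def\<close>)
  have UP: "(\<Union>j<n. P j) = (\<Union>i\<in>I. path_image (g i))"
  proof -
    have "(\<Union>j<n. P j) = (\<Union>j<n. path_image (g (h j)))" by (simp add: G_def)
    also have "\<dots> = (\<Union>i\<in>h ` {..<n}. path_image (g i))" by blast
    also have "h ` {..<n} = I" using h(1) by (simp add: bij_betw_def)
    finally show ?thesis .
  qed
  obtain \<delta> K where K: "\<delta> > 0"
    "\<And>i. i < n \<Longrightarrow> connected (K i)"
    "\<And>i. i < n \<Longrightarrow> K i \<subseteq> ball p \<epsilon> - (\<Union>j<n. P j)"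
    "ball p \<delta> - (\<Union>j<n. P j) \<subseteq> (\<Union>i<n. K i)"
    "\<And>i j q. \<lbrakk>i < n; j < n; q \<in> P i; q \<noteq> p; q \<in> ball p \<delta>\<rbrakk> \<Longrightarrow>
        q \<in> closure (K j) \<longleftrightarrow> i = j \<or> i = Suc j mod n"
    using sectors[OF \<epsilon>(1)] by metis
  define k where "k = inv_into {..<n} h"
  have k: "k i < n" "h (k i) = i" if "i \<in> I" for i
    using that h(1) bij_betw_inv_into[OF h(1)] unfolding k_def
    by (auto simp: bij_betw_def f_inv_into_f)
  have kh: "k (h i) = i" if "i < n" for i using that h(1) by (simp add: k_def bij_betw_def)
  define \<rho> where "\<rho> i = h (Suc (k i) mod n)" for i
  have \<rho>h: "\<rho> (h i) = h (Suc i mod n)" if "i < n" for i using kh[OF that] by (simp add: \<rho>_def)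
  have \<rho>m: "(\<rho> ^^ m) (h i) = h ((i + m) mod n)" if "i < n" for i m
  proof (induction m)
    case (Suc m)
    then show ?case using \<rho>h[of "(i + m) mod n"] n by (simp add: mod_Suc_eq)
  qed (use that in simp)
  have trans: "\<exists>m. (\<rho> ^^ m) i = j" if "i \<in> I" "j \<in> I" for i j
  proof
    show "(\<rho> ^^ (k j + n - k i)) i = j"
      using \<rho>m[of "k i" "k j + n - k i"] k[OF that(1)] k[OF that(2)] by simp
  qed
  have "\<rho> ` I = I"
  proof
    show "\<rho> ` I \<subseteq> I" using hI n by (auto simp: \<rho>_def)
    show "I \<subseteq> \<rho> ` I"
    proof
      fix j assume j: "j \<in> I"
      have "\<rho> (h ((k j + (n - 1)) mod n)) = h (Suc (k j + (n - 1)) mod n)"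
        using \<rho>h[of "(k j + (n - 1)) mod n"] n by (simp add: mod_Suc_eq)
      also have "Suc (k j + (n - 1)) = k j + n" using n by simp
      finally have "\<rho> (h ((k j + (n - 1)) mod n)) = j" using k[OF j] by simp
      moreover have "h ((k j + (n - 1)) mod n) \<in> I" using hI n by simp
      ultimately show "j \<in> \<rho> ` I" by (metis imageI)
    qed
  qed
  then have bij: "bij_betw \<rho> I I"
    using I(1) by (simp add: bij_betw_def eq_card_imp_inj_on)
  define \<delta>' where "\<delta>' = min \<delta> \<epsilon>"
  show ?thesis
  proof (rule that [of \<delta>' \<rho> "K \<circ> k"])
    show "\<delta>' > 0" using K(1) \<epsilon>(1) by (simp add: \<delta>'_def)
    show "connected ((K \<circ> k) i)" if "i \<in> I" for i using K(2) k that by simp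
    show "(K \<circ> k) i \<inter> X = {}" if "i \<in> I" for i
    proof -
      have "K (k i) \<subseteq> ball p \<epsilon> - (\<Union>i\<in>I. path_image (g i))" using K(3)[of "k i"] k that unfolding UP by simp
      then show ?thesis using \<epsilon>(2) unfolding X' by auto
    qed
    show "ball p \<delta>' - X \<subseteq> (\<Union>i\<in>I. (K \<circ> k) i)"
    proof
      fix q assume q: "q \<in> ball p \<delta>' - X"
      then have "q \<in> ball p \<delta> - (\<Union>j<n. P j)" unfolding UP X' by (auto simp: \<delta>'_def)
      then obtain i where "i < n" "q \<in> K i" using K(4) by blast
      then show "q \<in> (\<Union>i\<in>I. (K \<circ> k) i)" using hI[of i] kh[of i] by (auto intro!: bexI[of _ "h i"])
    qed
    fix i j q assume ij: "i \<in> I" "j \<in> I" and q: "q \<in> path_image (\<gamma> i)" "q \<noteq> p" "q \<in> ball p \<delta>'"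
    have "q \<in> path_image (g i)"
    proof -
      obtain s where s: "s \<in> {0..1}" "q = \<gamma> i s" using q by (auto simp: path_image_def)
      moreover have "q \<notin> R'" using q(3) \<epsilon> by (auto simp: \<delta>'_def)
      ultimately have "s \<in> {0..t i}" using ij unfolding R'_def by force
      then show ?thesis using g(4)[OF ij(1)] s by auto
    qed
    then have "q \<in> P (k i)" using k[OF ij(1)] by (simp add: G_def)
    then have "q \<in> closure (K (k j)) \<longleftrightarrow> k i = k j \<or> k i = Suc (k j) mod n"
      using K(5)[of "k i" "k j" q] q k ij by (simp add: \<delta>'_def)
    moreover have "k i = k j \<longleftrightarrow> i = j" using k ij by metis
    moreover have "k i = Suc (k j) mod n \<longleftrightarrow> i = \<rho> j"
      using k(2)[OF ij(1)] kh[of "Suc (k j) mod n"] n unfolding \<rho>_def by auto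
    ultimately show "q \<in> closure ((K \<circ> k) j) \<longleftrightarrow> i = j \<or> i = \<rho> j" by simp
  qed (use bij trans in auto)
qed

section \<open>Plane drawings and their rotation systems\<close>

text \<open>Sectors are replaced by the faces that contain them; several sectors may lie in one
  face. Near \<open>p\<close> a face is covered by finitely many sectors, so it reaches a point of
  an arc through one of them, and only the two sectors next to the arc come into question.\<close>

lemma star_faces:
  fixes \<gamma> :: "'i \<Rightarrow> real \<Rightarrow> complex"
  assumes I: "finite I" "I \<noteq> {}"
    and \<gamma>: "\<And>i. i \<in> I \<Longrightarrow> arc (\<gamma> i)" "\<And>i. i \<in> I \<Longrightarrow> pathstart (\<gamma> i) = p"
    and disj: "\<And>i j. \<lbrakk>i \<in> I; j \<in> I; i \<noteq> j\<rbrakk> \<Longrightarrow> path_image (\<gamma> i) \<inter> path_image (\<gamma> j) = {p}"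
    and R: "closed R" "p \<notin> R"
    and X: "X = R \<union> (\<Union>i\<in>I. path_image (\<gamma> i))"
  obtains \<delta> f \<rho> where "\<delta> > 0" "bij_betw \<rho> I I" "\<And>i j. \<lbrakk>i \<in> I; j \<in> I\<rbrakk> \<Longrightarrow> \<exists>m. (\<rho> ^^ m) i = j"
    "\<And>i. i \<in> I \<Longrightarrow> f i \<in> components (- X)"
    "\<And>F. \<lbrakk>F \<in> components (- X); p \<in> closure F\<rbrakk> \<Longrightarrow> F \<in> f ` I"
    "\<And>i F q. \<lbrakk>i \<in> I; F \<in> components (- X); q \<in> path_image (\<gamma> (\<rho> i)); q \<noteq> p; q \<in> ball p \<delta>\<rbrakk> \<Longrightarrow>
        q \<in> closure F \<longleftrightarrow> F = f i \<or> F = f (\<rho> i)"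
proof -
  obtain \<delta> K \<rho> where \<delta>: "\<delta> > 0" and \<rho>: "bij_betw \<rho> I I" "\<And>i j. \<lbrakk>i \<in> I; j \<in> I\<rbrakk> \<Longrightarrow> \<exists>m. (\<rho> ^^ m) i = j"
    and K: "\<And>i. i \<in> I \<Longrightarrow> connected (K i)" "\<And>i. i \<in> I \<Longrightarrow> K i \<inter> X = {}"
    "ball p \<delta> - X \<subseteq> (\<Union>i\<in>I. K i)"
    "\<And>i j q. \<lbrakk>i \<in> I; j \<in> I; q \<in> path_image (\<gamma> i); q \<noteq> p; q \<in> ball p \<delta>\<rbrakk> \<Longrightarrow>
        q \<in> closure (K j) \<longleftrightarrow> i = j \<or> i = \<rho> j"
    by (rule star_sectors[of I \<gamma> p R X]) (use assms in auto)
  have \<rho>I: "\<rho> i \<in> I" if "i \<in> I" for i using \<rho>(1) that by (auto simp: bij_betw_def)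
  have \<rho>inj: "\<rho> i = \<rho> j \<longleftrightarrow> i = j" if "i \<in> I" "j \<in> I" for i j
    using \<rho>(1) that by (auto simp: bij_betw_def inj_on_def)
  have near: "\<exists>q. q \<in> path_image (\<gamma> i) \<and> q \<noteq> p \<and> q \<in> ball p \<delta>" if "i \<in> I" for i
  proof -
    have c: "continuous_on {0..1} (\<gamma> i)" and inj: "inj_on (\<gamma> i) {0..1}" and "\<gamma> i 0 = p"
      using \<gamma>[OF that] by (auto simp: arc_def path_def pathstart_def)
    then obtain d where d: "d > 0" "\<And>t. \<lbrakk>t \<in> {0..1}; dist t 0 < d\<rbrakk> \<Longrightarrow> dist (\<gamma> i t) p < \<delta>"
      using \<delta> unfolding continuous_on_iff by (metis atLeastAtMost_iff order_refl zero_le_one)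
    define t where "t = min d 1 / 2"
    have t: "t > 0" "t \<in> {0..1}" "dist t 0 < d" using d(1) by (auto simp: t_def min_def)
    then have "\<gamma> i t \<noteq> p" using inj_onD[OF inj, of t 0] \<open>\<gamma> i 0 = p\<close> by auto
    then show ?thesis using d(2)[OF t(2,3)] t(2) by (auto simp: path_image_def dist_commute)
  qed
  have "K i \<noteq> {}" if "i \<in> I" for i using near[OF that] K(4)[OF that that] by auto
  then have "\<exists>F. F \<in> components (- X) \<and> K i \<subseteq> F" if "i \<in> I" for i
    using K(1,2)[OF that] that exists_component_superset[of "K i" "- X"]
    by (metis disjoint_eq_subset_Compl subset_empty)
  then obtain f where f: "\<And>i. i \<in> I \<Longrightarrow> f i \<in> components (- X)" "\<And>i. i \<in> I \<Longrightarrow> K i \<subseteq> f i" by metis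
  have meet: "F = f i" if "i \<in> I" "F \<in> components (- X)" "K i \<inter> F \<noteq> {}" for i F
    using that f[OF that(1)] components_nonoverlap[of F "- X" "f i"] by blast
  have FX: "F \<inter> X = {}" if "F \<in> components (- X)" for F
    using in_components_subset[OF that] by blast
  show ?thesis
  proof (rule that [OF \<delta> \<rho> f(1)])
    fix F assume F: "F \<in> components (- X)" "p \<in> closure F"
    then obtain z where "z \<in> F" "dist z p < \<delta>" using \<delta> closure_approachable by metis
    then have "z \<in> (\<Union>i\<in>I. K i)" using K(3) FX[OF F(1)] by (auto simp: dist_commute)
    then show "F \<in> f ` I" using meet F \<open>z \<in> F\<close> by blast
  next
    fix i F q assume i: "i \<in> I" and F: "F \<in> components (- X)" and q: "q \<in> path_image (\<gamma> (\<rho> i))" "q \<noteq> p" "q \<in> ball p \<delta>"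
    show "q \<in> closure F \<longleftrightarrow> F = f i \<or> F = f (\<rho> i)"
    proof
      assume "q \<in> closure F"
      then have "q \<in> closure (ball p \<delta> \<inter> F)"
        using open_Int_closure_subset[of "ball p \<delta>" F] q(3) by auto
      moreover have "closure (ball p \<delta> \<inter> F) \<subseteq> (\<Union>j\<in>I. closure (K j \<inter> F))"
      proof (rule closure_minimal)
        have "ball p \<delta> \<inter> F \<subseteq> (\<Union>j\<in>I. K j \<inter> F)" using K(3) FX[OF F] by blast
        also have "\<dots> \<subseteq> (\<Union>j\<in>I. closure (K j \<inter> F))" by (intro UN_mono subset_refl closure_subset)
        finally show "ball p \<delta> \<inter> F \<subseteq> (\<Union>j\<in>I. closure (K j \<inter> F))" .
        show "closed (\<Union>j\<in>I. closure (K j \<inter> F))" using I(1) by (intro closed_UN) auto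
      qed
      ultimately have "q \<in> (\<Union>j\<in>I. closure (K j \<inter> F))" by (rule subsetD[rotated])
      then obtain j where j: "j \<in> I" "q \<in> closure (K j \<inter> F)" by blast
      then have "K j \<inter> F \<noteq> {}" by auto
      then have "F = f j" using meet F j by blast
      moreover have "q \<in> closure (K j)" using j closure_mono[of "K j \<inter> F" "K j"] by blast
      then have "\<rho> i = j \<or> \<rho> i = \<rho> j" using K(4)[OF \<rho>I[OF i] j(1) q] by blast
      ultimately show "F = f i \<or> F = f (\<rho> i)" using \<rho>inj i j by auto
    next
      assume "F = f i \<or> F = f (\<rho> i)"
      then obtain j where j: "j \<in> I" "F = f j" "j = i \<or> j = \<rho> i" using i \<rho>I by blast
      then have "q \<in> closure (K j)" using K(4)[OF \<rho>I[OF i] j(1) q] by blast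
      then show "q \<in> closure F" using f(2)[OF j(1)] j(2) closure_mono by blast
    qed
  qed
qed

locale plane_drawing =
  fixes V :: "complex set" and E :: "'e set" and c :: "'e \<Rightarrow> real \<Rightarrow> complex"
  assumes finV: "finite V" and finE: "finite E"
    and simple: "\<And>e. e \<in> E \<Longrightarrow> simple_path (c e)"
    and ends_V: "\<And>e. e \<in> E \<Longrightarrow> path_image (c e) \<inter> V = {pathstart (c e), pathfinish (c e)}"
    and disjoint: "\<And>e f. \<lbrakk>e \<in> E; f \<in> E; e \<noteq> f\<rbrakk> \<Longrightarrow> path_image (c e) \<inter> path_image (c f) \<subseteq> V"
begin

definition "X = V \<union> (\<Union>e\<in>E. path_image (c e))"
definition "D = E \<times> (UNIV :: bool set)"
definition tail :: "'e \<times> bool \<Rightarrow> complex" where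
  "tail d = (if snd d then pathfinish (c (fst d)) else pathstart (c (fst d)))"
definition dpath :: "'e \<times> bool \<Rightarrow> real \<Rightarrow> complex" where
  "dpath d = (if snd d then reversepath (c (fst d)) else c (fst d))"
definition "regions = components (- X)"
definition "regions_of e = {F \<in> regions. path_image (c e) \<subseteq> closure F}"

lemma compact_c: "e \<in> E \<Longrightarrow> compact (path_image (c e))"
  using simple by (simp add: compact_simple_path_image)

lemma compact_X: "compact X"
  unfolding X_def using finV finE compact_c by (intro compact_Un compact_UN) (simp_all add: finite_imp_compact)

lemma cont_c: "e \<in> E \<Longrightarrow> continuous_on {0..1} (c e)"
  using simple simple_path_imp_path path_def by blast

lemma finD: "finite D" unfolding D_def using finE by simp

lemma loop_free: "\<lbrakk>e \<in> E; s \<in> {0..1}; t \<in> {0..1}; c e s = c e t\<rbrakk> \<Longrightarrow> s = t \<or> {s,t} = {0,1}"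
  using simple unfolding simple_path_def loop_free_def by (metis insert_commute)

lemma in_V: "\<lbrakk>e \<in> E; s \<in> {0..1}; c e s \<in> V\<rbrakk> \<Longrightarrow> s = 0 \<or> s = 1"
proof -
  assume e: "e \<in> E" "s \<in> {0..1}" "c e s \<in> V"
  then have "c e s \<in> path_image (c e) \<inter> V" by (auto simp: path_image_def)
  then have "c e s = c e 0 \<or> c e s = c e 1"
    using ends_V[OF e(1)] by (auto simp: pathstart_def pathfinish_def)
  then show "s = 0 \<or> s = 1" using loop_free[OF e(1,2), of 0] loop_free[OF e(1,2), of 1]
    by (auto simp: doubleton_eq_iff)
qed

text \<open>On the open edge, lying in the closure of \<open>F\<close> is a closed condition. It is
  also an open one: an interior point is the centre of a star of two half edges, where both sectors
  border both halves. Connectedness then spreads one interior point to the whole edge.\<close>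

lemma edge_closure:
  assumes e: "e \<in> E" and F: "F \<in> regions" and s: "0 < s" "s < 1" "c e s \<in> closure F"
  shows "path_image (c e) \<subseteq> closure F"
proof -
  define S where "S = {t \<in> {0<..<1}. c e t \<in> closure F}"
  have cont: "continuous_on {0<..<1} (c e)" using cont_c[OF e] by (auto intro: continuous_on_subset)
  have clo: "closedin (top_of_set {0<..<1}) S"
  proof -
    have "S = {0<..<1} \<inter> c e -` closure F" by (auto simp: S_def)
    then show ?thesis using continuous_closedin_preimage[OF cont closed_closure] by simp
  qed
  have op: "\<exists>\<eta>>0. \<forall>t. \<bar>t - a\<bar> < \<eta> \<longrightarrow> t \<in> {0<..<1} \<longrightarrow> t \<in> S" if a: "a \<in> S" for a
  proof -
    have a01: "0 < a" "a < 1" and aF: "c e a \<in> closure F" using a by (auto simp: S_def)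
    \<comment> \<open>Half way to either end, which keeps the two half edges away from the
      vertices.\<close>
    define u where "u b = (if b then (a + 1) / 2 else a / 2)" for b
    have u: "u b \<in> {0..1}" "u b \<noteq> a" "\<bar>a - u b\<bar> < 1" for b using a01 by (auto simp: u_def)
    define \<gamma> where "\<gamma> b = subpath a (u b) (c e)" for b
    have im: "path_image (\<gamma> b) = c e ` (if b then {a..u True} else {u False..a})" for b
      unfolding \<gamma>_def using a01 by (auto simp: path_image_subpath u_def)
    define R where "R = V \<union> (\<Union>f\<in>E - {e}. path_image (c f)) \<union> c e ` ({0..u False} \<union> {u True..1})"
    have ne: "c e a \<noteq> c e t" if "t \<in> {0..1}" "t \<noteq> a" for t
      using loop_free[OF e, of a t] that a01 by (auto simp: doubleton_eq_iff)
    have inj: "c e t = c e t' \<longleftrightarrow> t = t'" if "t \<in> {0<..<1}" "t' \<in> {0..1}" for t t'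
      using loop_free[OF e, of t t'] that by (auto simp: doubleton_eq_iff)
    have aV: "c e a \<notin> V" using in_V[OF e, of a] a01 by auto
    obtain \<delta> f \<rho> where \<delta>: "\<delta> > 0" and \<rho>: "bij_betw \<rho> (UNIV :: bool set) UNIV" "\<And>i j. \<exists>m. (\<rho> ^^ m) i = j"
      and f: "\<And>F. \<lbrakk>F \<in> components (- X); c e a \<in> closure F\<rbrakk> \<Longrightarrow> F \<in> f ` UNIV"
        "\<And>i F q. \<lbrakk>F \<in> components (- X); q \<in> path_image (\<gamma> (\<rho> i)); q \<noteq> c e a; q \<in> ball (c e a) \<delta>\<rbrakk> \<Longrightarrow>
        q \<in> closure F \<longleftrightarrow> F = f i \<or> F = f (\<rho> i)"
    proof (rule star_faces [of "UNIV :: bool set" \<gamma> "c e a" R X])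
      show "arc (\<gamma> i)" for i
        unfolding \<gamma>_def using arc_simple_path_subpath_interior[OF simple[OF e], of a "u i"] a01 u by auto
      show "pathstart (\<gamma> i) = c e a" for i by (simp add: \<gamma>_def)
      show "path_image (\<gamma> i) \<inter> path_image (\<gamma> j) = {c e a}" if "i \<noteq> j" for i j
      proof -
        have "c e ` {a..u True} \<inter> c e ` {u False..a} = {c e a}"
        proof
          show "c e ` {a..u True} \<inter> c e ` {u False..a} \<subseteq> {c e a}"
          proof clarify
            fix t t' assume t: "t \<in> {a..u True}" "t' \<in> {u False..a}" "c e t = c e t'"
            then have "t = t'" using inj[of t t'] a01 by (auto simp: u_def)
            then show "c e t = c e a" using t by (metis atLeastAtMost_iff order_antisym)
          qed
        qed (use a01 in \<open>auto simp: u_def\<close>)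
        then show ?thesis using that unfolding im by (cases i; cases j) auto
      qed
      show "closed R"
      proof -
        have "compact (c e ` ({0..u False} \<union> {u True..1}))"
          using cont_c[OF e] a01 by (intro compact_continuous_image compact_Un) (auto simp: u_def intro: continuous_on_subset)
        then show ?thesis unfolding R_def using finV finE compact_c
          by (intro closed_Un closed_UN) (auto intro: compact_imp_closed finite_imp_closed)
      qed
      show "c e a \<notin> R"
      proof
        assume "c e a \<in> R"
        then consider "c e a \<in> V" | f where "f \<in> E - {e}" "c e a \<in> path_image (c f)" | "c e a \<in> c e ` ({0..u False} \<union> {u True..1})"
          unfolding R_def by blast
        then show False
        proof cases
          case 1 then show ?thesis using aV by blast
        next
          case 2
          have "c e a \<in> path_image (c e)" using a01 by (auto simp: path_image_def)
          then show ?thesis using 2 disjoint[OF e, of f] aV by blast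
        next
          case 3
          then obtain t where "t \<in> {0..u False} \<union> {u True..1}" "c e a = c e t" by blast
          then show ?thesis using ne[of t] a01 by (auto simp: u_def)
        qed
      qed
      show "X = R \<union> (\<Union>i\<in>UNIV. path_image (\<gamma> i))"
      proof -
        have "{0..1} = ({0..u False} \<union> {u True..1}) \<union> ({a..u True} \<union> {u False..a})"
          using a01 by (auto simp: u_def)
        then have "path_image (c e) = c e ` ({0..u False} \<union> {u True..1}) \<union> (c e ` {a..u True} \<union> c e ` {u False..a})"
          unfolding path_image_def by (metis image_Un)
        moreover have "(\<Union>i\<in>UNIV. path_image (\<gamma> i)) = c e ` {a..u True} \<union> c e ` {u False..a}"
          unfolding im UNIV_bool by auto
        moreover have "(\<Union>f\<in>E. path_image (c f)) = path_image (c e) \<union> (\<Union>f\<in>E - {e}. path_image (c f))"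
          using e by blast
        ultimately show ?thesis unfolding X_def R_def by (simp only: Un_ac)
      qed
    qed (auto)
    \<comment> \<open>A permutation of two elements with a single orbit exchanges them.\<close>
    have \<rho>not: "\<rho> i = (\<not> i)" for i
    proof -
      have "\<rho> i \<noteq> i"
      proof
        assume "\<rho> i = i"
        then have "(\<rho> ^^ m) i = i" for m by (induction m) auto
        then show False using \<rho>(2)[of i "\<not> i"] by auto
      qed
      then show ?thesis by auto
    qed
    have Fc: "F \<in> components (- X)" using F by (simp add: regions_def)
    then have "F = f True \<or> F = f False" using f(1)[OF _ aF] by (auto simp: UNIV_bool)
    then have all: "q \<in> closure F" if "q \<in> path_image (\<gamma> b)" "q \<noteq> c e a" "q \<in> ball (c e a) \<delta>" for q b
      using f(2)[OF Fc, of q "\<not> b"] that unfolding \<rho>not by (cases b) auto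
    have "continuous (at a) (c e)"
      using cont a01 by (simp add: continuous_on_eq_continuous_at)
    then obtain d where d: "d > 0" "\<And>t. \<bar>t - a\<bar> < d \<Longrightarrow> dist (c e t) (c e a) < \<delta>"
      using \<delta> unfolding continuous_at_eps_delta dist_real_def by metis
    show ?thesis
    proof (intro exI conjI allI impI)
      show "min d (min (a/2) ((1 - a)/2)) > 0" using d a01 by auto
      fix t assume t: "\<bar>t - a\<bar> < min d (min (a/2) ((1 - a)/2))" "t \<in> {0<..<1}"
      show "t \<in> S"
      proof (cases "t = a")
        case False
        have "c e t \<in> path_image (\<gamma> (t > a))"
          unfolding im using t by (intro image_eqI[OF refl]) (auto simp: u_def abs_less_iff field_simps)
        moreover have "c e t \<noteq> c e a" using ne[of t] t False by auto
        ultimately have "c e t \<in> closure F" using all d(2)[of t] t by (auto simp: dist_commute)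
        then show ?thesis using t by (simp add: S_def)
      qed (use a in simp)
    qed
  qed
  have "openin (top_of_set {0<..<1}) S"
    unfolding openin_euclidean_subtopology_iff
  proof (intro conjI ballI)
    show "S \<subseteq> {0<..<1}" by (auto simp: S_def)
    fix a assume "a \<in> S"
    then show "\<exists>\<eta>>0. \<forall>t\<in>{0<..<1}. dist t a < \<eta> \<longrightarrow> t \<in> S"
      using op[of a] unfolding dist_real_def by blast
  qed
  moreover have "connected {0<..<1::real}" by simp
  moreover have "s \<in> S" using s by (simp add: S_def)
  ultimately have "S = {0<..<1}" using clo unfolding connected_clopen by blast
  then have "c e ` {0<..<1} \<subseteq> closure F" by (auto simp: S_def)
  moreover have "c e ` closure {0<..<1} \<subseteq> closure F"
    using cont_c[OF e] calculation by (intro image_closure_subset) auto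
  ultimately show ?thesis by (simp add: path_image_def)
qed

end

section \<open>Darts at a vertex and the rotation system\<close>

context plane_drawing
begin

text \<open>Thirds keep the two ends of a loop apart: they meet in the common vertex only and can
  both be arcs of one star.\<close>

definition "third d = subpath 0 (1/3) (dpath d)"

lemma fstD: "d \<in> D \<Longrightarrow> fst d \<in> E" by (auto simp: D_def)

lemma third_image:
  "path_image (third d) = c (fst d) ` (if snd d then {2/3..1} else {0..1/3})"
proof -
  have "{2/3..1} = (\<lambda>t. 1 - t) ` {0..1/3::real}"
    by (auto simp: image_iff intro!: bexI[of _ "1 - x" for x])
  then have "c (fst d) ` {2/3..1} = (\<lambda>t. c (fst d) (1 - t)) ` {0..1/3}"
    by (simp only: image_image)
  then show ?thesis
    by (auto simp: third_def path_image_subpath dpath_def reversepath_def)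
qed

lemma third_sub: "path_image (third d) \<subseteq> path_image (c (fst d))"
  unfolding third_image by (auto simp: path_image_def)

lemma third_start: "pathstart (third d) = tail d"
  by (simp add: third_def dpath_def tail_def) (simp add: pathstart_def pathfinish_def reversepath_def)

lemma third_arc: assumes "d \<in> D" shows "arc (third d)"
  unfolding third_def using simple[OF fstD[OF assms]]
  by (intro arc_simple_path_subpath_interior) (auto simp: dpath_def simple_path_reversepath)

lemma third_V:
  assumes "d \<in> D" shows "path_image (third d) \<inter> V \<subseteq> {tail d}"
proof
  fix z assume z: "z \<in> path_image (third d) \<inter> V"
  then obtain s where s: "s \<in> (if snd d then {2/3..1} else {0..1/3})" "z = c (fst d) s"
    unfolding third_image by auto
  then have "s \<in> {0..1}" by (auto split: if_splits)
  then have "s = 0 \<or> s = 1" using in_V[OF fstD[OF assms], of s] z s by auto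
  then show "z \<in> {tail d}" using s by (auto simp: tail_def pathstart_def pathfinish_def split: if_splits)
qed

lemma third_disj:
  assumes d: "d \<in> D" "d' \<in> D" "d \<noteq> d'" "tail d = x" "tail d' = x"
  shows "path_image (third d) \<inter> path_image (third d') = {x}"
proof
  show "{x} \<subseteq> path_image (third d) \<inter> path_image (third d')"
    using third_start d pathstart_in_path_image by (metis IntI empty_subsetI insert_subset)
  show "path_image (third d) \<inter> path_image (third d') \<subseteq> {x}"
  proof (cases "fst d = fst d'")
    case False
    then have "path_image (third d) \<inter> path_image (third d') \<subseteq> V"
      using third_sub[of d] third_sub[of d'] disjoint[of "fst d" "fst d'"] fstD d by blast
    then show ?thesis using third_V[OF d(1)] d(4) by blast
  next
    case True
    have e: "fst d \<in> E" using d fstD by blast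
    have *: "c (fst d) s = x" if "s \<in> {0..1/3}" "t \<in> {2/3..1}" "c (fst d) s = c (fst d) t" for s t
    proof -
      have "{s, t} = {0, 1}" using loop_free[OF e, of s t] that by auto
      then have "s = 0" "t = 1" using that by (auto simp: doubleton_eq_iff)
      then show ?thesis using that d True by (auto simp: tail_def pathstart_def pathfinish_def split: if_splits)
    qed
    have "snd d \<noteq> snd d'" using True d(3) by (auto simp: prod_eq_iff)
    moreover have "c (fst d) ` {0..1/3} \<inter> c (fst d) ` {2/3..1} \<subseteq> {x}" using * by force
    ultimately show ?thesis unfolding third_image True[symmetric] by (cases "snd d") (auto simp: Int_commute)
  qed
qed

text \<open>The star tells which faces touch an edge close to \<open>x\<close>;
  \<open>edge_closure\<close> extends this to the whole edge and so gives
  \<open>regions_of\<close>.\<close>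

lemma vertex_star:
  assumes x: "d0 \<in> D" "tail d0 = x"
  defines "I \<equiv> {d \<in> D. tail d = x}"
  shows "\<exists>f \<rho>. bij_betw \<rho> I I \<and> (\<forall>i\<in>I. \<forall>j\<in>I. \<exists>m. (\<rho> ^^ m) i = j) \<and> (\<forall>i\<in>I. f i \<in> regions) \<and>
     (\<forall>F\<in>regions. x \<in> closure F \<longrightarrow> F \<in> f ` I) \<and> (\<forall>i\<in>I. regions_of (fst (\<rho> i)) = {f i, f (\<rho> i)})"
proof -
  \<comment> \<open>The parameters left after cutting off each third that starts at
    \<open>x\<close>; for a loop at \<open>x\<close> the middle third.\<close>
  define T where "T e = {s \<in> {0..1::real}. (pathstart (c e) = x \<longrightarrow> 1/3 \<le> s) \<and> (pathfinish (c e) = x \<longrightarrow> s \<le> 2/3)}" for e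
  define R where "R = (V - {x}) \<union> (\<Union>e\<in>E. c e ` T e)"
  have ID: "i \<in> I \<Longrightarrow> i \<in> D \<and> tail i = x" for i by (simp add: I_def)
  have "finite I" using finD by (simp add: I_def)
  have "I \<noteq> {}" using x unfolding I_def by blast
  have xV: "x \<in> V" using ends_V[OF fstD[OF x(1)]] x(2) by (auto simp: tail_def split: if_splits)
  have Tcl: "closed (c e ` T e)" if "e \<in> E" for e
  proof -
    have "T e = {0..1} \<inter> (if pathstart (c e) = x then {1/3..} else UNIV) \<inter> (if pathfinish (c e) = x then {..2/3} else UNIV)"
      by (auto simp: T_def)
    then have "compact (T e)" by (auto intro!: compact_Int_closed closed_Int)
    moreover have "continuous_on (T e) (c e)" using cont_c[OF that] by (rule continuous_on_subset) (auto simp: T_def)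
    ultimately show ?thesis by (simp add: compact_continuous_image compact_imp_closed)
  qed
  have Rcl: "closed R" unfolding R_def using finV finE Tcl by (intro closed_Un closed_UN) (simp_all add: finite_imp_closed)
  have xR: "x \<notin> R"
  proof
    assume "x \<in> R"
    then obtain e s where e: "e \<in> E" "s \<in> T e" "x = c e s" unfolding R_def by auto
    then have "s = 0 \<or> s = 1" using in_V[of e s] xV by (auto simp: T_def)
    then show False using e by (auto simp: T_def pathstart_def pathfinish_def)
  qed
  have XR: "X = R \<union> (\<Union>i\<in>I. path_image (third i))"
  proof
    show "R \<union> (\<Union>i\<in>I. path_image (third i)) \<subseteq> X"
    proof -
      have "c e ` T e \<subseteq> path_image (c e)" for e by (auto simp: T_def path_image_def)
      moreover have "path_image (third i) \<subseteq> X" if "i \<in> I" for i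
        using third_sub[of i] fstD[of i] ID[OF that] unfolding X_def by blast
      ultimately show ?thesis unfolding R_def X_def by blast
    qed
    show "X \<subseteq> R \<union> (\<Union>i\<in>I. path_image (third i))"
    proof
      fix z assume "z \<in> X"
      then consider "z = x" | "z \<in> V - {x}" | e s where "e \<in> E" "s \<in> {0..1}" "z = c e s"
        unfolding X_def path_image_def by blast
      then show "z \<in> R \<union> (\<Union>i\<in>I. path_image (third i))"
      proof cases
        case 1
        then have "z \<in> path_image (third d0)" "d0 \<in> I"
          using x third_start[of d0] pathstart_in_path_image[of "third d0"] unfolding I_def by auto
        then show ?thesis by blast
      next
        case 2 then show ?thesis by (simp add: R_def)
      next
        case 3
        show ?thesis
        proof (cases "s \<in> T e")
          case True then show ?thesis using 3 by (auto simp: R_def)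
        next
          case False
          then have "(pathstart (c e) = x \<and> s < 1/3) \<or> (pathfinish (c e) = x \<and> 2/3 < s)"
            using 3(2) by (auto simp: T_def)
          then show ?thesis
          proof
            assume "pathstart (c e) = x \<and> s < 1/3"
            then have "(e, False) \<in> I" "z \<in> path_image (third (e, False))"
              unfolding third_image using 3 by (auto simp: I_def D_def tail_def)
            then show ?thesis by blast
          next
            assume "pathfinish (c e) = x \<and> 2/3 < s"
            then have "(e, True) \<in> I" "z \<in> path_image (third (e, True))"
              unfolding third_image using 3 by (auto simp: I_def D_def tail_def)
            then show ?thesis by blast
          qed
        qed
      qed
    qed
  qed
  obtain \<delta> f \<rho> where \<delta>: "\<delta> > 0" and \<rho>: "bij_betw \<rho> I I" "\<And>i j. \<lbrakk>i \<in> I; j \<in> I\<rbrakk> \<Longrightarrow> \<exists>m. (\<rho> ^^ m) i = j"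
    and f: "\<And>i. i \<in> I \<Longrightarrow> f i \<in> components (- X)"
    "\<And>F. \<lbrakk>F \<in> components (- X); x \<in> closure F\<rbrakk> \<Longrightarrow> F \<in> f ` I"
    "\<And>i F q. \<lbrakk>i \<in> I; F \<in> components (- X); q \<in> path_image (third (\<rho> i)); q \<noteq> x; q \<in> ball x \<delta>\<rbrakk> \<Longrightarrow>
        q \<in> closure F \<longleftrightarrow> F = f i \<or> F = f (\<rho> i)"
  proof (rule star_faces [of I third x R X])
    show "path_image (third i) \<inter> path_image (third j) = {x}" if "i \<in> I" "j \<in> I" "i \<noteq> j" for i j
      using third_disj[of i j x] ID that by blast
  qed (use \<open>finite I\<close> \<open>I \<noteq> {}\<close> third_arc third_start ID Rcl xR XR in auto)
  have "regions_of (fst (\<rho> i)) = {f i, f (\<rho> i)}" if i: "i \<in> I" for i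
  proof -
    define d where "d = \<rho> i"
    have "d \<in> I" using \<rho>(1) i by (auto simp: d_def bij_betw_def)
    then have d: "d \<in> D" "tail d = x" "fst d \<in> E" using ID fstD by auto
    have "continuous_on {0..1} (third d)" "third d 0 = x" "inj_on (third d) {0..1}"
      using third_arc[OF d(1)] third_start[of d] d by (auto simp: arc_def path_def pathstart_def)
    then obtain \<eta> where \<eta>: "\<eta> > 0" "\<And>t. \<lbrakk>t \<in> {0..1}; dist t 0 < \<eta>\<rbrakk> \<Longrightarrow> dist (third d t) x < \<delta>"
      using \<delta> unfolding continuous_on_iff by (metis atLeastAtMost_iff order_refl zero_le_one)
    define t where "t = min \<eta> 1 / 2"
    have t: "0 < t" "t < 1" "t < \<eta>" using \<eta>(1) by (auto simp: t_def min_def)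
    define q where "q = third d t"
    have q1: "q \<in> path_image (third (\<rho> i))" using t by (auto simp: q_def d_def path_image_def)
    have q2: "q \<noteq> x" using inj_onD[OF \<open>inj_on (third d) {0..1}\<close>, of t 0] t \<open>third d 0 = x\<close> by (auto simp: q_def)
    have q3: "q \<in> ball x \<delta>" using \<eta>(2)[of t] t by (auto simp: q_def dist_commute)
    obtain s where s: "0 < s" "s < 1" "q = c (fst d) s"
    proof (rule that)
      show "0 < (if snd d then 1 - t/3 else t/3)" "(if snd d then 1 - t/3 else t/3) < 1" using t by auto
      show "q = c (fst d) (if snd d then 1 - t/3 else t/3)"
        by (simp add: q_def third_def subpath_def dpath_def reversepath_def)
    qed
    have "F \<in> regions_of (fst d) \<longleftrightarrow> F \<in> {f i, f (\<rho> i)}" for F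
    proof
      assume F: "F \<in> regions_of (fst d)"
      then have "q \<in> closure F" using s by (auto simp: regions_of_def path_image_def)
      then show "F \<in> {f i, f (\<rho> i)}" using f(3)[OF i _ q1 q2 q3, of F] F by (auto simp: regions_of_def regions_def)
    next
      assume F: "F \<in> {f i, f (\<rho> i)}"
      then have "F \<in> regions" using f(1)[OF i] f(1)[OF \<open>d \<in> I\<close>] unfolding regions_def d_def by blast
      moreover have "q \<in> closure F" using f(3)[OF i _ q1 q2 q3, of F] F calculation by (auto simp: regions_def)
      ultimately show "F \<in> regions_of (fst d)"
        using edge_closure[OF d(3) _ s(1,2), of F] s(3) by (auto simp: regions_of_def)
    qed
    then show ?thesis unfolding d_def by blast
  qed
  then show ?thesis using \<rho> f(1,2) unfolding regions_def
    by (intro exI[of _ f] exI[of _ \<rho>] conjI ballI impI) blast+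
qed

theorem rotation_system:
  obtains \<rho> f where "bij_betw \<rho> D D" "\<And>d. d \<in> D \<Longrightarrow> tail (\<rho> d) = tail d"
    "\<And>d d'. \<lbrakk>d \<in> D; d' \<in> D; tail d = tail d'\<rbrakk> \<Longrightarrow> \<exists>m. (\<rho> ^^ m) d = d'"
    "\<And>d. d \<in> D \<Longrightarrow> f d \<in> regions" "\<And>d. d \<in> D \<Longrightarrow> regions_of (fst (\<rho> d)) = {f d, f (\<rho> d)}"
    "\<And>F d. \<lbrakk>F \<in> regions; d \<in> D; tail d \<in> closure F\<rbrakk> \<Longrightarrow> F \<in> f ` D"
proof -
  let ?I = "\<lambda>x. {d \<in> D. tail d = x}"
  define Q where "Q x f \<rho> \<longleftrightarrow> bij_betw \<rho> (?I x) (?I x) \<and> (\<forall>i\<in>?I x. \<forall>j\<in>?I x. \<exists>m. (\<rho> ^^ m) i = j) \<and> (\<forall>i\<in>?I x. f i \<in> regions) \<and>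
     (\<forall>F\<in>regions. x \<in> closure F \<longrightarrow> F \<in> f ` ?I x) \<and> (\<forall>i\<in>?I x. regions_of (fst (\<rho> i)) = {f i, f (\<rho> i)})" for x f \<rho>
  have "\<exists>f \<rho>. Q x f \<rho>" if x: "x \<in> tail ` D" for x
  proof -
    obtain d where "d \<in> D" "tail d = x" using x by blast
    from vertex_star[OF this] show ?thesis unfolding Q_def .
  qed
  then obtain f \<rho> where Q: "\<And>x. x \<in> tail ` D \<Longrightarrow> Q x (f x) (\<rho> x)" by metis
  define P where "P d = \<rho> (tail d) d" for d
  define g where "g d = f (tail d) d" for d
  have bij: "bij_betw (\<rho> (tail d)) (?I (tail d)) (?I (tail d))"
    and tr: "\<forall>i\<in>?I (tail d). \<forall>j\<in>?I (tail d). \<exists>m. (\<rho> (tail d) ^^ m) i = j"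
    and fF: "\<forall>i\<in>?I (tail d). f (tail d) i \<in> regions"
    and fc: "\<forall>F\<in>regions. tail d \<in> closure F \<longrightarrow> F \<in> f (tail d) ` ?I (tail d)"
    and fo: "\<forall>i\<in>?I (tail d). regions_of (fst (\<rho> (tail d) i)) = {f (tail d) i, f (tail d) (\<rho> (tail d) i)}"
    if "d \<in> D" for d
    using Q[OF imageI[OF that, of tail]] unfolding Q_def by - (elim conjE, assumption)+
  have tP: "P d \<in> D \<and> tail (P d) = tail d" if "d \<in> D" for d
  proof -
    have "P d \<in> ?I (tail d)" unfolding P_def using bij_betwE[OF bij[OF that]] that by blast
    then show ?thesis by blast
  qed
  have pow: "(P ^^ m) d = (\<rho> (tail d) ^^ m) d \<and> (P ^^ m) d \<in> D \<and> tail ((P ^^ m) d) = tail d" if "d \<in> D" for d m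
  proof (induction m)
    case (Suc m)
    then have "P ((P ^^ m) d) = \<rho> (tail d) ((\<rho> (tail d) ^^ m) d)" by (metis P_def)
    moreover have "P ((P ^^ m) d) \<in> D" "tail (P ((P ^^ m) d)) = tail d"
      using tP[of "(P ^^ m) d"] Suc by (blast, metis)
    ultimately show ?case by simp
  qed (use that in simp)
  have inj: "inj_on P D"
  proof (rule inj_onI)
    fix a b assume ab: "a \<in> D" "b \<in> D" "P a = P b"
    then have "tail a = tail b" using tP by metis
    then show "a = b" using inj_onD[OF bij_betw_imp_inj_on[OF bij[OF ab(1)]], of a b] ab unfolding P_def by simp
  qed
  have "P ` D \<subseteq> D" using tP by blast
  then have bijP: "bij_betw P D D" using inj finD by (simp add: bij_betw_def endo_inj_surj)
  show ?thesis
  proof (rule that [of P g])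
    show "\<exists>m. (P ^^ m) d = d'" if dd: "d \<in> D" "d' \<in> D" "tail d = tail d'" for d d'
    proof -
      have "\<exists>m. (\<rho> (tail d) ^^ m) d = d'"
        by (rule tr[OF dd(1), THEN bspec, THEN bspec]) (use dd in simp_all)
      then obtain m where "(\<rho> (tail d) ^^ m) d = d'" by blast
      then show ?thesis using pow[OF dd(1), of m] by auto
    qed
    show "g d \<in> regions" if "d \<in> D" for d using fF[OF that] that unfolding g_def by blast
    show "regions_of (fst (P d)) = {g d, g (P d)}" if "d \<in> D" for d
    proof -
      have "regions_of (fst (\<rho> (tail d) d)) = {f (tail d) d, f (tail d) (\<rho> (tail d) d)}"
        by (rule fo[OF that, THEN bspec]) (use that in simp)
      then show ?thesis using tP[OF that] by (simp add: g_def P_def)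
    qed
    show "F \<in> g ` D" if "F \<in> regions" "d \<in> D" "tail d \<in> closure F" for F d
    proof -
      have "F \<in> f (tail d) ` ?I (tail d)" using fc[OF that(2)] that by blast
      then obtain i where i: "i \<in> D" "tail i = tail d" "F = f (tail d) i" by blast
      then have "F = g i" by (simp add: g_def)
      then show ?thesis using i(1) by blast
    qed
  qed (use bijP tP in auto)
qed

text \<open>The boundary of a region contains a point of the drawing. At a vertex the region has a
  corner by assumption; at an interior point of an edge it borders the whole edge and is one of the
  two labels beside it. In particular there are only finitely many regions.\<close>

lemma regions_meet_darts:
  assumes f: "\<And>d. d \<in> D \<Longrightarrow> regions_of (fst (\<rho> d)) = {f d, f (\<rho> d)}" "bij_betw \<rho> D D"
    "\<And>F d. \<lbrakk>F \<in> regions; d \<in> D; tail d \<in> closure F\<rbrakk> \<Longrightarrow> F \<in> f ` D"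
   and V: "V \<subseteq> tail ` D" "V \<noteq> {}"
  shows "regions \<subseteq> f ` D"
proof
  fix F assume F: "F \<in> regions"
  have Fc: "F \<in> components (- X)" using F by (simp add: regions_def)
  have "F \<noteq> {}" "F \<noteq> UNIV"
    using Fc in_components_nonempty in_components_subset[OF Fc] V(2) by (auto simp: X_def)
  then have "frontier F \<noteq> {}" by (metis frontier_eq_empty)
  moreover have "frontier F \<subseteq> frontier (- X)" using Fc frontier_of_components_subset by blast
  moreover have "frontier (- X) \<subseteq> X" using compact_X by (simp add: frontier_complement compact_imp_closed frontier_subset_closed)
  ultimately obtain z where z: "z \<in> X" "z \<in> closure F" by (auto simp: frontier_def)
  show "F \<in> f ` D"
  proof (cases "z \<in> V")
    case True
    then show ?thesis using V(1) f(3)[OF F] z by blast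
  next
    case False
    then obtain e s where e: "e \<in> E" "s \<in> {0..1}" "z = c e s" using z by (auto simp: X_def path_image_def)
    have "c e 0 \<in> V" "c e 1 \<in> V" using ends_V[OF e(1)] by (auto simp: pathstart_def pathfinish_def)
    then have "s \<noteq> 0" "s \<noteq> 1" using False e by auto
    then have "F \<in> regions_of e" using edge_closure[OF e(1) F, of s] e z F by (auto simp: regions_of_def)
    moreover have "(e, False) \<in> \<rho> ` D" using f(2) e by (auto simp: bij_betw_def D_def)
    then obtain d where "d \<in> D" "(e, False) = \<rho> d" by blast
    moreover have "\<rho> d \<in> D" using f(2) \<open>d \<in> D\<close> by (auto simp: bij_betw_def)
    ultimately show ?thesis using f(1)[OF \<open>d \<in> D\<close>] by (metis fst_conv image_eqI insertE singletonD)
  qed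
qed

end

section \<open>Euler's inequality\<close>

text \<open>Reduces closed curves to arcs, to which the dimension argument applies.\<close>

lemma simple_path_two_arcs:
  assumes "simple_path g"
  shows "arc (subpath 0 (1/2) g)" "arc (subpath (1/2) 1 g)"
    "path_image g = path_image (subpath 0 (1/2) g) \<union> path_image (subpath (1/2) 1 g)"
proof -
  show "arc (subpath 0 (1/2) g)" "arc (subpath (1/2) 1 g)"
    using assms by (auto intro!: arc_simple_path_subpath_interior)
  have "{0..1} = {0..1/2} \<union> {1/2..1::real}" by auto
  then have "path_image g = g ` {0..1/2} \<union> g ` {1/2..1}" unfolding path_image_def by (metis image_Un)
  then show "path_image g = path_image (subpath 0 (1/2) g) \<union> path_image (subpath (1/2) 1 g)"
    by (simp add: path_image_subpath)
qed

lemma interior_simple_path_empty: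
  fixes g :: "real \<Rightarrow> complex"
  assumes "simple_path g" shows "interior (path_image g) = {}"
  unfolding simple_path_two_arcs(3)[OF assms]
  using interior_closed_Un_empty_interior[OF closed_arc_image[OF simple_path_two_arcs(1)[OF assms]]]
    interior_arc_empty simple_path_two_arcs(1,2)[OF assms] by metis

lemma interior_finite_Union_empty:
  fixes \<F> :: "'a::topological_space set set"
  assumes "finite \<F>" "\<And>S. S \<in> \<F> \<Longrightarrow> closed S \<and> interior S = {}"
  shows "interior (\<Union>\<F>) = {}"
  using assms
proof (induction \<F>)
  case (insert S \<F>)
  then show ?case using interior_closed_Un_empty_interior[of S "\<Union>\<F>"] by simp
qed simp

context plane_drawing
begin

definition "drawn S = V \<union> (\<Union>e\<in>S. path_image (c e))"
definition "link e = (pathstart (c e), pathfinish (c e))"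

lemma drawn_E: "drawn E = X" by (simp add: drawn_def X_def)

lemma closed_drawn: "S \<subseteq> E \<Longrightarrow> closed (drawn S)"
  unfolding drawn_def using finV finE compact_c finite_subset[of S E]
  by (intro closed_Un closed_UN) (auto intro: finite_imp_closed compact_imp_closed)

text \<open>A drawing is a finite union of closed sets with empty interior. This allows points to be
  moved off it within any open set.\<close>

lemma drawn_dense:
  assumes "S \<subseteq> E" "open U" "u \<in> U"
  obtains z where "z \<in> U" "z \<notin> drawn S"
proof -
  have "interior (\<Union>((\<lambda>v. {v}) ` V \<union> (\<lambda>e. path_image (c e)) ` S)) = {}"
    using assms(1) finV finE finite_subset[of S E] simple compact_c
    by (intro interior_finite_Union_empty) (auto simp: interior_simple_path_empty subset_iff intro: compact_imp_closed)
  moreover have "\<Union>((\<lambda>v. {v}) ` V \<union> (\<lambda>e. path_image (c e)) ` S) = drawn S" by (auto simp: drawn_def)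
  ultimately have "\<not> U \<subseteq> drawn S" using assms(2,3) interior_maximal[of U "drawn S"] by auto
  then show ?thesis using that by blast
qed

lemma link_path_component:
  assumes "S \<subseteq> E" "x \<in> V" "(x, y) \<in> conn (link ` S)"
  shows "path_component (drawn S) x y"
  using assms(3) unfolding conn_def
proof (induction rule: rtrancl_induct)
  case base
  show ?case using assms(2) by (simp add: path_component_refl drawn_def)
next
  case (step y z)
  have link: "path_component (drawn S) a b" if ab: "(a, b) \<in> link ` S" for a b
  proof -
    obtain e where e: "e \<in> S" "a = pathstart (c e)" "b = pathfinish (c e)" using ab by (auto simp: link_def)
    then have "path (c e)" "path_image (c e) \<subseteq> drawn S"
      using assms(1) simple simple_path_imp_path by (blast, auto simp: drawn_def)
    then show ?thesis unfolding path_component_def using e by blast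
  qed
  from step(2) have "path_component (drawn S) y z"
    using link[of y z] link[of z y] path_component_sym by auto
  then show ?case using step(3) path_component_trans by blast
qed

text \<open>The edge lies on a Jordan curve in the drawing: the edge itself if it is a loop, and
  otherwise the edge closed up by an arc through the rest. The midpoint of the edge is on the
  frontier of both sides of that curve and has a ball free of the other edges; \<open>p\<close> and
  \<open>q\<close> are chosen in this ball on different sides.\<close>

lemma cycle_edge_separates:
  assumes S: "S \<subseteq> E" and e: "e \<in> E" "e \<notin> S" "link e \<in> conn (link ` S)"
  obtains p q where "p \<notin> drawn (insert e S)" "q \<notin> drawn (insert e S)"
    "connected_component (- drawn S) p q" "\<not> connected_component (- drawn (insert e S)) p q"
proof -
  define x where "x = pathstart (c e)"
  define y where "y = pathfinish (c e)"
  have V: "path_image (c e) \<inter> V = {x, y}" using ends_V[OF e(1)] by (simp add: x_def y_def)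
  have meet: "path_image (c e) \<inter> drawn S \<subseteq> {x, y}"
  proof -
    have "path_image (c e) \<inter> path_image (c f) \<subseteq> V" if "f \<in> S" for f
      using disjoint[OF e(1), of f] that S e(2) by blast
    then have "path_image (c e) \<inter> drawn S \<subseteq> path_image (c e) \<inter> V" unfolding drawn_def by blast
    then show ?thesis using V by simp
  qed
  obtain J where J: "simple_path J" "pathfinish J = pathstart J" "path_image (c e) \<subseteq> path_image J"
      "path_image J \<subseteq> drawn (insert e S)"
  proof (cases "x = y")
    case True
    show ?thesis
    proof (rule that [of "c e"])
      show "path_image (c e) \<subseteq> drawn (insert e S)" by (auto simp: drawn_def)
    qed (use simple[OF e(1)] True in \<open>auto simp: x_def y_def\<close>)
  next
    case False
    have "path_component (drawn S) x y"
      using link_path_component[OF S, of x y] V e(3) by (auto simp: link_def x_def y_def)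
    then obtain g where g: "arc g" "path_image g \<subseteq> path_component_set (drawn S) x" "pathstart g = x" "pathfinish g = y"
      using path_connected_path_component[of "drawn S" x] False path_component_refl[of x "drawn S"]
      unfolding path_connected_arcwise by (metis mem_Collect_eq path_component_mem(1))
    then have gS: "path_image g \<subseteq> drawn S" using path_component_subset by fast
    have ace: "arc (c e)" using simple[OF e(1)] False by (simp add: arc_simple_path x_def y_def)
    have im: "path_image (c e +++ reversepath g) = path_image (c e) \<union> path_image g"
      using g by (simp add: path_image_join y_def)
    show ?thesis
    proof (rule that [of "c e +++ reversepath g"])
      show "simple_path (c e +++ reversepath g)"
        using g ace meet gS by (intro simple_path_join_loop) (auto simp: x_def y_def arc_reversepath)
      show "path_image (c e) \<subseteq> path_image (c e +++ reversepath g)" using im by simp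
      show "path_image (c e +++ reversepath g) \<subseteq> drawn (insert e S)" unfolding im using gS by (auto simp: drawn_def)
    qed (use g in \<open>auto simp: x_def\<close>)
  qed
  note Jordan = Jordan_inside_outside[OF J(1,2)]
  define m where "m = c e (1/2)"
  have m: "m \<in> path_image (c e)" by (auto simp: m_def path_image_def)
  have "m \<notin> V" using in_V[OF e(1), of "1/2"] by (auto simp: m_def)
  then have "m \<notin> drawn S" using meet m V by blast
  then obtain r where r: "r > 0" "ball m r \<inter> drawn S = {}" using closed_ball_avoid[OF closed_drawn[OF S]] by metis
  have sub: "insert e S \<subseteq> E" using S e by blast
  have "m \<in> frontier (inside (path_image J))" "m \<in> frontier (outside (path_image J))" using Jordan m J(3) by auto
  then have mc: "m \<in> closure (inside (path_image J))" "m \<in> closure (outside (path_image J))" by (auto simp: frontier_def)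
  have pick: "\<exists>z\<in>ball m r \<inter> U. z \<notin> drawn (insert e S)" if U: "open U" "m \<in> closure U" for U
  proof -
    obtain u where "u \<in> U" "dist u m < r" using U(2) r(1) closure_approachable by metis
    then have "u \<in> ball m r \<inter> U" by (simp add: dist_commute)
    then show ?thesis using drawn_dense[OF sub, of "ball m r \<inter> U"] U(1) by (metis open_Int open_ball)
  qed
  obtain p where p: "p \<in> ball m r" "p \<in> inside (path_image J)" "p \<notin> drawn (insert e S)" using pick[OF _ mc(1)] Jordan by blast
  obtain q where q: "q \<in> ball m r" "q \<in> outside (path_image J)" "q \<notin> drawn (insert e S)" using pick[OF _ mc(2)] Jordan by blast
  show ?thesis
  proof (rule that [OF p(3) q(3)])
    show "connected_component (- drawn S) p q"
      unfolding connected_component_def using p q r by (intro exI[of _ "ball m r"]) auto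
    show "\<not> connected_component (- drawn (insert e S)) p q"
    proof
      assume "connected_component (- drawn (insert e S)) p q"
      then have "connected_component (- path_image J) p q"
        using J(4) connected_component_of_subset[of "- drawn (insert e S)" p q "- path_image J"] by blast
      then have "q \<in> inside (path_image J)" using inside_same_component p(2) by metis
      then show False using q(2) Jordan by blast
    qed
  qed
qed

definition separated_by :: "complex set \<Rightarrow> complex set \<Rightarrow> bool" where
  "separated_by Y P \<longleftrightarrow> P \<inter> Y = {} \<and> (\<forall>p\<in>P. \<forall>q\<in>P. p \<noteq> q \<longrightarrow> \<not> connected_component (- Y) p q)"

lemma separated_by_mono:
  assumes "separated_by Y P" "Y \<subseteq> Y'" "P \<inter> Y' = {}" shows "separated_by Y' P"
  using assms connected_component_of_subset[of "- Y'" _ _ "- Y"] unfolding separated_by_def by blast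

text \<open>The regions are counted by sets of points no two of which lie in the same region, so that their
  finiteness need not be known beforehand.\<close>

lemma euler_points:
  assumes "finite S" "S \<subseteq> E" "V \<noteq> {}"
  shows "\<exists>P. finite P \<and> separated_by (drawn S) P \<and> 1 + card S + ncomp (link ` S) V \<le> card P + card V"
  using assms
proof (induction S)
  case empty
  obtain z where z: "z \<notin> drawn {}" using drawn_dense[of "{}" UNIV 0] by auto
  have "V // conn {} = (\<lambda>v. conn {} `` {v}) ` V" by (auto simp: quotient_def)
  then have "card (V // conn {}) \<le> card V" using finV by (simp add: card_image_le)
  then show ?case using z by (intro exI[of _ "{z}"]) (auto simp: separated_by_def ncomp_def)
next
  case (insert e S)
  then have S: "S \<subseteq> E" and e: "e \<in> E" "e \<notin> S" and sub: "insert e S \<subseteq> E" by auto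
  obtain P where P: "finite P" "separated_by (drawn S) P" "1 + card S + ncomp (link ` S) V \<le> card P + card V"
    using insert by auto
  have le: "drawn S \<subseteq> drawn (insert e S)" by (auto simp: drawn_def)
  \<comment> \<open>A representative may lie on the new edge; it is moved off the edge within its
    region.\<close>
  have "\<exists>p'. p' \<notin> drawn (insert e S) \<and> connected_component (- drawn S) p p'" if "p \<in> P" for p
  proof -
    have "p \<in> - drawn S" using P(2) that by (auto simp: separated_by_def)
    then have "p \<in> connected_component_set (- drawn S) p" by simp
    moreover have "open (connected_component_set (- drawn S) p)"
      using closed_drawn[OF S] by (intro open_connected_component) auto
    ultimately obtain z where "z \<in> connected_component_set (- drawn S) p" "z \<notin> drawn (insert e S)"
      using drawn_dense[OF sub] by metis
    then show ?thesis by auto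
  qed
  then obtain \<pi> where \<pi>: "\<And>p. p \<in> P \<Longrightarrow> \<pi> p \<notin> drawn (insert e S)" "\<And>p. p \<in> P \<Longrightarrow> connected_component (- drawn S) p (\<pi> p)"
    by metis
  have sep: "\<not> connected_component (- drawn S) (\<pi> p) (\<pi> q)" if "p \<in> P" "q \<in> P" "p \<noteq> q" for p q
  proof
    assume "connected_component (- drawn S) (\<pi> p) (\<pi> q)"
    then have "connected_component (- drawn S) p q"
      using \<pi>(2)[OF that(1)] \<pi>(2)[OF that(2)] by (meson connected_component_sym connected_component_trans)
    then show False using P(2) that by (auto simp: separated_by_def)
  qed
  have refl: "connected_component (- drawn S) (\<pi> p) (\<pi> p)" if "p \<in> P" for p
    using \<pi>(1)[OF that] le by (auto simp: connected_component_refl)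
  have "inj_on \<pi> P" using sep refl unfolding inj_on_def by metis
  define P' where "P' = \<pi> ` P"
  have P': "finite P'" "card P' = card P" "P' \<inter> drawn (insert e S) = {}"
    using P(1) \<open>inj_on \<pi> P\<close> \<pi>(1) by (auto simp: P'_def card_image)
  have sP': "separated_by (drawn S) P'"
    unfolding separated_by_def using P'(3) le sep by (auto simp: P'_def)
  have cardS: "card (insert e S) = card S + 1" using insert by simp
  have ends: "pathstart (c e) \<in> V" "pathfinish (c e) \<in> V" using ends_V[OF e(1)] by auto
  have li: "link ` insert e S = insert (pathstart (c e), pathfinish (c e)) (link ` S)" by (simp add: link_def)
  \<comment> \<open>An edge between two components lowers \<open>ncomp\<close>, and the old
    representatives serve. An edge that closes a cycle splits a region: the representative of that
    region, if there is one, gives way to the two points \<open>p\<close> and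
    \<open>q\<close>.\<close>
  show ?case
  proof (cases "link e \<in> conn (link ` S)")
    case False
    then have "ncomp (link ` insert e S) V + 1 \<le> ncomp (link ` S) V"
      unfolding li using finV ends by (intro ncomp_insert_less) (auto simp: link_def)
    moreover have "separated_by (drawn (insert e S)) P'" using separated_by_mono[OF sP' le P'(3)] .
    ultimately show ?thesis using P(3) P' cardS by (intro exI[of _ P']) simp
  next
    case True
    obtain p q where pq: "p \<notin> drawn (insert e S)" "q \<notin> drawn (insert e S)"
      "connected_component (- drawn S) p q" "\<not> connected_component (- drawn (insert e S)) p q"
      using cycle_edge_separates[OF S e True] .
    have ref: "connected_component (- drawn (insert e S)) p p" using pq(1) by (simp add: connected_component_refl)
    then have "p \<noteq> q" using pq(4) by auto
    define B where "B = {z \<in> P'. connected_component (- drawn S) p z}"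
    have "card B \<le> 1"
    proof -
      have "z = w" if "z \<in> B" "w \<in> B" for z w
      proof -
        have "connected_component (- drawn S) z w"
          using that by (auto simp: B_def intro: connected_component_trans connected_component_sym)
        then show ?thesis using that sP' by (auto simp: B_def separated_by_def)
      qed
      then show ?thesis by (simp add: card_le_Suc0_iff_eq B_def P'(1))
    qed
    define Q where "Q = insert p (insert q (P' - B))"
    have B: "\<not> connected_component (- drawn S) p z" "\<not> connected_component (- drawn S) q z"
      "\<not> connected_component (- drawn S) z p" "\<not> connected_component (- drawn S) z q" if "z \<in> P' - B" for z
      using that pq(3) unfolding B_def by (auto dest: connected_component_sym connected_component_trans)
    have "p \<notin> P' - B" "q \<notin> P' - B"
      using B[of p] B[of q] pq(3) connected_component_sym[OF pq(3)] by (auto dest: connected_component_trans)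
    then have cQ: "card Q = card (P' - B) + 2" using \<open>p \<noteq> q\<close> P'(1) by (simp add: Q_def)
    have "card (P' - B) = card P' - card B" using P'(1) by (intro card_Diff_subset) (auto simp: B_def)
    then have "card P + 1 \<le> card Q" using cQ \<open>card B \<le> 1\<close> P'(2) by linarith
    moreover have "separated_by (drawn (insert e S)) Q"
    proof -
      have mono: "connected_component (- drawn (insert e S)) z w \<Longrightarrow> connected_component (- drawn S) z w" for z w
        using connected_component_of_subset[of "- drawn (insert e S)" z w "- drawn S"] le by blast
      have "\<not> connected_component (- drawn (insert e S)) q p" using pq(4) connected_component_sym by blast
      moreover have "\<not> connected_component (- drawn (insert e S)) z w" if "z \<in> P' - B" "w \<in> P' - B" "z \<noteq> w" for z w
        using that mono[of z w] sP' unfolding separated_by_def by blast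
      moreover have "\<not> connected_component (- drawn (insert e S)) z w"
         if "z \<in> P' - B" "w \<in> {p, q}" for z w using B(3,4)[OF that(1)] mono that(2) by blast
      moreover have "\<not> connected_component (- drawn (insert e S)) w z"
         if "z \<in> P' - B" "w \<in> {p, q}" for z w using B(1,2)[OF that(1)] mono that(2) by blast
      ultimately show ?thesis
        unfolding separated_by_def Q_def using pq(1,2,4) P'(3) by (intro conjI ballI impI) blast+
    qed
    moreover have "ncomp (link ` insert e S) V \<le> ncomp (link ` S) V"
      unfolding li by (rule ncomp_mono[OF finV insert_conn])
    moreover have "finite Q" using P'(1) by (simp add: Q_def)
    ultimately show ?thesis using P(3) cardS by (intro exI[of _ Q]) simp
  qed
qed

theorem euler_inequality:
  assumes "V \<noteq> {}" "finite regions"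
  shows "card E + 2 \<le> card V + card regions"
proof -
  obtain P where P: "finite P" "separated_by X P" "1 + card E + ncomp (link ` E) V \<le> card P + card V"
    using euler_points[OF finE subset_refl assms(1)] unfolding drawn_E by blast
  have "ncomp (link ` E) V \<noteq> 0"
    using assms(1) finite_comps[OF finV] by (auto simp: ncomp_def quotient_def)
  moreover have "card P \<le> card regions"
  proof (rule card_inj_on_le [of "connected_component_set (- X)"])
    show "connected_component_set (- X) ` P \<subseteq> regions"
      using P(2) unfolding regions_def separated_by_def by (intro image_subsetI componentsI) auto
    show "inj_on (connected_component_set (- X)) P"
    proof (rule inj_onI)
      fix p q assume pq: "p \<in> P" "q \<in> P" "connected_component_set (- X) p = connected_component_set (- X) q"
      have "q \<in> connected_component_set (- X) q" using P(2) pq(2) by (auto simp: separated_by_def)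
      then have "connected_component (- X) p q" using pq(3) by blast
      then show "p = q" using P(2) pq(1,2) by (auto simp: separated_by_def)
    qed
  qed (rule assms(2))
  ultimately show ?thesis using P(3) by linarith
qed

end

section \<open>From the sphere to the plane\<close>

lemma closure_continuous_image:
  fixes f :: "'a::metric_space \<Rightarrow> 'b::metric_space"
  assumes "continuous_on S f" "A \<subseteq> S" "x \<in> S" "x \<in> closure A"
  shows "f x \<in> closure (f ` A)"
proof -
  obtain u where u: "\<And>n. u n \<in> A" "u \<longlonglongrightarrow> x" using assms(4) closure_sequential by metis
  then have "(f \<circ> u) \<longlonglongrightarrow> f x"
    using assms(1-3) unfolding continuous_on_sequentially by blast
  then show ?thesis using u(1) closure_sequential[of "f x" "f ` A"] by (metis comp_apply imageI)
qed

lemma punctured_sphere_homeomorphic_plane: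
  assumes "P \<in> two_sphere" shows "(two_sphere - {P}) homeomorphic (UNIV :: complex set)"
proof -
  have "rel_frontier (cball 0 1 :: (real^3) set) = two_sphere" by (simp add: rel_frontier_cball)
  moreover have "aff_dim (cball 0 1 :: (real^3) set) = aff_dim (UNIV :: complex set) + 1"
    by (simp add: aff_dim_cball)
  ultimately show ?thesis
    using homeomorphic_punctured_sphere_affine_gen[of "cball 0 1 :: (real^3) set" P "UNIV :: complex set"] assms by simp
qed

lemma antipode:
  assumes "p \<in> two_sphere" shows "- p \<in> two_sphere" "p \<noteq> - p"
proof -
  show "- p \<in> two_sphere" using assms by simp
  show "p \<noteq> - p"
  proof
    assume "p = - p"
    then have "2 *\<^sub>R p = 0" by (metis add.right_inverse scaleR_2)
    then show False using assms by auto
  qed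
qed

text \<open>The puncture at the antipode of a point of \<open>U\<close> gives a chart containing
  that point, in which the inverse of the arc would embed an open set of the plane into the
  line.\<close>

lemma sphere_open_not_in_arc:
  assumes \<gamma>: "arc \<gamma>" and U: "openin (top_of_set two_sphere) U" "U \<subseteq> path_image \<gamma>"
  shows "U = {}"
proof (rule ccontr)
  assume "U \<noteq> {}"
  then obtain p where p: "p \<in> U" by blast
  then have "- p \<in> two_sphere" "p \<noteq> - p" using openin_subset[OF U(1)] antipode[of p] by auto
  then obtain h k where hk: "homeomorphism (two_sphere - {- p}) (UNIV :: complex set) h k"
    using punctured_sphere_homeomorphic_plane unfolding homeomorphic_def by blast
  obtain j where j: "homeomorphism {0..1} (path_image \<gamma>) \<gamma> j" using homeomorphism_arc[OF \<gamma>] .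
  define W where "W = U - {- p}"
  have "openin (top_of_set (two_sphere - {- p})) W"
  proof -
    obtain O' where "open O'" "U = two_sphere \<inter> O'" using U(1) openin_open by metis
    then show ?thesis unfolding openin_open W_def by (intro exI[of _ O']) auto
  qed
  then have "openin (top_of_set UNIV) (h ` W)" using hk homeomorphism_imp_open_map by blast
  then have op: "open (h ` W)" by simp
  have W: "W \<subseteq> two_sphere - {- p}" "W \<subseteq> path_image \<gamma>" "p \<in> W"
    using openin_subset[OF U(1)] U(2) p \<open>p \<noteq> - p\<close> by (auto simp: W_def)
  have kh: "k (h w) = w" if "w \<in> W" for w using hk W(1) that by (auto simp: homeomorphism_def)
  have "k ` h ` W = W" using kh by force
  have "continuous_on (h ` W) k" using hk by (auto simp: homeomorphism_def intro: continuous_on_subset)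
  moreover have "continuous_on (k ` h ` W) j"
    using j W(2) \<open>k ` h ` W = W\<close> by (auto simp: homeomorphism_def intro: continuous_on_subset)
  ultimately have "continuous_on (h ` W) (j \<circ> k)" by (rule continuous_on_compose)
  moreover have "inj_on (j \<circ> k) (h ` W)"
  proof (rule comp_inj_on)
    show "inj_on k (h ` W)" using kh by (auto intro: inj_onI)
    show "inj_on j (k ` h ` W)" unfolding \<open>k ` h ` W = W\<close>
      using j W(2) by (auto simp: homeomorphism_def intro!: inj_on_inverseI[of _ \<gamma>])
  qed
  ultimately have "DIM(complex) \<le> DIM(real)" using W(3) by (intro invariance_of_dimension[OF _ op]) auto
  then show False by simp
qed

lemma openin_not_in_finite_Union:
  assumes "finite \<F>" "\<And>C. C \<in> \<F> \<Longrightarrow> closed C" "\<And>C U. \<lbrakk>C \<in> \<F>; openin (top_of_set S) U; U \<subseteq> C\<rbrakk> \<Longrightarrow> U = {}"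
    and "openin (top_of_set S) U" "U \<subseteq> \<Union>\<F>"
  shows "U = {}"
  using assms
proof (induction \<F> arbitrary: U)
  case (insert C \<F>)
  have "U - C = U \<inter> - C" by auto
  moreover have "openin (top_of_set S) (U \<inter> - C)"
    using insert.prems(1)[of C] insert.prems(3) by (intro openin_Int_open) auto
  moreover have "U \<inter> - C = {}"
  proof (rule insert.IH)
    show "closed C'" if "C' \<in> \<F>" for C' using insert.prems(1) that by simp
    show "U' = {}" if "C' \<in> \<F>" "openin (top_of_set S) U'" "U' \<subseteq> C'" for C' U'
      using insert.prems(2)[of C' U'] that by simp
    show "U \<inter> - C \<subseteq> \<Union>\<F>" using insert.prems(4) by auto
  qed (use calculation in simp)
  ultimately have "U - C = {}" by simp
  then show ?case using insert.prems(2)[of C U] insert.prems(3) by blast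
qed simp

text \<open>Supplies the point off the drawing at which the sphere is punctured.\<close>

lemma sphere_not_covered:
  assumes "finite E" "\<And>e. e \<in> E \<Longrightarrow> simple_path (c e)"
  shows "\<not> two_sphere \<subseteq> (\<Union>e\<in>E. path_image (c e :: real \<Rightarrow> real^3))"
proof
  assume a: "two_sphere \<subseteq> (\<Union>e\<in>E. path_image (c e))"
  define \<F> where "\<F> = (\<lambda>e. path_image (subpath 0 (1/2) (c e))) ` E \<union> (\<lambda>e. path_image (subpath (1/2) 1 (c e))) ` E"
  have sub: "path_image (c e) \<subseteq> \<Union>\<F>" if "e \<in> E" for e
    unfolding simple_path_two_arcs(3)[OF assms(2)[OF that]] \<F>_def using that by auto
  have arcs: "\<exists>g. arc g \<and> C = path_image g" if "C \<in> \<F>" for C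
    using that simple_path_two_arcs(1,2)[OF assms(2)] unfolding \<F>_def by auto
  have "(two_sphere :: (real^3) set) = {}"
  proof (rule openin_not_in_finite_Union[of \<F> two_sphere])
    show "finite \<F>" using assms(1) by (simp add: \<F>_def)
    show "closed C" if "C \<in> \<F>" for C using arcs[OF that] closed_arc_image by metis
    show "U = {}" if "C \<in> \<F>" "openin (top_of_set two_sphere) U" "U \<subseteq> C" for C U
      using arcs[OF that(1)] sphere_open_not_in_arc[OF _ that(2)] that(3) by metis
    show "two_sphere \<subseteq> \<Union>\<F>" using a sub by (meson UN_least subset_trans)
  qed simp
  then show False by (simp add: sphere_eq_empty)
qed

section \<open>Faces on the punctured sphere and in the plane\<close>

locale puncture =
  fixes X :: "(real^3) set" and P :: "real^3" and h :: "real^3 \<Rightarrow> complex" and k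
  assumes X: "compact X" "X \<subseteq> two_sphere" and P: "P \<in> two_sphere" "P \<notin> X"
    and hk: "homeomorphism (two_sphere - {P}) (UNIV :: complex set) h k"
begin

lemma hk_simps: "x \<in> two_sphere \<Longrightarrow> x \<noteq> P \<Longrightarrow> k (h x) = x" "h (k z) = z" "k z \<in> two_sphere" "k z \<noteq> P"
proof -
  have "k z \<in> two_sphere - {P}" using hk unfolding homeomorphism_def by blast
  then show "k z \<in> two_sphere" "k z \<noteq> P" by blast+
qed (use hk in \<open>auto simp: homeomorphism_def\<close>)

lemma h_cont: "continuous_on (two_sphere - {P}) h" and k_cont: "continuous_on A k"
  using hk by (auto simp: homeomorphism_def intro: continuous_on_subset)

lemma h_inj: "inj_on h (two_sphere - {P})"
  by (rule inj_on_inverseI[of _ k]) (simp add: hk_simps)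

lemma compact_hX: "compact (h ` X)"
  using X P h_cont by (intro compact_continuous_image) (auto intro: continuous_on_subset)

lemma k_in_X: "k z \<in> X \<longleftrightarrow> z \<in> h ` X"
proof
  assume "k z \<in> X" then show "z \<in> h ` X" using hk_simps(2) by (metis imageI)
next
  assume "z \<in> h ` X"
  then obtain x where x: "x \<in> X" "z = h x" by blast
  then have "x \<in> two_sphere" "x \<noteq> P" using X(2) P(2) by auto
  then show "k z \<in> X" using x hk_simps(1) by simp
qed

lemma h_in_X: "x \<in> two_sphere \<Longrightarrow> x \<noteq> P \<Longrightarrow> h x \<in> h ` X \<longleftrightarrow> x \<in> X"
  using k_in_X[of "h x"] hk_simps(1) by simp

lemma k_open:
  assumes "open B" shows "openin (top_of_set two_sphere) (k ` B)"
proof -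
  have "openin (top_of_set (two_sphere - {P})) (k ` B)"
    using homeomorphism_imp_open_map[OF homeomorphism_symD[OF hk], of B] assms by simp
  moreover have "openin (top_of_set two_sphere) (two_sphere - {P})"
    by (simp add: openin_delete)
  ultimately show ?thesis by (rule openin_trans)
qed

text \<open>The pole together with the image of the complement of a compact disc is a neighbourhood
  of the pole.\<close>

lemma k_open_pole:
  assumes "open B" "- cball 0 R \<subseteq> B" shows "openin (top_of_set two_sphere) (insert P (k ` B))"
proof -
  have "insert P (k ` B) = k ` B \<union> (two_sphere - k ` cball 0 R)"
  proof
    show "insert P (k ` B) \<subseteq> k ` B \<union> (two_sphere - k ` cball 0 R)" using P(1) hk_simps(4) by blast
    show "k ` B \<union> (two_sphere - k ` cball 0 R) \<subseteq> insert P (k ` B)"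
    proof
      fix x assume x: "x \<in> k ` B \<union> (two_sphere - k ` cball 0 R)"
      show "x \<in> insert P (k ` B)"
      proof (cases "x \<in> k ` B \<or> x = P")
        case False
        then have "x = k (h x)" "x \<in> two_sphere - k ` cball 0 R" using x hk_simps(1)[of x] by auto
        then have "h x \<notin> cball 0 R" by (metis DiffD2 imageI)
        then have "h x \<in> B" using assms(2) by blast
        then show ?thesis using \<open>x = k (h x)\<close> by blast
      qed auto
    qed
  qed
  moreover have "compact (k ` cball 0 R)" using k_cont by (intro compact_continuous_image) auto
  then have "open (- k ` cball 0 R)" by (simp add: compact_imp_closed open_Compl)
  then have "openin (top_of_set two_sphere) (two_sphere - k ` cball 0 R)"
    unfolding Diff_eq by (rule openin_open_Int)
  ultimately show ?thesis using openin_Un[OF k_open[OF assms(1)]] by simp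
qed

lemma radius: obtains R where "R > 0" "h ` X \<subseteq> cball 0 R" "connected (- cball (0::complex) R)" "- cball (0::complex) R \<noteq> {}"
proof -
  obtain R where "R > 0" "h ` X \<subseteq> ball 0 R" using compact_imp_bounded[OF compact_hX] bounded_subset_ballD by metis
  moreover have "connected (- cball (0::complex) R)" by (intro connected_complement_bounded_convex) auto
  moreover have "of_real (R + 1) \<in> - cball (0::complex) R" using \<open>R > 0\<close> by (simp add: norm_of_real del: of_real_add)
  ultimately show ?thesis using that[of R] ball_subset_cball by blast
qed

text \<open>A connected set on the sphere may pass through the pole, so it cannot simply be mapped
  to the plane. Instead, the component of \<open>h p\<close> and the rest of the complement are
  carried to disjoint open sets of the sphere, the pole being added to the one that contains a
  neighbourhood of infinity.\<close>

lemma component_iff: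
  assumes p: "p \<in> two_sphere - X" "p \<noteq> P" and q: "q \<in> two_sphere - X" "q \<noteq> P"
  shows "connected_component (two_sphere - X) p q \<longleftrightarrow> connected_component (- h ` X) (h p) (h q)"
proof
  assume "connected_component (- h ` X) (h p) (h q)"
  then obtain B where B: "connected B" "B \<subseteq> - h ` X" "h p \<in> B" "h q \<in> B" unfolding connected_component_def by blast
  have "connected (k ` B)" using B(1) k_cont by (rule connected_continuous_image[rotated])
  moreover have "k ` B \<subseteq> two_sphere - X" using B(2) k_in_X hk_simps(3) by blast
  moreover have "p \<in> k ` B" "q \<in> k ` B" using B(3,4) hk_simps(1)[of p] hk_simps(1)[of q] p q by (metis DiffD1 imageI)+
  ultimately show "connected_component (two_sphere - X) p q" unfolding connected_component_def by blast
next
  assume "connected_component (two_sphere - X) p q"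
  then obtain C where C: "connected C" "C \<subseteq> two_sphere - X" "p \<in> C" "q \<in> C" unfolding connected_component_def by blast
  define A where "A = connected_component_set (- h ` X) (h p)"
  have oX: "open (- h ` X)" using compact_hX by (simp add: compact_imp_closed open_Compl)
  have oA: "open A" unfolding A_def using oX by (rule open_connected_component)
  have oB: "open (- h ` X - A)"
  proof -
    have "- h ` X - A = (\<Union>z\<in>- h ` X - A. connected_component_set (- h ` X) z)" (is "?l = ?r")
    proof
      show "?l \<subseteq> ?r" by (auto simp: connected_component_refl)
      have "w \<in> ?l" if "z \<in> ?l" "w \<in> connected_component_set (- h ` X) z" for z w
        using that connected_component_in[of "- h ` X" z w] unfolding A_def
        by (auto intro: connected_component_trans connected_component_sym)
      then show "?r \<subseteq> ?l" by blast
    qed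
    then show ?thesis using open_connected_component[OF oX] by (metis (no_types, lifting) open_UN)
  qed
  obtain R where R: "R > 0" "h ` X \<subseteq> cball 0 R" "connected (- cball (0::complex) R)" "- cball (0::complex) R \<noteq> {}" by (rule radius)
  \<comment> \<open>The complement of a large disc is connected and misses the drawing, so it lies
    in one of the two sets.\<close>
  have dich: "- cball 0 R \<subseteq> A \<or> - cball 0 R \<subseteq> - h ` X - A"
  proof (cases "- cball 0 R \<inter> A = {}")
    case False
    then obtain w where "w \<in> - cball 0 R" "connected_component (- h ` X) (h p) w" unfolding A_def by auto
    then have "- cball 0 R \<subseteq> connected_component_set (- h ` X) w" using R by (intro connected_component_maximal) auto
    also have "\<dots> = A" unfolding A_def using \<open>connected_component (- h ` X) (h p) w\<close> by (metis connected_component_eq mem_Collect_eq)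
    finally show ?thesis by blast
  qed (use R in auto)
  have "\<exists>T1 T2. openin (top_of_set two_sphere) T1 \<and> openin (top_of_set two_sphere) T2 \<and> T1 \<inter> T2 = {} \<and>
     two_sphere - X \<subseteq> T1 \<union> T2 \<and> T1 - {P} = k ` A \<and> k ` A \<subseteq> T1"
  proof -
    have "inj k" by (rule inj_on_inverseI[of _ h]) (rule hk_simps(2))
    then have "k ` A \<inter> k ` (- h ` X - A) = k ` (A \<inter> (- h ` X - A))" by (rule image_Int[symmetric])
    also have "A \<inter> (- h ` X - A) = {}" by blast
    finally have d: "k ` A \<inter> k ` (- h ` X - A) = {}" by simp
    have P': "P \<notin> k ` B" for B
    proof
      assume "P \<in> k ` B"
      then obtain z where "P = k z" by (rule imageE)
      then show False using hk_simps(4)[of z] by simp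
    qed
    have cov: "x \<in> insert P (k ` A \<union> k ` (- h ` X - A))" if "x \<in> two_sphere - X" for x
    proof (cases "x = P")
      case False
      then have "x = k (h x)" "h x \<notin> h ` X" using hk_simps(1)[of x] h_in_X[of x] that by auto
      then show ?thesis by blast
    qed simp
    from dich show ?thesis
    proof
      assume "- cball 0 R \<subseteq> A"
      show ?thesis
      proof (intro exI conjI)
        show "openin (top_of_set two_sphere) (insert P (k ` A))" by (rule k_open_pole[OF oA]) fact
        show "openin (top_of_set two_sphere) (k ` (- h ` X - A))" by (rule k_open[OF oB])
        show "insert P (k ` A) \<inter> k ` (- h ` X - A) = {}" using d P' by simp
        show "two_sphere - X \<subseteq> insert P (k ` A) \<union> k ` (- h ` X - A)" using cov by (intro subsetI) simp
        show "insert P (k ` A) - {P} = k ` A" using P' by simp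
      qed (rule subset_insertI)
    next
      assume "- cball 0 R \<subseteq> - h ` X - A"
      show ?thesis
      proof (intro exI conjI)
        show "openin (top_of_set two_sphere) (k ` A)" by (rule k_open[OF oA])
        show "openin (top_of_set two_sphere) (insert P (k ` (- h ` X - A)))" by (rule k_open_pole[OF oB]) fact
        show "k ` A \<inter> insert P (k ` (- h ` X - A)) = {}" using d P' by simp
        show "two_sphere - X \<subseteq> k ` A \<union> insert P (k ` (- h ` X - A))" using cov by (intro subsetI) simp
        show "k ` A - {P} = k ` A" using P' by simp
      qed (rule subset_refl)
    qed
  qed
  then obtain T1 T2 where T: "openin (top_of_set two_sphere) T1" "openin (top_of_set two_sphere) T2" "T1 \<inter> T2 = {}"
     "two_sphere - X \<subseteq> T1 \<union> T2" "T1 - {P} = k ` A" "k ` A \<subseteq> T1" by blast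
  obtain O1 O2 where O: "open O1" "T1 = two_sphere \<inter> O1" "open O2" "T2 = two_sphere \<inter> O2"
    using T(1,2) unfolding openin_open by blast
  have "h p \<in> A" unfolding A_def using p h_in_X[of p] by (simp add: connected_component_refl)
  then have "p \<in> k ` A" using hk_simps(1)[of p] p by (metis DiffD1 imageI)
  then have "p \<in> O1" using T(6) O(2) by blast
  have "O1 \<inter> O2 \<inter> C = {}" using T(3) O C(2) by blast
  moreover have "C \<subseteq> O1 \<union> O2" using T(4) O C(2) by blast
  ultimately have "O2 \<inter> C = {}" using connectedD[OF C(1) O(1,3)] C(3) \<open>p \<in> O1\<close> by blast
  then have "q \<in> T1" using T(4) O C(2,4) by blast
  then have "q \<in> k ` A" using T(5) q(2) by blast
  then have "h q \<in> A" using hk_simps(2) by (metis imageE)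
  then show "connected_component (- h ` X) (h p) (h q)" by (simp add: A_def)
qed

text \<open>The pole has a connected neighbourhood off \<open>X\<close>, the image of the complement
  of a large disc with the pole added; a face containing the pole contains all of it. Thus every
  face leaves a trace in the plane.\<close>

lemma pole_component:
  assumes "F \<in> components (two_sphere - X)" shows "F - {P} \<noteq> {}"
proof
  assume e: "F - {P} = {}"
  then have FP: "F = {P}" using in_components_nonempty[OF assms] by blast
  obtain R where R: "R > 0" "h ` X \<subseteq> cball 0 R" "connected (- cball (0::complex) R)" "- cball (0::complex) R \<noteq> {}" by (rule radius)
  define W where "W = k ` (- cball 0 R)"
  have "connected W" unfolding W_def using R(3) k_cont by (rule connected_continuous_image[rotated])
  have Psph: "P islimpt two_sphere"
  proof (rule connected_imp_perfect)
    show "connected two_sphere" by (rule connected_sphere) simp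
    show "two_sphere \<noteq> {x}" for x using antipode[OF P(1)] P(1) by (metis singletonD)
  qed (rule P(1))
  have clo: "P \<in> closure W"
  proof (rule ccontr)
    assume "P \<notin> closure W"
    then obtain \<epsilon> where \<epsilon>: "\<epsilon> > 0" "ball P \<epsilon> \<inter> W = {}"
      using closure_approachable by (metis disjoint_iff dist_commute mem_ball)
    have "openin (top_of_set two_sphere) (insert P W)" unfolding W_def by (rule k_open_pole) (auto simp: open_Compl)
    then obtain Q where Q: "open Q" "insert P W = two_sphere \<inter> Q" unfolding openin_open by blast
    then have "open (Q \<inter> ball P \<epsilon>)" "P \<in> Q \<inter> ball P \<epsilon>" using \<epsilon> by auto
    then obtain y where "y \<in> two_sphere" "y \<in> Q \<inter> ball P \<epsilon>" "y \<noteq> P" using Psph unfolding islimpt_def by blast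
    then have "y \<in> W" using Q(2) by blast
    then show False using \<epsilon>(2) \<open>y \<in> Q \<inter> ball P \<epsilon>\<close> by blast
  qed
  have "connected (insert P W)"
    by (rule connected_intermediate_closure[OF \<open>connected W\<close>]) (use clo closure_subset in auto)
  moreover have "insert P W \<subseteq> two_sphere - X"
    unfolding W_def using P k_in_X hk_simps(3) R(2) by blast
  moreover have "F \<inter> insert P W \<noteq> {}" using FP by simp
  ultimately have "insert P W \<subseteq> F" by (rule components_maximal[OF assms])
  moreover obtain z where "z \<in> - cball (0::complex) R" using R(4) by blast
  then have "k z \<in> insert P W" unfolding W_def by blast
  ultimately have "k z \<in> {P}" using FP by blast
  then show False using hk_simps(4) by simp
qed

definition "plane_face F = h ` (F - {P})"

lemma plane_face_component:
  assumes "p \<in> two_sphere - X" "p \<noteq> P"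
  shows "plane_face (connected_component_set (two_sphere - X) p) = connected_component_set (- h ` X) (h p)"
proof
  show "plane_face (connected_component_set (two_sphere - X) p) \<subseteq> connected_component_set (- h ` X) (h p)"
  proof
    fix z assume "z \<in> plane_face (connected_component_set (two_sphere - X) p)"
    then obtain x where x: "z = h x" "connected_component (two_sphere - X) p x" "x \<noteq> P"
      unfolding plane_face_def by auto
    then have "x \<in> two_sphere - X" using connected_component_in[OF x(2)] by simp
    then show "z \<in> connected_component_set (- h ` X) (h p)"
      using component_iff[OF assms _ x(3)] x(1,2) by simp
  qed
  show "connected_component_set (- h ` X) (h p) \<subseteq> plane_face (connected_component_set (two_sphere - X) p)"
  proof
    fix z assume z: "z \<in> connected_component_set (- h ` X) (h p)"
    then have "k z \<in> two_sphere - X" using connected_component_in[of "- h ` X" "h p" z] k_in_X hk_simps(3) by auto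
    then have "connected_component (two_sphere - X) p (k z)"
      using component_iff[OF assms, of "k z"] z hk_simps(2,4) by simp
    then show "z \<in> plane_face (connected_component_set (two_sphere - X) p)"
      unfolding plane_face_def using hk_simps(2,4) by (intro image_eqI[of _ _ "k z"]) auto
  qed
qed

lemma face_eq:
  assumes "F \<in> components (two_sphere - X)"
  obtains p where "p \<in> two_sphere - X" "p \<noteq> P" "F = connected_component_set (two_sphere - X) p"
proof -
  obtain p where p: "p \<in> F" "p \<noteq> P" using pole_component[OF assms] by blast
  have "F = connected_component_set (two_sphere - X) p"
    using assms p(1) unfolding components_def by (metis (no_types, lifting) connected_component_eq imageE)
  then show ?thesis using that p in_components_subset[OF assms] by blast
qed

lemma plane_face_bij: "bij_betw plane_face (components (two_sphere - X)) (components (- h ` X))"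
proof (rule bij_betwI')
  fix F G assume F: "F \<in> components (two_sphere - X)" and G: "G \<in> components (two_sphere - X)"
  show "plane_face F = plane_face G \<longleftrightarrow> F = G"
  proof
    assume eq: "plane_face F = plane_face G"
    obtain p where p: "p \<in> F" "p \<noteq> P" using pole_component[OF F] by blast
    then obtain q where q: "q \<in> G" "q \<noteq> P" "h p = h q" using eq unfolding plane_face_def by blast
    have "p \<in> two_sphere - {P}" "q \<in> two_sphere - {P}"
      using p q in_components_subset[OF F] in_components_subset[OF G] by auto
    then have "p = q" using h_inj q(3) by (auto simp: inj_on_def)
    then show "F = G" using p q F G components_nonoverlap[of F "two_sphere - X" G] by blast
  qed simp
next
  fix F assume "F \<in> components (two_sphere - X)"
  then obtain p where p: "p \<in> two_sphere - X" "p \<noteq> P" "F = connected_component_set (two_sphere - X) p" by (rule face_eq)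
  then show "plane_face F \<in> components (- h ` X)"
    using plane_face_component[OF p(1,2)] h_in_X[of p] by (auto intro!: componentsI)
next
  fix F' assume "F' \<in> components (- h ` X)"
  then obtain z where z: "z \<notin> h ` X" "F' = connected_component_set (- h ` X) z" unfolding components_def by auto
  then have "k z \<in> two_sphere - X" "k z \<noteq> P" using k_in_X hk_simps by auto
  then show "\<exists>F\<in>components (two_sphere - X). F' = plane_face F"
    using plane_face_component[of "k z"] z hk_simps(2) by (metis componentsI)
qed

lemma plane_face_closure:
  assumes "F \<subseteq> two_sphere" "x \<in> two_sphere" "x \<noteq> P"
  shows "h x \<in> closure (plane_face F) \<longleftrightarrow> x \<in> closure F"
proof
  assume "x \<in> closure F"
  moreover have "closure F \<subseteq> closure (insert P (F - {P}))" by (intro closure_mono) auto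
  moreover have "closure (insert P (F - {P})) = insert P (closure (F - {P}))" by (rule closure_insert)
  ultimately have "x \<in> closure (F - {P})" using assms(3) by blast
  then show "h x \<in> closure (plane_face F)"
    unfolding plane_face_def using assms by (intro closure_continuous_image[OF h_cont]) auto
next
  assume "h x \<in> closure (plane_face F)"
  then have "k (h x) \<in> closure (k ` plane_face F)" by (intro closure_continuous_image[OF k_cont[of UNIV]]) auto
  moreover have "k ` plane_face F \<subseteq> F" unfolding plane_face_def using assms(1) hk_simps(1) by fastforce
  ultimately show "x \<in> closure F" using hk_simps(1)[OF assms(2,3)] closure_mono by (metis subsetD)
qed

end

section \<open>Counting for graphs on the sphere\<close>

text \<open>The contribution of one edge to the degree of a face as a function of the set of faces
  at the edge, so that degrees on the sphere and among flags can be compared edge by edge.\<close>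

definition side_count :: "'f set \<Rightarrow> 'f \<Rightarrow> nat" where
  "side_count \<S> F = (if F \<in> \<S> then if \<S> = {F} then 2 else 1 else 0)"

context cmap
begin

lemma card_label_eq_sum: "card {x \<in> \<Phi>. lab x = F} = (\<Sum>d\<in>D. side_count (sides d) F)"
proof -
  have "card {b. lab (d, b) = F} = side_count (sides d) F" if "d \<in> D" for d
  proof -
    have "{b. lab (d, b) = F} = (if lab (d, True) = F then {True} else {}) \<union> (if lab (d, False) = F then {False} else {})"
      by (auto, (metis (full_types))+)
    then show ?thesis unfolding side_count_def sides_lab[OF that] by auto
  qed
  moreover have "{x \<in> \<Phi>. lab x = F} = (SIGMA d:D. {b. lab (d, b) = F})" by (auto simp: \<Phi>_def)
  ultimately show ?thesis using finD by (simp add: card_SigmaI)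
qed

end

lemma face_degree_eq:
  assumes "finite (edges G)"
  shows "face_degree G F = (\<Sum>e\<in>edges G. side_count (faces_at G e) F)"
proof -
  have "face_degree G F = (\<Sum>e\<in>edges G. if F \<in> faces_at G e then if faces_at G e = {F} then 2 else 1 else 0)"
    unfolding face_degree_def using assms by (subst sum.inter_filter[symmetric]) (auto simp: Int_def)
  then show ?thesis by (simp add: side_count_def)
qed

text \<open>A walk of vertices is followed by darts, with moves between darts at the same vertex and
  moves between the two ends of an edge.\<close>

lemma adjacency_conn:
  assumes "(x, y) \<in> (adjacency G)\<^sup>*"
    and "\<And>d d'. \<lbrakk>d \<in> D; d' \<in> D; tail d = tail d'\<rbrakk> \<Longrightarrow> (d, d') \<in> conn r"
    and "\<And>e. e \<in> edges G \<Longrightarrow> \<exists>d d'. d \<in> D \<and> d' \<in> D \<and> tail d = pathstart (curve G e) \<and> tail d' = pathfinish (curve G e) \<and> (d, d') \<in> conn r"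
    and "d \<in> D" "tail d = x" "d' \<in> D" "tail d' = y"
  shows "(d, d') \<in> conn r"
proof -
  have "\<forall>d'\<in>D. tail d' = y \<longrightarrow> (d, d') \<in> conn r"
    using assms(1)
  proof (induction rule: rtrancl_induct)
    case base
    then show ?case using assms(2,4,5) by metis
  next
    case (step y z)
    obtain e where e: "e \<in> edges G" "(y, z) = (pathstart (curve G e), pathfinish (curve G e)) \<or> (z, y) = (pathstart (curve G e), pathfinish (curve G e))"
      using step(2) unfolding adjacency_def by auto
    obtain d1 d2 where d12: "d1 \<in> D" "d2 \<in> D" "tail d1 = pathstart (curve G e)" "tail d2 = pathfinish (curve G e)" "(d1, d2) \<in> conn r"
      using assms(3)[OF e(1)] by metis
    have "\<exists>a b. a \<in> D \<and> b \<in> D \<and> tail a = y \<and> tail b = z \<and> (a, b) \<in> conn r"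
      using e(2) d12 conn_sym[OF d12(5)] by (elim disjE) auto
    then obtain a b where ab: "a \<in> D" "b \<in> D" "tail a = y" "tail b = z" "(a, b) \<in> conn r" by metis
    have "(d, b) \<in> conn r" using step.IH ab(1,3,5) conn_trans by metis
    then show ?case using assms(2)[OF ab(2)] ab(4) conn_trans by metis
  qed
  then show ?thesis using assms by blast
qed

theorem planar_count:
  fixes G :: "'e drawing" and k l :: nat and \<gamma> :: "real^3 \<Rightarrow> real" and \<kappa> :: "(real^3) set \<Rightarrow> real"
  assumes G: "planar_graph G" "connected_graph G" "edges G \<noteq> {}" and kl: "k > 1" "l > 1"
  defines "\<gamma> \<equiv> \<lambda>v. real (gcd (vertex_degree G v) l) / real l" and "\<kappa> \<equiv> \<lambda>F. real (gcd (face_degree G F) k) / real k"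
  defines "S \<equiv> (\<Sum>v\<in>verts G. \<gamma> v) + (\<Sum>F\<in>faces G. \<kappa> F)"
  shows "finite (faces G)" "card (edges G) + 2 \<le> card (verts G) + card (faces G)"
    "v \<in> verts G \<Longrightarrow> S \<le> card (edges G) + 2 * \<gamma> v" "F \<in> faces G \<Longrightarrow> S \<le> card (edges G) + 2 * \<kappa> F"
proof -
  note pg = G(1)[unfolded planar_graph_def]
  have fin: "finite (verts G)" "finite (edges G)" and sph: "drawn_set G \<subseteq> two_sphere"
    and simp_path: "\<And>e. e \<in> edges G \<Longrightarrow> simple_path (curve G e)"
    and ends: "\<And>e. e \<in> edges G \<Longrightarrow> path_image (curve G e) \<inter> verts G = {pathstart (curve G e), pathfinish (curve G e)}"
    and disj: "\<And>e f. \<lbrakk>e \<in> edges G; f \<in> edges G; e \<noteq> f\<rbrakk> \<Longrightarrow> path_image (curve G e) \<inter> path_image (curve G f) \<subseteq> verts G"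
    using pg by auto
  obtain e0 where e0: "e0 \<in> edges G" using G(3) by blast
  have endV: "pathstart (curve G e) \<in> verts G" "pathfinish (curve G e) \<in> verts G" if "e \<in> edges G" for e
    using ends[OF that] by auto
  \<comment> \<open>Since there is an edge, connectedness excludes isolated vertices; the vertices
    are therefore exactly the tails of darts.\<close>
  have isolated: "\<exists>e\<in>edges G. v = pathstart (curve G e) \<or> v = pathfinish (curve G e)" if "v \<in> verts G" for v
  proof (cases "v = pathstart (curve G e0)")
    case False
    have "(v, pathstart (curve G e0)) \<in> (adjacency G)\<^sup>*"
      using G(2) that endV(1)[OF e0] unfolding connected_graph_def by blast
    then obtain w where "(v, w) \<in> adjacency G" using False by (metis converse_rtranclE)
    then show ?thesis unfolding adjacency_def by auto
  qed (use e0 in blast)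
  have drawn: "drawn_set G = (\<Union>e\<in>edges G. path_image (curve G e))"
  proof -
    have "v \<in> (\<Union>e\<in>edges G. path_image (curve G e))" if "v \<in> verts G" for v
      using isolated[OF that] by (metis UN_I pathfinish_in_path_image pathstart_in_path_image)
    then show ?thesis unfolding drawn_set_def by blast
  qed
  have "\<not> two_sphere \<subseteq> (\<Union>e\<in>edges G. path_image (curve G e))"
    by (rule sphere_not_covered[OF fin(2)]) (rule simp_path)
  then obtain P where P: "P \<in> two_sphere" "P \<notin> drawn_set G"
    unfolding drawn by blast
  obtain h kk where hk: "homeomorphism (two_sphere - {P}) (UNIV :: complex set) h kk"
    using punctured_sphere_homeomorphic_plane[OF P(1)] unfolding homeomorphic_def by blast
  have compact_drawn: "compact (drawn_set G)"
    unfolding drawn using fin(2) simp_path by (intro compact_UN) (auto simp: compact_simple_path_image)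
  interpret puncture "drawn_set G" P h kk
    using compact_drawn sph P hk by unfold_locales
  have sub: "drawn_set G \<subseteq> two_sphere - {P}" using sph P(2) by blast
  have pi_sub: "path_image (curve G e) \<subseteq> two_sphere - {P}" if "e \<in> edges G" for e
    using sub that unfolding drawn by blast
  have V_sub: "verts G \<subseteq> two_sphere - {P}" using sub by (auto simp: drawn_set_def)
  have inj: "h x = h y \<longleftrightarrow> x = y" if "x \<in> two_sphere - {P}" "y \<in> two_sphere - {P}" for x y
    using h_inj that by (auto simp: inj_on_def)
  have img_Int: "h ` A \<inter> h ` B = h ` (A \<inter> B)" if "A \<subseteq> two_sphere - {P}" "B \<subseteq> two_sphere - {P}" for A B
    using inj_on_image_Int[OF h_inj that] by simp
  define c where "c e = h \<circ> curve G e" for e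
  have pic: "path_image (c e) = h ` path_image (curve G e)" for e by (simp add: c_def path_image_compose)
  have psc: "pathstart (c e) = h (pathstart (curve G e))" "pathfinish (c e) = h (pathfinish (curve G e))" for e
    by (simp_all add: c_def pathstart_compose pathfinish_compose)
  interpret pl: plane_drawing "h ` verts G" "edges G" c
  proof
    show "finite (h ` verts G)" "finite (edges G)" using fin by auto
    show "simple_path (c e)" if "e \<in> edges G" for e
      unfolding c_def using simp_path[OF that] pi_sub[OF that] h_cont h_inj
      by (intro simple_path_continuous_image) (auto intro: continuous_on_subset inj_on_subset)
    show "path_image (c e) \<inter> h ` verts G = {pathstart (c e), pathfinish (c e)}" if "e \<in> edges G" for e
      unfolding pic img_Int[OF pi_sub[OF that] V_sub] ends[OF that] psc by simp
    show "path_image (c e) \<inter> path_image (c f) \<subseteq> h ` verts G" if "e \<in> edges G" "f \<in> edges G" "e \<noteq> f" for e f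
      unfolding pic img_Int[OF pi_sub[OF that(1)] pi_sub[OF that(2)]] using disj[OF that] by (rule image_mono)
  qed
  have hX: "pl.X = h ` drawn_set G"
    unfolding pl.X_def drawn_set_def image_Un image_UN pic ..
  have bijF: "bij_betw plane_face (faces G) pl.regions"
    unfolding faces_def pl.regions_def hX by (rule plane_face_bij)
  have faces_sub: "F \<subseteq> two_sphere" if "F \<in> faces G" for F
    using in_components_subset that unfolding faces_def by blast
  have faces_of_iff: "plane_face F \<in> pl.regions_of e \<longleftrightarrow> F \<in> faces_at G e" if "F \<in> faces G" "e \<in> edges G" for F e
  proof -
    have "path_image (c e) \<subseteq> closure (plane_face F) \<longleftrightarrow> path_image (curve G e) \<subseteq> closure F"
      unfolding pic image_subset_iff subset_eq
      using plane_face_closure[OF faces_sub[OF that(1)]] pi_sub[OF that(2)] by blast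
    moreover have "plane_face F \<in> pl.regions" using bijF that(1) by (rule bij_betwE[THEN bspec])
    ultimately show ?thesis using that(1) by (simp add: pl.regions_of_def faces_at_def)
  qed
  have faces_of_eq: "pl.regions_of e = plane_face ` faces_at G e" if "e \<in> edges G" for e
  proof
    show "plane_face ` faces_at G e \<subseteq> pl.regions_of e" using faces_of_iff[OF _ that] by (auto simp: faces_at_def)
    show "pl.regions_of e \<subseteq> plane_face ` faces_at G e"
    proof
      fix F' assume F': "F' \<in> pl.regions_of e"
      then have "F' \<in> plane_face ` faces G" using bijF by (simp add: pl.regions_of_def bij_betw_def)
      then show "F' \<in> plane_face ` faces_at G e" using F' faces_of_iff[OF _ that] by blast
    qed
  qed
  have side_eq: "side_count (pl.regions_of e) (plane_face F) = side_count (faces_at G e) F" if "F \<in> faces G" "e \<in> edges G" for F e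
  proof -
    have "inj_on plane_face (faces G)" using bijF by (rule bij_betw_imp_inj_on)
    moreover have "insert F (faces_at G e) \<subseteq> faces G" using that(1) by (auto simp: faces_at_def)
    ultimately have ij: "inj_on plane_face (insert F (faces_at G e))" by (rule inj_on_subset)
    then have "plane_face ` faces_at G e = {plane_face F} \<longleftrightarrow> faces_at G e = {F}"
      using inj_on_image_eq_iff[OF ij, of "faces_at G e" "{F}"] by (simp add: subset_insertI)
    then show ?thesis using faces_of_iff[OF that] faces_of_eq[OF that(2)] by (simp add: side_count_def)
  qed
  obtain \<rho> f where rot: "bij_betw \<rho> pl.D pl.D" "\<And>d. d \<in> pl.D \<Longrightarrow> pl.tail (\<rho> d) = pl.tail d"
    "\<And>d d'. \<lbrakk>d \<in> pl.D; d' \<in> pl.D; pl.tail d = pl.tail d'\<rbrakk> \<Longrightarrow> \<exists>m. (\<rho> ^^ m) d = d'"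
    "\<And>d. d \<in> pl.D \<Longrightarrow> f d \<in> pl.regions" "\<And>d. d \<in> pl.D \<Longrightarrow> pl.regions_of (fst (\<rho> d)) = {f d, f (\<rho> d)}"
    "\<And>F d. \<lbrakk>F \<in> pl.regions; d \<in> pl.D; pl.tail d \<in> closure F\<rbrakk> \<Longrightarrow> F \<in> f ` pl.D"
    by (rule pl.rotation_system) (rule that, assumption+)
  have tail: "pl.tail (e, b) = h (if b then pathfinish (curve G e) else pathstart (curve G e))" for e b
    by (simp add: pl.tail_def psc)
  have tailD: "pl.tail ` pl.D = h ` verts G"
  proof
    show "pl.tail ` pl.D \<subseteq> h ` verts G" using endV by (auto simp: pl.D_def tail)
    show "h ` verts G \<subseteq> pl.tail ` pl.D"
    proof
      fix x assume "x \<in> h ` verts G"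
      then obtain e where e: "e \<in> edges G" "x = h (pathstart (curve G e)) \<or> x = h (pathfinish (curve G e))"
        using isolated by blast
      then have "x = pl.tail (e, False) \<or> x = pl.tail (e, True)" "(e, False) \<in> pl.D" "(e, True) \<in> pl.D"
        by (auto simp: tail pl.D_def)
      then show "x \<in> pl.tail ` pl.D" by blast
    qed
  qed
  have "pl.regions \<subseteq> f ` pl.D"
    by (rule pl.regions_meet_darts[OF rot(5,1,6)]) (use tailD endV(1)[OF e0] in auto)
  then have fD: "f ` pl.D = pl.regions" using rot(4) by blast
  then have finF: "finite pl.regions" using pl.finD by (metis finite_imageI)
  then show finG: "finite (faces G)" using bijF bij_betw_finite by blast
  have cardF: "card (faces G) = card pl.regions" using bijF by (rule bij_betw_same_card)
  have cardV: "card (h ` verts G) = card (verts G)" using h_inj V_sub by (intro card_image) (rule inj_on_subset)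
  have eul: "card (edges G) + 2 \<le> card (h ` verts G) + card pl.regions"
    using pl.euler_inequality[OF _ finF] endV(1)[OF e0] by blast
  then show "card (edges G) + 2 \<le> card (verts G) + card (faces G)" using cardF cardV by simp
  define opp where "opp d = (fst d, \<not> snd d)" for d :: "'e \<times> bool"
  let ?r = "graph_on \<rho> pl.D \<union> graph_on opp pl.D"
  have cardD: "card pl.D = 2 * card (edges G)" by (simp add: pl.D_def card_cartesian_product)
  have same: "(d, d') \<in> conn ?r" if dd: "d \<in> pl.D" "d' \<in> pl.D" "pl.tail d = pl.tail d'" for d d'
  proof -
    obtain m where "(\<rho> ^^ m) d = d'" using rot(3)[OF dd] by blast
    moreover have "(d, (\<rho> ^^ m) d) \<in> conn (graph_on \<rho> pl.D)"
      using rot(1) dd(1) by (intro funpow_conn) (auto simp: bij_betw_def)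
    moreover have "conn (graph_on \<rho> pl.D) \<subseteq> conn ?r" by (intro conn_least subset_conn) blast
    ultimately show ?thesis by blast
  qed
  interpret cm: cmap pl.D \<rho> opp pl.tail f "\<lambda>d. pl.regions_of (fst d)"
  proof
    show "finite pl.D" by (rule pl.finD)
    show "pl.D \<noteq> {}" using e0 by (auto simp: pl.D_def)
    show "opp d \<in> pl.D" if "d \<in> pl.D" for d using that by (auto simp: opp_def pl.D_def)
    show "card pl.D + 4 \<le> 2 * card (pl.tail ` pl.D) + 2 * card (f ` pl.D)"
      using eul unfolding cardD tailD fD by simp
    fix d d' assume d: "d \<in> pl.D" "d' \<in> pl.D"
    obtain x y where xy: "x \<in> verts G" "h x = pl.tail d" "y \<in> verts G" "h y = pl.tail d'"
    proof -
      have "pl.tail d \<in> h ` verts G" "pl.tail d' \<in> h ` verts G" using d unfolding tailD[symmetric] by blast+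
      then show ?thesis using that by (elim imageE) metis
    qed
    \<comment> \<open>The tail as a point of the sphere, where the adjacency relation of
      \<open>G\<close> lives.\<close>
    define tl where "tl d = kk (pl.tail d)" for d
    have "(x, y) \<in> (adjacency G)\<^sup>*" using G(2) xy unfolding connected_graph_def by blast
    then show "(d, d') \<in> conn ?r"
    proof (rule adjacency_conn[where tail = tl and D = pl.D])
      have kt: "tl d = x \<longleftrightarrow> pl.tail d = h x" if xd: "x \<in> verts G" "d \<in> pl.D" for x d
      proof -
        obtain z where "z \<in> verts G" "pl.tail d = h z" using tailD xd(2) by (metis (no_types, lifting) imageE imageI)
        then show ?thesis unfolding tl_def using hk_simps(1) V_sub xd(1) by (metis Diff_iff singletonI subsetD)
      qed
      show "(d, d') \<in> conn ?r" if "d \<in> pl.D" "d' \<in> pl.D" "tl d = tl d'" for d d'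
        using same[OF that(1,2)] that(3) hk_simps(2) unfolding tl_def by metis
      show "\<exists>d d'. d \<in> pl.D \<and> d' \<in> pl.D \<and> tl d = pathstart (curve G e) \<and> tl d' = pathfinish (curve G e) \<and> (d, d') \<in> conn ?r"
        if "e \<in> edges G" for e
      proof (intro exI conjI)
        show D: "(e, False) \<in> pl.D" "(e, True) \<in> pl.D" using that by (auto simp: pl.D_def)
        show "tl (e, False) = pathstart (curve G e)" "tl (e, True) = pathfinish (curve G e)"
          using kt endV[OF that] D by (simp_all add: tail)
        have "((e, False), (e, True)) \<in> graph_on opp pl.D" using D(1) by (auto simp: graph_on_def opp_def image_iff)
        then show "((e, False), (e, True)) \<in> conn ?r" by (intro conn_base) blast
      qed
      show "tl d = x" "tl d' = y" using kt xy d by simp_all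
    qed (use d in auto)
  qed (use rot in \<open>auto simp: opp_def\<close>)
  have deg: "cm.deg (h x) = vertex_degree G x" if "x \<in> verts G" for x
  proof -
    have hx: "h y = h x \<longleftrightarrow> y = x" if "y \<in> verts G" for y
      by (rule inj) (use V_sub that \<open>x \<in> verts G\<close> in blast)+
    have "{d \<in> pl.D. pl.tail d = h x} = {e \<in> edges G. pathstart (curve G e) = x} \<times> {False} \<union> {e \<in> edges G. pathfinish (curve G e) = x} \<times> {True}"
      (is "?l = ?r")
    proof -
      have "(e, b) \<in> ?l \<longleftrightarrow> (e, b) \<in> ?r" for e b
        using hx endV[of e] by (cases b) (auto simp: pl.D_def tail)
      then show ?thesis by auto
    qed
    then show ?thesis unfolding cm.deg_def vertex_degree_def using fin(2)
      by (simp add: card_Un_disjoint card_cartesian_product Times_Int_Times)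
  qed
  have fdeg: "cm.fdeg (plane_face F) = face_degree G F" if "F \<in> faces G" for F
  proof -
    \<comment> \<open>Both darts of an edge see both of its sides, whence the factor 2 that the
      definition of \<open>fdeg\<close> divides out.\<close>
    have "card {x \<in> cm.\<Phi>. cm.lab x = plane_face F} = (\<Sum>d\<in>pl.D. side_count (pl.regions_of (fst d)) (plane_face F))"
      by (rule cm.card_label_eq_sum)
    also have "\<dots> = (\<Sum>e\<in>edges G. \<Sum>b\<in>(UNIV :: bool set). side_count (pl.regions_of e) (plane_face F))"
      unfolding pl.D_def sum.cartesian_product by (simp only: case_prod_unfold)
    also have "\<dots> = (\<Sum>e\<in>edges G. 2 * side_count (faces_at G e) F)"
      using side_eq[OF that] by (intro sum.cong) auto
    also have "\<dots> = 2 * face_degree G F" using face_degree_eq[OF fin(2)] by (simp add: sum_distrib_left)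
    finally show ?thesis by (simp add: cm.fdeg_def)
  qed
  have sumV: "(\<Sum>v\<in>pl.tail ` pl.D. real (gcd (cm.deg v) l) / real l) = (\<Sum>v\<in>verts G. \<gamma> v)"
    unfolding tailD using h_inj V_sub deg by (subst sum.reindex) (auto simp: \<gamma>_def intro: inj_on_subset)
  have sumF: "(\<Sum>F\<in>f ` pl.D. real (gcd (cm.fdeg F) k) / real k) = (\<Sum>F\<in>faces G. \<kappa> F)"
    unfolding fD sum.reindex_bij_betw[OF bijF, symmetric] using fdeg by (intro sum.cong) (auto simp: \<kappa>_def)
  note count = cm.lifted_count[OF kl, unfolded sumV sumF, folded S_def, unfolded cardD]
  show "S \<le> card (edges G) + 2 * \<gamma> v" if "v \<in> verts G"
    using count(1)[of "h v"] that deg[OF that] tailD by (simp add: \<gamma>_def)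
  show "S \<le> card (edges G) + 2 * \<kappa> F" if "F \<in> faces G"
  proof -
    have "plane_face F \<in> f ` pl.D" unfolding fD using bijF that by (rule bij_betwE[THEN bspec])
    then show ?thesis using count(2)[of "plane_face F"] fdeg[OF that] by (simp add: \<kappa>_def)
  qed
qed

text \<open>Where \<open>m\<close> divides \<open>g x\<close> the greatest common divisor is
  \<open>m\<close>, so the deficit is zero.\<close>

lemma sum_exceptional:
  fixes g :: "'a \<Rightarrow> nat"
  assumes "finite A" "m > 0"
  shows "(\<Sum>x\<in>A. real (gcd (g x) m) / real m) = real (card A) - (\<Sum>x | x \<in> A \<and> \<not> m dvd g x. 1 - real (gcd (g x) m) / real m)"
proof -
  have "(\<Sum>x | x \<in> A \<and> \<not> m dvd g x. 1 - real (gcd (g x) m) / real m) = (\<Sum>x\<in>A. 1 - real (gcd (g x) m) / real m)"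
    using assms by (intro sum.mono_neutral_left) (auto simp: gcd_nat.absorb2)
  then show ?thesis by (simp add: sum_subtractf)
qed

theorem corollary1p4:
  fixes G :: "'e drawing" and k l :: nat
  assumes "planar_graph G" and "connected_graph G"
    and "k > 1" and "l > 1"
  shows "(\<forall>a b u v.
            exceptional_faces G k = {} \<longrightarrow>
            a \<noteq> b \<longrightarrow> exceptional_vertices G l = {a, b} \<longrightarrow>
            u = vertex_degree G a \<longrightarrow> v = vertex_degree G b \<longrightarrow>
            gcd u l = gcd v l)
       \<and> (\<forall>F a u v.
            exceptional_faces G k = {F} \<longrightarrow> exceptional_vertices G l = {a} \<longrightarrow>
            u = face_degree G F \<longrightarrow> v = vertex_degree G a \<longrightarrow>
            k div gcd u k = l div gcd v l)"
proof -
  define \<gamma> where "\<gamma> = (\<lambda>v. real (gcd (vertex_degree G v) l) / real l)"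
  define \<kappa> where "\<kappa> = (\<lambda>F. real (gcd (face_degree G F) k) / real k)"
  have finV: "finite (verts G)" using assms(1) by (simp add: planar_graph_def)
  \<comment> \<open>Every number divides 0, so an exceptional vertex has positive degree and lies on
    an edge.\<close>
  have nonempty: "edges G \<noteq> {}" if "a \<in> exceptional_vertices G l" for a
    using that by (auto simp: exceptional_vertices_def vertex_degree_def)
  \<comment> \<open>The left side is the total deficit, by which the sum of all \<gamma> and
    \<kappa> falls short of V + F \<ge> E + 2; that sum is at most E + 2g.\<close>
  have *: "(\<Sum>v\<in>exceptional_vertices G l. 1 - \<gamma> v) + (\<Sum>F\<in>exceptional_faces G k. 1 - \<kappa> F) \<ge> 2 - 2 * g"
    if "edges G \<noteq> {}" "g \<in> \<gamma> ` verts G \<union> \<kappa> ` faces G" for g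
  proof -
    note pc = planar_count[OF assms(1,2) that(1) assms(3,4)]
    have "(\<Sum>v\<in>verts G. \<gamma> v) + (\<Sum>F\<in>faces G. \<kappa> F) \<le> card (edges G) + 2 * g"
      using that(2) pc(3,4) unfolding \<gamma>_def \<kappa>_def by auto
    moreover have "(\<Sum>v\<in>verts G. \<gamma> v) = real (card (verts G)) - (\<Sum>v\<in>exceptional_vertices G l. 1 - \<gamma> v)"
      unfolding \<gamma>_def exceptional_vertices_def using finV assms(4) by (intro sum_exceptional) auto
    moreover have "(\<Sum>F\<in>faces G. \<kappa> F) = real (card (faces G)) - (\<Sum>F\<in>exceptional_faces G k. 1 - \<kappa> F)"
      unfolding \<kappa>_def exceptional_faces_def using pc(1) assms(3) by (intro sum_exceptional) auto
    moreover have "real (card (edges G)) + 2 \<le> real (card (verts G)) + real (card (faces G))"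
      using pc(2) by linarith
    ultimately show ?thesis by linarith
  qed
  show ?thesis
  proof (intro conjI allI impI)
    fix a b u v assume ex: "exceptional_faces G k = {}" "a \<noteq> b" "exceptional_vertices G l = {a, b}"
      and uv: "u = vertex_degree G a" "v = vertex_degree G b"
    have "edges G \<noteq> {}" using nonempty ex(3) by blast
    moreover have "a \<in> verts G" "b \<in> verts G" using ex(3) by (auto simp: exceptional_vertices_def)
    ultimately have "\<gamma> a = \<gamma> b" using *[of "\<gamma> a"] *[of "\<gamma> b"] ex by auto
    then show "gcd u l = gcd v l" using assms(4) by (simp add: \<gamma>_def uv)
  next
    fix F a u v assume ex: "exceptional_faces G k = {F}" "exceptional_vertices G l = {a}"
      and uv: "u = face_degree G F" "v = vertex_degree G a"
    have "edges G \<noteq> {}" using nonempty ex(2) by blast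
    moreover have "a \<in> verts G" "F \<in> faces G" using ex by (auto simp: exceptional_vertices_def exceptional_faces_def)
    ultimately have "\<gamma> a = \<kappa> F" using *[of "\<gamma> a"] *[of "\<kappa> F"] ex by auto
    then have "real (l div gcd v l) = real (k div gcd u k)"
      using assms(3,4) by (simp add: \<gamma>_def \<kappa>_def uv real_of_nat_div field_simps)
    then show "k div gcd u k = l div gcd v l" by simp
  qed
qed

end
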